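(* Suppose that Assumption A and Assumption B (both stated in the context) hold. Let $0<\sigma<2$ and $0<\delta<1/L_{\nabla h}$, and let $\{(x^k,y^k,u^k)\}$ be generated by the algorithm FPSA described in the context. Suppose that one of the following conditions is fulfilled: (i) $f^*$ is calm at $y^k$ for all sufficiently large $k$, and $\varpi$ possesses the KL property at every point of $\mathrm{dom}\,\partial\varpi$; (ii) $f$ is differentiable with Lipschitz continuous gradient over an open set containing $K(\mathcal S)$, and $\vartheta$, viewed as the function $(x,u)\mapsto\vartheta(x,u;\delta)$, satisfies the KL property at every point of $\mathrm{dom}\,\partial\vartheta$. Then $$\sum_k\big(\|x^k-x^{k+1}\|+\|u^k-u^{k+1}\|\big)<+\infty,$$ and $\{x^k\}$ converges to a (limiting) lifted stationary point of the problem $\min_{x\in\mathcal S}\frac{g(x)+h(x)}{f(Kx)}$.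
   Context: Notation: $\overline{\mathbb R}=\mathbb R\cup\{+\infty\}$; $\|\cdot\|$ is the Euclidean norm; $\iota_{\mathcal S}$ is the indicator function of $\mathcal S$ ($0$ on $\mathcal S$, $+\infty$ elsewhere); $f^*(z)=\sup_w\{\langle w,z\rangle-f(w)\}$ is the convex conjugate; $\mathrm{ri}$, $\mathrm{int}$ denote relative interior and interior. For $\psi:\mathbb R^N\to\overline{\mathbb R}$ finite at $\overline x$, the Fréchet subdifferential is $\hat\partial\psi(\overline x)=\{v:\liminf_{x\to\overline x,x\ne\overline x}\frac{\psi(x)-\psi(\overline x)-\langle v,x-\overline x\rangle}{\|x-\overline x\|}\ge0\}$ and the limiting subdifferential is $\partial\psi(\overline x)=\{v:\exists\,x^k\to\overline x,\ \psi(x^k)\to\psi(\overline x),\ v^k\in\hat\partial\psi(x^k),\ v^k\to v\}$; both coincide with the convex subdifferential for convex functions. Problem: $\min_{x\in\mathcal S}\frac{g(x)+h(x)}{f(Kx)}$, where $\mathcal S\subseteq\mathbb R^n$, $g:\mathbb R^n\to\overline{\mathbb R}$, $h:\mathbb R^n\to\mathbb R$, $f:\mathbb R^p\to\overline{\mathbb R}$, and $K:\mathbb R^n\to\mathbb R^p$ is linear with transpose (adjoint) $K^\top$. Assumption A: (a) $\mathcal S$ is nonempty, convex and compact; (b) $g$ is proper, convex and lower semicontinuous; (c) $h$ (possibly nonconvex) is differentiable with Lipschitz continuous gradient, with Lipschitz constant $L_{\nabla h}$, over an open set containing $\mathcal S$; (d) $f$ is proper, convex and lower semicontinuous, $K(\mathcal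 S)\subseteq\mathrm{int}(\mathrm{dom}\, f)$ and $f(Kx)>0$ for all $x\in\mathcal S$; (e) $\mathcal S\cap\mathrm{dom}\, g\ne\emptyset$ and $\inf_{x\in\mathcal S}\{g(x)+h(x)\}\ge 0$. Assumption B: $\mathrm{ri}(\mathcal S)\cap\mathrm{ri}(\mathrm{dom}\, g)\neq\emptyset$, or $\mathcal S\cap\mathrm{ri}(\mathrm{dom}\, g)\ne\emptyset$ in case $\mathcal S$ is polyhedral. Functions: $\varphi(x,u;\delta)=g(x)+h(x)+\iota_{\mathcal S}(x)+\frac1{2\delta}\|x-u\|^2$ and $\vartheta(x,u;\delta)=\frac{\varphi(x,u;\delta)}{f(Kx)}$ (with value $+\infty$ if $x\notin\mathcal S\cap\mathrm{dom}\,g$). Algorithm FPSA with constants $\delta,\sigma$ ($1/L_{\nabla h}:=+\infty$ if $L_{\nabla h}=0$): start from $x^0\in\mathcal S\cap\mathrm{dom}\,g$, $u^0\in\mathbb R^n$, $\theta_0=\vartheta(x^0,u^0;\delta)$, and for $k=0,1,2,\dots$ choose/compute $$y^{k+1}\in\partial f(Kx^k),$$ $$x^{k+1}\in\arg\min_{x\in\mathcal S}\Big[g(x)+\tfrac1{2\delta}\|x-u^k+\delta\nabla h(x^k)-\theta_k\delta K^\top y^{k+1}\|^2\Big],$$ $$u^{k+1}=(1-\sigma)u^k+\sigma x^{k+1},\qquad \theta_{k+1}=\vartheta(x^{k+1},u^{k+1};\delta).$$ Merit function: $m,M$ are positive scalars with $0<m<\inf_k f(Kx^k)\le\sup_k f(Kx^k)\le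 M$ (such scalars exist under Assumption A). The function $\varpi$ is defined by $\varpi(x,y,u)=\frac{\varphi(x,u;\delta)}{\langle Kx,y\rangle-f^*(y)}$ on $\{(x,y)\in\mathbb R^n\times\mathrm{dom}f^*:\langle Kx,y\rangle-f^*(y)>m/2\}\times\mathbb R^n$ (and $+\infty$ elsewhere). Calmness: a function $\psi:\mathbb R^N\to\overline{\mathbb R}$ is calm at $x\in\mathrm{dom}\,\psi$ if there are $\varrho>0$ and a ball $B(x,\varepsilon)$ with $|\psi(x)-\psi(y)|\le\varrho\|x-y\|$ for all $y\in B(x,\varepsilon)$. KL property: a function $\psi:\mathbb R^N\to(-\infty,+\infty]$ has the Kurdyka-Łojasiewicz property at $\hat x\in\mathrm{dom}\,\partial\psi$ (points where $\partial\psi\neq\emptyset$) if there are $a\in(0,\infty]$, a neighborhood $U$ of $\hat x$, and a continuous concave function $\phi:[0,a)\to[0,\infty)$ with $\phi(0)=0$, continuously differentiable on $(0,a)$ with $\phi'>0$ there, such that $\phi'(\psi(x)-\psi(\hat x))\,\mathrm{dist}(0,\partial\psi(x))\ge1$ for every $x\in U$ with $\psi(\hat x)<\psi(x)<\psi(\hat x)+a$. A point $\overline x$ is a (limiting) lifted stationary point of the problem if $0\in(\partial g(\overline x)+\nabla h(\overline x)+\partial\iota_{\mathcal S}(\overline x))f(K\overline x)-(g(\overline x)+h(\overline x))K^\top\partial f(K\overline x)$. *)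

theory Defs
  imports "HOL-Analysis.Analysis"
begin

text \<open>
  Functions with values in \<open>\<real> \<union> {+\<infinity>}\<close> are modelled as \<^typ>\<open>ereal\<close>-valued functions;
  properness excludes the value \<open>-\<infinity>\<close>.
\<close>

definition effective_domain :: "('a \<Rightarrow> ereal) \<Rightarrow> 'a set" where
  "effective_domain f = {x. f x < \<infinity>}"

definition proper_fun :: "('a \<Rightarrow> ereal) \<Rightarrow> bool" where
  "proper_fun f \<longleftrightarrow> (\<forall>x. f x \<noteq> -\<infinity>) \<and> effective_domain f \<noteq> {}"

definition convex_fun :: "('a::real_vector \<Rightarrow> ereal) \<Rightarrow> bool" where
  "convex_fun f \<longleftrightarrow> convex {(x, r::real). f x \<le> ereal r}"

definition lsc_fun :: "('a::topological_space \<Rightarrow> ereal) \<Rightarrow> bool" where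
  "lsc_fun f \<longleftrightarrow> (\<forall>x. f x \<le> Liminf (at x) f)"

definition indicator_fun :: "'a set \<Rightarrow> 'a \<Rightarrow> ereal" where
  "indicator_fun S x = (if x \<in> S then 0 else \<infinity>)"

definition convex_conjugate :: "('a::real_inner \<Rightarrow> ereal) \<Rightarrow> 'a \<Rightarrow> ereal" where
  "convex_conjugate f z = (SUP w. ereal (w \<bullet> z) - f w)"

definition frechet_subdifferential :: "('a::euclidean_space \<Rightarrow> ereal) \<Rightarrow> 'a \<Rightarrow> 'a set" where
  "frechet_subdifferential \<psi> a =
     {v. \<bar>\<psi> a\<bar> \<noteq> \<infinity> \<and>
         0 \<le> Liminf (at a) (\<lambda>x. (\<psi> x - \<psi> a - ereal (v \<bullet> (x - a))) / ereal (norm (x - a)))}"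

definition limiting_subdifferential :: "('a::euclidean_space \<Rightarrow> ereal) \<Rightarrow> 'a \<Rightarrow> 'a set" where
  "limiting_subdifferential \<psi> a =
     {v. \<bar>\<psi> a\<bar> \<noteq> \<infinity> \<and>
         (\<exists>xs vs. xs \<longlonglongrightarrow> a \<and> (\<lambda>k. \<psi> (xs k)) \<longlonglongrightarrow> \<psi> a \<and>
            (\<forall>k. vs k \<in> frechet_subdifferential \<psi> (xs k)) \<and> vs \<longlonglongrightarrow> v)}"

definition gradient :: "('a::euclidean_space \<Rightarrow> real) \<Rightarrow> 'a \<Rightarrow> 'a" where
  "gradient F x = (THE D. GDERIV F x :> D)"

lemma gradient_eq: "gradient F x = D" if "GDERIV F x :> D"
proof -
  have "D' = D" if "GDERIV F x :> D'" for D'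
  proof -
    have "(\<lambda>v. v \<bullet> D') = (\<lambda>v. v \<bullet> D)"
      using that \<open>GDERIV F x :> D\<close> unfolding gderiv_def by (rule has_derivative_unique)
    then show ?thesis
      by (metis vector_eq_ldot)
  qed
  with that show ?thesis
    unfolding gradient_def by (intro the_equality)
qed

definition lipschitz_gradient_on ::
    "real \<Rightarrow> 'a::euclidean_space set \<Rightarrow> ('a \<Rightarrow> real) \<Rightarrow> bool" where
  "lipschitz_gradient_on L U F \<longleftrightarrow>
     (\<forall>x\<in>U. F differentiable (at x)) \<and> L-lipschitz_on U (gradient F)"

definition calm_at :: "('a::euclidean_space \<Rightarrow> ereal) \<Rightarrow> 'a \<Rightarrow> bool" where
  "calm_at \<psi> x \<longleftrightarrow> x \<in> effective_domain \<psi> \<and>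
     (\<exists>\<rho>>0. \<exists>\<epsilon>>0. \<forall>y\<in>ball x \<epsilon>. \<bar>\<psi> x - \<psi> y\<bar> \<le> ereal (\<rho> * norm (x - y)))"

text \<open>
  The distance to the origin is an extended real because it has to be \<open>+\<infinity>\<close> for the empty set,
  whereas \<^const>\<open>infdist\<close> yields \<open>0\<close> in that case.
\<close>

definition dist_zero :: "'a::real_normed_vector set \<Rightarrow> ereal" where
  "dist_zero A = (INF v\<in>A. ereal (dist 0 v))"

definition desingularizing :: "ereal \<Rightarrow> (real \<Rightarrow> real) \<Rightarrow> bool" where
  "desingularizing a \<phi> \<longleftrightarrow>
     (\<forall>t. 0 \<le> t \<and> ereal t < a \<longrightarrow> 0 \<le> \<phi> t) \<and>
     continuous_on {t. 0 \<le> t \<and> ereal t < a} \<phi> \<and>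
     concave_on {t. 0 \<le> t \<and> ereal t < a} \<phi> \<and>
     \<phi> 0 = 0 \<and>
     (\<forall>t. 0 < t \<and> ereal t < a \<longrightarrow> \<phi> differentiable (at t) \<and> 0 < deriv \<phi> t) \<and>
     continuous_on {t. 0 < t \<and> ereal t < a} (deriv \<phi>)"

definition KL_property_at :: "('a::euclidean_space \<Rightarrow> ereal) \<Rightarrow> 'a \<Rightarrow> bool" where
  "KL_property_at \<psi> a \<longleftrightarrow> limiting_subdifferential \<psi> a \<noteq> {} \<and>
     (\<exists>(\<eta>::ereal) U \<phi>. 0 < \<eta> \<and> open U \<and> a \<in> U \<and> desingularizing \<eta> \<phi> \<and>
        (\<forall>x\<in>U. \<psi> a < \<psi> x \<and> \<psi> x < \<psi> a + \<eta> \<longrightarrow>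
           1 \<le> ereal (deriv \<phi> (real_of_ereal (\<psi> x - \<psi> a))) *
               dist_zero (limiting_subdifferential \<psi> x)))"

definition KL_function :: "('a::euclidean_space \<Rightarrow> ereal) \<Rightarrow> bool" where
  "KL_function \<psi> \<longleftrightarrow>
     (\<forall>a. limiting_subdifferential \<psi> a \<noteq> {} \<longrightarrow> KL_property_at \<psi> a)"

definition phi_fun ::
    "'a::euclidean_space set \<Rightarrow> ('a \<Rightarrow> ereal) \<Rightarrow> ('a \<Rightarrow> real) \<Rightarrow> real \<Rightarrow> 'a \<Rightarrow> 'a \<Rightarrow> ereal" where
  "phi_fun S g h \<delta> x u =
     g x + ereal (h x) + indicator_fun S x + ereal (1 / (2 * \<delta>) * (norm (x - u))\<^sup>2)"

definition vartheta_fun ::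
    "'a::euclidean_space set \<Rightarrow> ('a \<Rightarrow> ereal) \<Rightarrow> ('a \<Rightarrow> real) \<Rightarrow> ('b::euclidean_space \<Rightarrow> ereal) \<Rightarrow>
     ('a \<Rightarrow> 'b) \<Rightarrow> real \<Rightarrow> 'a \<Rightarrow> 'a \<Rightarrow> ereal" where
  "vartheta_fun S g h f K \<delta> x u =
     (if x \<in> S \<inter> effective_domain g then phi_fun S g h \<delta> x u / f (K x) else \<infinity>)"

definition varpi_fun ::
    "'a::euclidean_space set \<Rightarrow> ('a \<Rightarrow> ereal) \<Rightarrow> ('a \<Rightarrow> real) \<Rightarrow> ('b::euclidean_space \<Rightarrow> ereal) \<Rightarrow>
     ('a \<Rightarrow> 'b) \<Rightarrow> real \<Rightarrow> real \<Rightarrow> 'a \<Rightarrow> 'b \<Rightarrow> 'a \<Rightarrow> ereal" where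
  "varpi_fun S g h f K \<delta> m x y u =
     (if y \<in> effective_domain (convex_conjugate f) \<and>
         ereal (m / 2) < ereal (K x \<bullet> y) - convex_conjugate f y
      then phi_fun S g h \<delta> x u / (ereal (K x \<bullet> y) - convex_conjugate f y)
      else \<infinity>)"

text \<open>
  The equation \<open>ereal (\<theta> k) = \<dots>\<close> records that \<open>\<theta> k\<close> is a real number: \<open>x k\<close> stays in
  \<open>S \<inter> dom g\<close>. The iterates \<open>y k\<close> are generated for \<open>k \<ge> 1\<close> only, so \<open>y 0\<close> is unconstrained.
\<close>

definition FPSA ::
    "'a::euclidean_space set \<Rightarrow> ('a \<Rightarrow> ereal) \<Rightarrow> ('a \<Rightarrow> real) \<Rightarrow> ('b::euclidean_space \<Rightarrow> ereal) \<Rightarrow>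
     ('a \<Rightarrow> 'b) \<Rightarrow> real \<Rightarrow> real \<Rightarrow>
     (nat \<Rightarrow> 'a) \<Rightarrow> (nat \<Rightarrow> 'b) \<Rightarrow> (nat \<Rightarrow> 'a) \<Rightarrow> (nat \<Rightarrow> real) \<Rightarrow> bool" where
  "FPSA S g h f K \<delta> \<sigma> x y u \<theta> \<longleftrightarrow>
     x 0 \<in> S \<inter> effective_domain g \<and>
     (\<forall>k. ereal (\<theta> k) = vartheta_fun S g h f K \<delta> (x k) (u k)) \<and>
     (\<forall>k. y (Suc k) \<in> limiting_subdifferential f (K (x k))) \<and>
     (\<forall>k. is_arg_min
            (\<lambda>z. g z + ereal (1 / (2 * \<delta>) *
                   (norm (z - u k + \<delta> *\<^sub>R gradient h (x k)
                            - (\<theta> k * \<delta>) *\<^sub>R adjoint K (y (Suc k))))\<^sup>2))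
            (\<lambda>z. z \<in> S) (x (Suc k))) \<and>
     (\<forall>k. u (Suc k) = (1 - \<sigma>) *\<^sub>R u k + \<sigma> *\<^sub>R x (Suc k))"

text \<open>
  A witness forces \<open>g x\<close> and \<open>f (K x)\<close> to be finite and \<open>x \<in> S\<close>, because all subdifferentials
  are empty elsewhere; hence \<^const>\<open>real_of_ereal\<close> is only applied to finite values.
\<close>

definition lifted_stationary ::
    "'a::euclidean_space set \<Rightarrow> ('a \<Rightarrow> ereal) \<Rightarrow> ('a \<Rightarrow> real) \<Rightarrow> ('b::euclidean_space \<Rightarrow> ereal) \<Rightarrow>
     ('a \<Rightarrow> 'b) \<Rightarrow> 'a \<Rightarrow> bool" where
  "lifted_stationary S g h f K x \<longleftrightarrow>
     0 \<in> {real_of_ereal (f (K x)) *\<^sub>R (v + gradient h x + w)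
           - real_of_ereal (g x + ereal (h x)) *\<^sub>R adjoint K z | v w z.
          v \<in> limiting_subdifferential g x \<and>
          w \<in> limiting_subdifferential (indicator_fun S) x \<and>
          z \<in> limiting_subdifferential f (K x)}"

end

theory Submission
  imports Defs
begin

text \<open>
Write \<open>\<Delta> k\<close> for \<open>\<parallel>x k - x (Suc k)\<parallel> + \<parallel>u k - u (Suc k)\<parallel>\<close>. The proof is the descent scheme for functions with the
Kurdyka-Lojasiewicz (KL) property. It needs a merit function \<open>\<psi>\<close> whose values \<open>r k\<close> along the
iterates decrease by at least a multiple of \<open>(\<Delta> k)\<^sup>2\<close>, together with subgradients \<open>w k\<close> of \<open>\<psi>\<close> at the
iterates that are small when the steps are small. The KL inequality at the cluster points then
turns the decrease of \<open>r\<close> into summability of \<open>\<Delta>\<close> (lemma \<open>KL_function_finite_length\<close>). The bound on the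
subgradients is allowed to have the form \<open>C * (\<Delta> k + (r k - r (Suc k)))\<close>. The extra term telescopes,
so it costs nothing, and it takes the place of an estimate of the decrease of \<open>r\<close> by the steps.

For the decrease, the first-order condition of the proximal step says that the vector \<open>\<xi> k\<close> is a
subgradient of \<open>g\<close> restricted to \<open>S\<close> at \<open>x (Suc k)\<close>. Combined with the quadratic upper bound for \<open>h\<close>
and with the relaxation of \<open>u\<close>, it bounds the new numerator by \<open>\<theta> k\<close> times the linearization \<open>den k\<close>
of \<open>f \<circ> K\<close> at \<open>x k\<close>, minus a multiple of \<open>(\<Delta> k)\<^sup>2\<close> (lemma \<open>numerator_descent\<close>). Dividing by any number
between \<open>den k\<close> and \<open>M\<close> gives a descent inequality. If \<open>f\<close> is smooth, the divisor \<open>f (K (x (Suc k)))\<close> gives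
the values \<open>\<theta>\<close> of \<open>\<vartheta>\<close>. Otherwise the divisor \<open>den k\<close> itself, which is eventually positive, gives the values \<open>\<omega>\<close> of \<open>\<varpi>\<close> at
\<open>(x (Suc k), y (Suc k), u (Suc k))\<close>. The two sequences eventually interlace,
\<open>\<theta> (Suc k) \<le> \<omega> k \<le> \<theta> k\<close>, and so they have the same limit.

For the subgradients, both merit functions are quotients with a nonnegative numerator that has a
first-order minorant and a denominator that has a first-order majorant. This alone makes the usual
quotient rule produce a regular subgradient (lemma \<open>quotient_frechet_subgradient\<close>). In \<open>\<varpi>\<close> the
majorant is the Fenchel-Young inequality, because \<open>K (x k)\<close> is a subgradient of the conjugate at
\<open>y (Suc k)\<close>. The \<open>y\<close> iterates need not converge, which is why the KL inequality is used on
a finite cover of the closure of the iterates and not near one point.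

Once \<open>x\<close> converges to \<open>p\<close>, the vectors \<open>\<xi> k\<close> converge along a subsequence to a subgradient at \<open>p\<close>
of \<open>g\<close> restricted to \<open>S\<close> (lemma \<open>cluster_point_properties\<close>). The constraint qualification splits it into a subgradient of
\<open>g\<close> and a normal vector of \<open>S\<close> (lemmas \<open>normal_separation_rel_interior\<close> and
\<open>normal_separation_polytope\<close>), and this is lifted stationarity.
\<close>

section \<open>Subgradients of convex functions\<close>

lemma frechet_subdifferentialI:
  fixes \<psi> :: "'a::euclidean_space \<Rightarrow> ereal"
  assumes "\<psi> a = ereal c"
    and "\<And>\<epsilon>. 0 < \<epsilon> \<Longrightarrow> \<forall>\<^sub>F z in at a. ereal (c + v \<bullet> (z - a) - \<epsilon> * norm (z - a)) \<le> \<psi> z"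
  shows "v \<in> frechet_subdifferential \<psi> a"
proof -
  have "0 \<le> Liminf (at a) (\<lambda>z. (\<psi> z - \<psi> a - ereal (v \<bullet> (z - a))) / ereal (norm (z - a)))"
    unfolding le_Liminf_iff
  proof (intro allI impI)
    fix y :: ereal
    assume "y < 0"
    then obtain e where e: "y < ereal (- e)" "0 < e"
      using that[of 1] that[of "- real_of_ereal y / 2"] by (cases y) auto
    from assms(2)[OF e(2)]
    show "\<forall>\<^sub>F z in at a. y < (\<psi> z - \<psi> a - ereal (v \<bullet> (z - a))) / ereal (norm (z - a))"
      using eventually_neq_at_within[of a a UNIV]
    proof eventually_elim
      case (elim z)
      then have n: "norm (z - a) > 0"
        by simp
      have "ereal (- e) \<le> (\<psi> z - \<psi> a - ereal (v \<bullet> (z - a))) / ereal (norm (z - a))"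
        using elim(1) n assms(1) by (cases "\<psi> z") (auto simp: field_simps)
      with e(1) show ?case
        by simp
    qed
  qed
  with assms(1) show ?thesis
    by (simp add: frechet_subdifferential_def)
qed

lemma frechet_subdifferentialD:
  fixes \<psi> :: "'a::euclidean_space \<Rightarrow> ereal"
  assumes v: "v \<in> frechet_subdifferential \<psi> a" and c: "\<psi> a = ereal c" and \<epsilon>: "0 < \<epsilon>"
  shows "\<forall>\<^sub>F z in at a. ereal (c + v \<bullet> (z - a) - \<epsilon> * norm (z - a)) \<le> \<psi> z"
proof -
  have "0 \<le> Liminf (at a) (\<lambda>z. (\<psi> z - \<psi> a - ereal (v \<bullet> (z - a))) / ereal (norm (z - a)))"
    using v by (simp add: frechet_subdifferential_def)
  moreover have "ereal (- \<epsilon>) < 0"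
    using \<epsilon> by simp
  ultimately have "\<forall>\<^sub>F z in at a. ereal (- \<epsilon>) < (\<psi> z - \<psi> a - ereal (v \<bullet> (z - a))) / ereal (norm (z - a))"
    unfolding le_Liminf_iff by blast
  then show ?thesis
    using eventually_neq_at_within[of a a UNIV]
  proof eventually_elim
    case (elim z)
    then have n: "norm (z - a) > 0"
      by simp
    show ?case
      using elim(1) n c by (cases "\<psi> z") (auto simp: field_simps)
  qed
qed

text \<open>
For proper convex functions this global inequality describes the limiting subdifferential: the
lemmas \<open>is_subgradient_imp_limiting\<close> and \<open>limiting_imp_is_subgradient\<close> are the two inclusions.
\<close>

definition is_subgradient :: "('a::real_inner \<Rightarrow> ereal) \<Rightarrow> 'a \<Rightarrow> 'a \<Rightarrow> bool" where
  "is_subgradient \<psi> a v \<longleftrightarrow> \<bar>\<psi> a\<bar> \<noteq> \<infinity> \<and> (\<forall>z. \<psi> a + ereal (v \<bullet> (z - a)) \<le> \<psi> z)"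

lemma frechet_subset_limiting:
  "frechet_subdifferential \<psi> a \<subseteq> limiting_subdifferential \<psi> a"
proof
  fix v assume v: "v \<in> frechet_subdifferential \<psi> a"
  then have "\<bar>\<psi> a\<bar> \<noteq> \<infinity>"
    by (simp add: frechet_subdifferential_def)
  with v show "v \<in> limiting_subdifferential \<psi> a"
    unfolding limiting_subdifferential_def mem_Collect_eq
    by (intro conjI exI[of _ "\<lambda>_. a"] exI[of _ "\<lambda>_. v"]) auto
qed

lemma is_subgradient_imp_limiting:
  fixes \<psi> :: "'a::euclidean_space \<Rightarrow> ereal"
  assumes "is_subgradient \<psi> a v"
  shows "v \<in> limiting_subdifferential \<psi> a"
proof -
  obtain c where c: "\<psi> a = ereal c"
    using assms by (cases "\<psi> a") (auto simp: is_subgradient_def)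
  have "v \<in> frechet_subdifferential \<psi> a"
  proof (rule frechet_subdifferentialI[where \<psi> = \<psi>, OF c])
    fix \<epsilon> :: real assume "0 < \<epsilon>"
    show "\<forall>\<^sub>F z in at a. ereal (c + v \<bullet> (z - a) - \<epsilon> * norm (z - a)) \<le> \<psi> z"
    proof (rule always_eventually, rule allI)
      fix z
      have "ereal (c + v \<bullet> (z - a) - \<epsilon> * norm (z - a)) \<le> ereal (c + v \<bullet> (z - a))"
        using \<open>0 < \<epsilon>\<close> by simp
      also have "\<dots> \<le> \<psi> z"
        using assms c by (simp add: is_subgradient_def)
      finally show "ereal (c + v \<bullet> (z - a) - \<epsilon> * norm (z - a)) \<le> \<psi> z" .
    qed
  qed
  then show ?thesis
    using frechet_subset_limiting by blast
qed

lemma convex_funD: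
  assumes "convex_fun \<psi>" "\<psi> a = ereal c" "\<psi> b = ereal d" "0 \<le> t" "t \<le> 1"
  shows "\<psi> (a + t *\<^sub>R (b - a)) \<le> ereal (c + t * (d - c))"
proof -
  have "(a, c) \<in> {(x, r::real). \<psi> x \<le> ereal r}" "(b, d) \<in> {(x, r::real). \<psi> x \<le> ereal r}"
    using assms by auto
  then have "(1 - t) *\<^sub>R (a, c) + t *\<^sub>R (b, d) \<in> {(x, r::real). \<psi> x \<le> ereal r}"
    using assms(1,4,5) unfolding convex_fun_def by (intro convexD_alt)
  moreover have "(1 - t) *\<^sub>R (a, c) + t *\<^sub>R (b, d) = (a + t *\<^sub>R (b - a), c + t * (d - c))"
    by (simp add: algebra_simps)
  ultimately show ?thesis
    by simp
qed

text \<open>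
Along the segment from \<open>a\<close> to \<open>z\<close>, convexity bounds the increments of \<open>\<psi>\<close> from above by a linear
function of the parameter, and the regular subgradient inequality bounds them from below up to an
error \<open>\<epsilon>\<close>. Dividing by the parameter removes the local character of the second bound.
\<close>

lemma frechet_imp_is_subgradient:
  fixes \<psi> :: "'a::euclidean_space \<Rightarrow> ereal"
  assumes \<psi>: "convex_fun \<psi>" "\<And>z. \<psi> z \<noteq> -\<infinity>" and v: "v \<in> frechet_subdifferential \<psi> a"
  shows "is_subgradient \<psi> a v"
proof -
  obtain c where c: "\<psi> a = ereal c"
    using v by (cases "\<psi> a") (auto simp: frechet_subdifferential_def)
  have "ereal (c + v \<bullet> (z - a)) \<le> \<psi> z" for z
  proof (cases "\<psi> z")
    case (real d)
    have "v \<bullet> (z - a) \<le> d - c + \<epsilon>" if "0 < \<epsilon>" for \<epsilon>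
    proof (cases "z = a")
      case True
      then show ?thesis using real c that by simp
    next
      case False
      define e where "e = \<epsilon> / norm (z - a)"
      have e: "0 < e" "e * norm (z - a) = \<epsilon>"
        using that False by (auto simp: e_def)
      have lim: "filterlim (\<lambda>t. a + t *\<^sub>R (z - a)) (at a) (at_right (0::real))"
        unfolding filterlim_at
      proof
        show "\<forall>\<^sub>F t in at_right (0::real). a + t *\<^sub>R (z - a) \<in> UNIV \<and> a + t *\<^sub>R (z - a) \<noteq> a"
          using False by (auto simp: eventually_at_filter)
        show "((\<lambda>t. a + t *\<^sub>R (z - a)) \<longlongrightarrow> a) (at_right (0::real))"
          by (auto intro!: tendsto_eq_intros)
      qed
      have ev: "\<forall>\<^sub>F t in at_right 0. ereal (c + v \<bullet> ((a + t *\<^sub>R (z - a)) - a)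
          - e * norm ((a + t *\<^sub>R (z - a)) - a)) \<le> \<psi> (a + t *\<^sub>R (z - a))"
        using lim frechet_subdifferentialD[OF v c e(1)] by (rule eventually_compose_filterlim[rotated])
      moreover have "\<forall>\<^sub>F t in at_right (0::real). 0 < t \<and> t < 1"
        using eventually_at_right_real[of 0 1] by simp
      ultimately have "\<forall>\<^sub>F t in at_right (0::real). v \<bullet> (z - a) \<le> d - c + \<epsilon>"
      proof eventually_elim
        case (elim t)
        have "ereal (c + v \<bullet> ((a + t *\<^sub>R (z - a)) - a) - e * norm ((a + t *\<^sub>R (z - a)) - a))
            \<le> ereal (c + t * (d - c))"
          using elim convex_funD[OF \<psi>(1) c real, of t] by (meson less_imp_le order_trans)
        then have "t * (v \<bullet> (z - a)) - t * (e * norm (z - a)) \<le> t * (d - c)"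
          using elim by (simp add: mult_ac)
        then have "t * (v \<bullet> (z - a)) \<le> t * (d - c + \<epsilon>)"
          unfolding e(2) by (simp add: algebra_simps)
        then show ?case
          using elim by simp
      qed
      then show ?thesis
        using trivial_limit_at_right_real by fastforce
    qed
    then have "v \<bullet> (z - a) \<le> d - c"
      by (rule field_le_epsilon)
    then show ?thesis
      using real by simp
  qed (use \<psi>(2) in auto)
  then show ?thesis
    using c by (simp add: is_subgradient_def)
qed

text \<open>
The global inequality passes to the limit because \<open>\<psi> (xs k)\<close> converges to \<open>\<psi> a\<close>, which is part of the
definition of a limiting subgradient.
\<close>

lemma limiting_imp_is_subgradient:
  fixes \<psi> :: "'a::euclidean_space \<Rightarrow> ereal"
  assumes \<psi>: "convex_fun \<psi>" "proper_fun \<psi>" and v: "v \<in> limiting_subdifferential \<psi> a"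
  shows "is_subgradient \<psi> a v"
proof -
  from v obtain xs vs where fin: "\<bar>\<psi> a\<bar> \<noteq> \<infinity>" and xs: "xs \<longlonglongrightarrow> a" "(\<lambda>k. \<psi> (xs k)) \<longlonglongrightarrow> \<psi> a"
    and vs: "\<And>k. vs k \<in> frechet_subdifferential \<psi> (xs k)" "vs \<longlonglongrightarrow> v"
    by (auto simp: limiting_subdifferential_def)
  have "\<psi> a + ereal (v \<bullet> (z - a)) \<le> \<psi> z" for z
  proof (rule LIMSEQ_le_const2)
    show "(\<lambda>k. \<psi> (xs k) + ereal (vs k \<bullet> (z - xs k))) \<longlonglongrightarrow> \<psi> a + ereal (v \<bullet> (z - a))"
      by (intro tendsto_add_ereal_general1 tendsto_ereal tendsto_intros xs vs) (use fin in auto)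
    show "\<exists>N. \<forall>k\<ge>N. \<psi> (xs k) + ereal (vs k \<bullet> (z - xs k)) \<le> \<psi> z"
      using frechet_imp_is_subgradient[OF \<psi>(1) _ vs(1)] \<psi>(2)
      by (auto simp: is_subgradient_def proper_fun_def)
  qed
  with fin show ?thesis
    by (simp add: is_subgradient_def)
qed


lemma proper_real:
  assumes "proper_fun \<psi>" "z \<in> effective_domain \<psi>"
  shows "\<psi> z = ereal (real_of_ereal (\<psi> z))"
  using assms by (cases "\<psi> z") (auto simp: proper_fun_def effective_domain_def)

lemma convex_on_real_of_convex_fun:
  assumes "convex_fun \<psi>" "proper_fun \<psi>"
  shows "convex_on (effective_domain \<psi>) (\<lambda>z. real_of_ereal (\<psi> z))"
proof -
  note real = proper_real[OF assms(2)]
  have le: "\<psi> ((1 - t) *\<^sub>R a + t *\<^sub>R b) \<le> ereal ((1 - t) * real_of_ereal (\<psi> a) + t * real_of_ereal (\<psi> b))"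
    if "a \<in> effective_domain \<psi>" "b \<in> effective_domain \<psi>" "0 \<le> t" "t \<le> 1" for a b t
    using convex_funD[OF assms(1) real[OF that(1)] real[OF that(2)] that(3,4)]
    by (simp add: algebra_simps)
  have conv: "convex (effective_domain \<psi>)"
    unfolding convex_alt
  proof (intro ballI allI impI)
    fix a b and t :: real
    assume *: "a \<in> effective_domain \<psi>" "b \<in> effective_domain \<psi>" "0 \<le> t \<and> t \<le> 1"
    show "(1 - t) *\<^sub>R a + t *\<^sub>R b \<in> effective_domain \<psi>"
      using le[of a b t] * unfolding effective_domain_def by (auto intro: le_less_trans)
  qed
  show ?thesis
  proof (rule convex_onI[OF _ conv])
    fix t :: real and a b
    assume *: "0 < t" "t < 1" "a \<in> effective_domain \<psi>" "b \<in> effective_domain \<psi>"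
    then have "(1 - t) *\<^sub>R a + t *\<^sub>R b \<in> effective_domain \<psi>"
      using conv by (intro convexD_alt) auto
    then show "real_of_ereal (\<psi> ((1 - t) *\<^sub>R a + t *\<^sub>R b))
        \<le> (1 - t) * real_of_ereal (\<psi> a) + t * real_of_ereal (\<psi> b)"
      using le[of a b t] * real by (metis ereal_less_eq(3) less_imp_le)
  qed
qed

lemma lsc_fun_sequentially:
  assumes "lsc_fun \<psi>" "xs \<longlonglongrightarrow> p" "(\<lambda>j. \<psi> (xs j)) \<longlonglongrightarrow> \<gamma>"
  shows "\<psi> p \<le> \<gamma>"
proof (rule ccontr)
  assume "\<not> \<psi> p \<le> \<gamma>"
  then obtain c where c: "\<gamma> < c" "c < \<psi> p"
    by (meson dense not_le)
  then have "c < Liminf (at p) \<psi>"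
    using assms(1) less_le_trans unfolding lsc_fun_def by fast
  then have "\<forall>\<^sub>F z in at p. c < \<psi> z"
    by (rule less_LiminfD)
  then have "\<forall>\<^sub>F z in nhds p. c < \<psi> z"
    using c(2) by (auto simp: eventually_at_filter elim: eventually_mono)
  then have "\<forall>\<^sub>F j in sequentially. c < \<psi> (xs j)"
    using assms(2) by (rule eventually_compose_filterlim)
  then have "\<forall>\<^sub>F j in sequentially. c \<le> \<psi> (xs j)"
    by (rule eventually_mono) simp
  then have "c \<le> \<gamma>"
    using assms(3) by (intro tendsto_lowerbound[of _ _ sequentially]) auto
  with c(1) show False
    by simp
qed

text \<open>
A subgradient \<open>v\<close> at \<open>a\<close> forces an increase of \<open>e * norm v\<close> over the step of length \<open>e\<close> in its own
direction. On a compact neighbourhood of \<open>C\<close> inside the domain, the convex function is continuous,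
hence bounded, so this increase is bounded as well.
\<close>

lemma subgradients_bounded:
  fixes \<psi> :: "'a::euclidean_space \<Rightarrow> ereal"
  assumes \<psi>: "convex_fun \<psi>" "proper_fun \<psi>" and C: "compact C" "C \<subseteq> interior (effective_domain \<psi>)"
  obtains B where "\<And>a v. a \<in> C \<Longrightarrow> is_subgradient \<psi> a v \<Longrightarrow> norm v \<le> B"
proof -
  let ?F = "\<lambda>z. real_of_ereal (\<psi> z)"
  obtain e where e: "e > 0" "(\<Union>x\<in>C. cball x e) \<subseteq> interior (effective_domain \<psi>)"
    using compact_subset_open_imp_cball_epsilon_subset[OF C(1) open_interior C(2)] by blast
  have "convex_on (interior (effective_domain \<psi>)) ?F"
    using convex_on_real_of_convex_fun[OF \<psi>] interior_subset
    by (rule convex_on_subset) (use convex_on_real_of_convex_fun[OF \<psi>] in \<open>simp add: convex_on_def\<close>)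
  then have "continuous_on (interior (effective_domain \<psi>)) ?F"
    by (intro convex_on_continuous open_interior)
  then have "continuous_on (\<Union>x\<in>C. cball x e) ?F"
    using e(2) continuous_on_subset by blast
  then have "bounded (?F ` (\<Union>x\<in>C. cball x e))"
    by (intro compact_imp_bounded compact_continuous_image compact_minkowski_sum_cball C(1))
  then obtain B where "\<forall>q \<in> ?F ` (\<Union>x\<in>C. cball x e). norm q \<le> B"
    unfolding bounded_iff by blast
  then have B: "\<bar>?F q\<bar> \<le> B" if "a \<in> C" "q \<in> cball a e" for a q
    using that by fastforce
  show thesis
  proof (rule that)
    fix a v assume a: "a \<in> C" "is_subgradient \<psi> a v"
    show "norm v \<le> 2 * B / e"
    proof (cases "v = 0")
      case True
      then show ?thesis
        using order_trans[OF abs_ge_zero B[OF a(1), of a]] e by simp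
    next
      case False
      define q where "q = a + (e / norm v) *\<^sub>R v"
      have q: "q \<in> cball a e"
        using e False by (simp add: q_def dist_norm)
      then have "q \<in> effective_domain \<psi>" "a \<in> effective_domain \<psi>"
        using e a C interior_subset by blast+
      then have "\<psi> q = ereal (?F q)" "\<psi> a = ereal (?F a)"
        using proper_real[OF \<psi>(2)] by blast+
      then have "?F a + v \<bullet> (q - a) \<le> ?F q"
        using a(2) unfolding is_subgradient_def by (metis ereal_less_eq(3) plus_ereal.simps(1))
      moreover have "v \<bullet> (q - a) = e * norm v"
        using False by (simp add: q_def dot_square_norm power2_eq_square)
      ultimately have "e * norm v \<le> 2 * B"
        using abs_le_D1[OF B[OF a(1) q]] abs_le_D2[OF B[OF a(1), of a]] e by simp
      then show ?thesis
        using e by (simp add: field_simps)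
    qed
  qed
qed

text \<open>
The equality case of the Fenchel-Young inequality.
\<close>

lemma convex_conjugate_at_subgradient:
  assumes "is_subgradient \<psi> a v" "\<psi> a = ereal c"
  shows "convex_conjugate \<psi> v = ereal (a \<bullet> v - c)"
  unfolding convex_conjugate_def
proof (rule antisym)
  show "(SUP w. ereal (w \<bullet> v) - \<psi> w) \<le> ereal (a \<bullet> v - c)"
  proof (rule SUP_least)
    fix w
    have "ereal (c + v \<bullet> (w - a)) \<le> \<psi> w"
      using assms by (simp add: is_subgradient_def)
    then show "ereal (w \<bullet> v) - \<psi> w \<le> ereal (a \<bullet> v - c)"
      by (cases "\<psi> w") (auto simp: inner_diff_right inner_commute)
  qed
  show "ereal (a \<bullet> v - c) \<le> (SUP w. ereal (w \<bullet> v) - \<psi> w)"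
    by (rule SUP_upper2[of a]) (auto simp: assms(2))
qed

lemma convex_conjugate_ge: "\<psi> a = ereal c \<Longrightarrow> ereal (a \<bullet> v - c) \<le> convex_conjugate \<psi> v"
  unfolding convex_conjugate_def by (rule SUP_upper2[of a]) auto

section \<open>Smooth functions and proximal steps\<close>

text \<open>
The Riesz representation of the derivative is obtained by applying its adjoint to \<open>1\<close>.
\<close>

lemma differentiable_imp_GDERIV:
  fixes F :: "'a::euclidean_space \<Rightarrow> real"
  assumes "F differentiable (at x)"
  shows "GDERIV F x :> gradient F x"
proof -
  obtain F' where F': "(F has_derivative F') (at x)"
    using assms by (auto simp: differentiable_def)
  then have "linear F'"
    by (rule has_derivative_linear)
  then have "F' = (\<lambda>v. v \<bullet> adjoint F' 1)"
    using adjoint_works[of F' _ 1] by auto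
  with F' have "GDERIV F x :> adjoint F' 1"
    unfolding gderiv_def by metis
  then show ?thesis
    using gradient_eq by metis
qed

lemma GDERIV_first_order:
  fixes F :: "'a::euclidean_space \<Rightarrow> real"
  assumes "GDERIV F a :> D" "0 < \<epsilon>"
  shows "\<forall>\<^sub>F z in nhds a. \<bar>F z - F a - D \<bullet> (z - a)\<bar> \<le> \<epsilon> * norm (z - a)"
proof -
  obtain d where "d > 0" "\<forall>z. norm (z - a) < d \<longrightarrow> norm (F z - F a - (z - a) \<bullet> D) \<le> \<epsilon> * norm (z - a)"
    using assms unfolding gderiv_def has_derivative_at_alt by blast
  then show ?thesis
    unfolding eventually_nhds_metric by (auto simp: dist_norm inner_commute)
qed

text \<open>
If the vectors differed, moving along \<open>v - D\<close> would make the linear minorant grow faster than the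
derivative allows.
\<close>

lemma gradient_eq_subgradient:
  fixes F :: "'a::euclidean_space \<Rightarrow> real"
  assumes "GDERIV F a :> D" "\<forall>\<^sub>F z in nhds a. F a + v \<bullet> (z - a) \<le> F z"
  shows "D = v"
proof (rule ccontr)
  assume "D \<noteq> v"
  define e where "e = v - D"
  have "((\<lambda>t. a + t *\<^sub>R e) \<longlongrightarrow> a) (at_right (0::real))"
    by (auto intro!: tendsto_eq_intros)
  moreover have "\<forall>\<^sub>F z in nhds a. v \<bullet> (z - a) \<le> D \<bullet> (z - a) + norm e / 2 * norm (z - a)"
  proof -
    have "0 < norm e / 2"
      using \<open>D \<noteq> v\<close> by (simp add: e_def)
    from GDERIV_first_order[OF assms(1) this] assms(2) show ?thesis
      by eventually_elim linarith
  qed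
  ultimately have "\<forall>\<^sub>F t in at_right (0::real). v \<bullet> ((a + t *\<^sub>R e) - a) \<le> D \<bullet> ((a + t *\<^sub>R e) - a)
      + norm e / 2 * norm ((a + t *\<^sub>R e) - a)"
    by (rule eventually_compose_filterlim[rotated])
  moreover have "\<forall>\<^sub>F t in at_right (0::real). 0 < t"
    by (simp add: eventually_at_right_less)
  ultimately have "\<forall>\<^sub>F t in at_right (0::real). False"
  proof eventually_elim
    case (elim t)
    then have "t * (v \<bullet> e) \<le> t * (D \<bullet> e + norm e / 2 * norm e)"
      by (simp add: algebra_simps)
    then have "v \<bullet> e \<le> D \<bullet> e + norm e / 2 * norm e"
      using elim by simp
    moreover have "v \<bullet> e = D \<bullet> e + norm e * norm e"
      using dot_square_norm[of e] by (simp add: e_def inner_diff_left power2_eq_square)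
    ultimately have "norm e * norm e \<le> 0"
      by simp
    then show False
      using \<open>D \<noteq> v\<close> by (simp add: e_def mult_le_0_iff)
  qed
  then show False
    by simp
qed

text \<open>
The descent lemma. The difference of the two sides, as a function of the position on the segment,
has a nonpositive derivative by the Lipschitz bound.
\<close>

lemma lipschitz_gradient_descent:
  fixes F :: "'a::euclidean_space \<Rightarrow> real"
  assumes F: "lipschitz_gradient_on L U F" and seg: "closed_segment a b \<subseteq> U"
  shows "F b \<le> F a + gradient F a \<bullet> (b - a) + L / 2 * (norm (b - a))\<^sup>2"
proof -
  define d where "d = b - a"
  define q where "q t = F (a + t *\<^sub>R d) - t * (gradient F a \<bullet> d) - L / 2 * t\<^sup>2 * (norm d)\<^sup>2" for t
  have inU: "a + t *\<^sub>R d \<in> U" if "0 \<le> t" "t \<le> 1" for t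
  proof -
    have "(1 - t) *\<^sub>R a + t *\<^sub>R b \<in> closed_segment a b"
      using that by (auto simp: closed_segment_def)
    then show ?thesis
      using seg by (auto simp: d_def algebra_simps)
  qed
  have "q 1 \<le> q 0"
  proof (rule DERIV_nonpos_imp_nonincreasing[of 0 1])
    fix t :: real assume t: "0 \<le> t" "t \<le> 1"
    let ?p = "a + t *\<^sub>R d"
    have "GDERIV F ?p :> gradient F ?p"
      using F inU[OF t] by (intro differentiable_imp_GDERIV) (simp add: lipschitz_gradient_on_def)
    then have "(F has_derivative (\<lambda>v. v \<bullet> gradient F ?p)) (at ?p)"
      by (simp add: gderiv_def)
    then have "((\<lambda>t. F (a + t *\<^sub>R d)) has_derivative (\<lambda>s. (s *\<^sub>R d) \<bullet> gradient F ?p)) (at t)"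
      by (rule has_derivative_compose[rotated]) (auto intro!: derivative_eq_intros)
    then have "((\<lambda>t. F (a + t *\<^sub>R d)) has_real_derivative (gradient F ?p \<bullet> d)) (at t)"
      by (simp add: has_field_derivative_def inner_commute mult_commute_abs)
    then have "(q has_real_derivative (gradient F ?p \<bullet> d - gradient F a \<bullet> d - L * t * (norm d)\<^sup>2)) (at t)"
      unfolding q_def by (auto intro!: derivative_eq_intros)
    moreover have "gradient F ?p \<bullet> d - gradient F a \<bullet> d - L * t * (norm d)\<^sup>2 \<le> 0"
    proof -
      have "gradient F ?p \<bullet> d - gradient F a \<bullet> d = (gradient F ?p - gradient F a) \<bullet> d"
        by (simp add: inner_diff_left)
      also have "\<dots> \<le> norm (gradient F ?p - gradient F a) * norm d"
        by (rule norm_cauchy_schwarz)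
      also have "\<dots> \<le> (L * norm (?p - a)) * norm d"
        using F inU[OF t] inU[of 0]
        by (intro mult_right_mono lipschitz_on_normD[of L U]) (auto simp: lipschitz_gradient_on_def)
      also have "\<dots> = L * t * (norm d)\<^sup>2"
        using t by (simp add: power2_eq_square)
      finally show ?thesis
        by simp
    qed
    ultimately show "\<exists>y. (q has_real_derivative y) (at t) \<and> y \<le> 0"
      by blast
  qed simp
  then show ?thesis
    by (simp add: q_def d_def)
qed

text \<open>
First-order optimality for a convex function plus a quadratic: comparing \<open>a\<close> with points of the
segment towards \<open>z\<close>, the quadratic contributes its linear part and a second-order term that
vanishes after division by the parameter.
\<close>

lemma prox_optimality:
  fixes G :: "'a::euclidean_space \<Rightarrow> real"
  assumes G: "convex_on T G" and a: "a \<in> T" and \<delta>: "0 < \<delta>"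
    and opt: "\<And>z. z \<in> T \<Longrightarrow> G a + 1 / (2 * \<delta>) * (norm (a - c))\<^sup>2 \<le> G z + 1 / (2 * \<delta>) * (norm (z - c))\<^sup>2"
    and z: "z \<in> T"
  shows "G a - (1 / \<delta>) * ((a - c) \<bullet> (z - a)) \<le> G z"
proof -
  define R where "R = (norm (z - a))\<^sup>2 / (2 * \<delta>)"
  have "\<forall>\<^sub>F t in at_right 0. t \<in> {0<..<1::real}"
    by (rule eventually_at_right_real) simp
  then have "\<forall>\<^sub>F t in at_right 0. G a - (1 / \<delta>) * ((a - c) \<bullet> (z - a)) - t * R \<le> G z"
  proof eventually_elim
    case (elim t)
    then have t: "0 < t" "t < 1"
      by auto
    define zt where "zt = (1 - t) *\<^sub>R a + t *\<^sub>R z"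
    have ztT: "zt \<in> T"
      unfolding zt_def using G a z t by (intro convexD_alt) (auto simp: convex_on_def)
    have Gzt: "G zt \<le> (1 - t) * G a + t * G z"
      unfolding zt_def using convex_onD[OF G, of t a z] t a z by simp
    have "zt - c = (a - c) + t *\<^sub>R (z - a)"
      by (simp add: zt_def algebra_simps)
    then have sq: "(norm (zt - c))\<^sup>2 = (norm (a - c))\<^sup>2 + 2 * t * ((a - c) \<bullet> (z - a)) + t\<^sup>2 * (norm (z - a))\<^sup>2"
      by (simp only: power2_norm_eq_inner)
        (simp add: inner_add_left inner_add_right inner_commute power2_eq_square)
    have "G a + 1 / (2 * \<delta>) * (norm (a - c))\<^sup>2 \<le> ((1 - t) * G a + t * G z)
        + 1 / (2 * \<delta>) * ((norm (a - c))\<^sup>2 + 2 * t * ((a - c) \<bullet> (z - a)) + t\<^sup>2 * (norm (z - a))\<^sup>2)"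
      using opt[OF ztT] Gzt unfolding sq by linarith
    also have "\<dots> = G a + t * (G z - G a) + 1 / (2 * \<delta>) * (norm (a - c))\<^sup>2
        + t * ((1 / \<delta>) * ((a - c) \<bullet> (z - a))) + t * (t * R)"
      using \<delta> by (simp add: R_def field_simps power2_eq_square)
    finally have "0 \<le> t * (G z - G a + (1 / \<delta>) * ((a - c) \<bullet> (z - a)) + t * R)"
      by (simp add: algebra_simps)
    then show ?case
      using t by (simp add: zero_le_mult_iff)
  qed
  moreover have "((\<lambda>t. G a - (1 / \<delta>) * ((a - c) \<bullet> (z - a)) - t * R) \<longlongrightarrow>
      G a - (1 / \<delta>) * ((a - c) \<bullet> (z - a)) - 0 * R) (at_right 0)"
    by (intro tendsto_intros)
  ultimately show ?thesis
    using tendsto_upperbound[OF _ _ trivial_limit_at_right_real] by fastforce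
qed

section \<open>Regular subgradients of quotients\<close>

text \<open>
A one-sided quotient rule at \<open>a\<close>, where the quotient is \<open>A / D\<close>. Only a minorant of the numerators
\<open>n\<close> and a majorant of the denominators \<open>d\<close> are assumed. Since \<open>n\<close> is nonnegative, replacing \<open>d\<close> by
its majorant can only decrease \<open>n / d\<close>, and afterwards both bounds are affine up to \<open>\<epsilon>\<close>. In
particular \<open>d\<close> may drop discontinuously, as happens when it contains minus a conjugate function,
and points where \<open>\<psi>\<close> is infinite are harmless.
\<close>

lemma quotient_frechet_subgradient:
  fixes \<psi> :: "'a::euclidean_space \<Rightarrow> ereal" and A D :: real
  assumes val: "\<psi> a = ereal (A / D)" and A: "0 \<le> A" and D: "0 < D"
    and ev: "\<And>\<epsilon>. 0 < \<epsilon> \<Longrightarrow> \<forall>\<^sub>F z in at a. \<psi> z = \<infinity> \<or> (\<exists>n d. \<psi> z = ereal (n / d) \<and> 0 \<le> n \<and> 0 < d \<and>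
        A + p \<bullet> (z - a) - \<epsilon> * norm (z - a) \<le> n \<and> d \<le> D + q \<bullet> (z - a) + \<epsilon> * norm (z - a))"
  shows "(1 / D) *\<^sub>R (p - (A / D) *\<^sub>R q) \<in> frechet_subdifferential \<psi> a"
proof (rule frechet_subdifferentialI[where \<psi> = \<psi>, OF val])
  fix \<epsilon>' :: real assume e': "0 < \<epsilon>'"
  define \<theta> where "\<theta> = A / D"
  have \<theta>: "0 \<le> \<theta>" "A = \<theta> * D"
    using A D by (auto simp: \<theta>_def)
  \<comment> \<open>Half of the tolerance \<open>\<epsilon>'\<close> pays for the errors in numerator and denominator, and the radius \<open>\<rho>\<close>
    is chosen so that the other half pays for replacing the perturbed denominator by \<open>D\<close>.\<close>
  define e where "e = \<epsilon>' * D / (4 * (1 + \<theta>))"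
  have e: "0 < e" "e * (1 + \<theta>) * 2 / D = \<epsilon>' / 2"
    using e' D \<theta> by (auto simp: e_def add_pos_nonneg) (auto simp: field_simps)
  define w where "w = p - \<theta> *\<^sub>R q"
  define R where "R = norm q + e"
  define W where "W = norm w + 1"
  have W: "0 < W" "norm w \<le> W"
    by (auto simp: W_def add_nonneg_pos)
  have R: "0 < R"
    using e by (auto simp: R_def add_nonneg_pos)
  define \<rho> where "\<rho> = min (D / (2 * R)) (\<epsilon>' * D\<^sup>2 / (4 * R * W))"
  have \<rho>: "0 < \<rho>"
    using R D e' W by (simp add: \<rho>_def)
  have "\<forall>\<^sub>F z in at a. dist z a < \<rho>"
    using \<rho> by (rule eventually_at_ball[unfolded mem_ball, THEN eventually_mono]) (simp add: dist_commute)
  with ev[OF e(1)]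
  show "\<forall>\<^sub>F z in at a. ereal (A / D + (1 / D) *\<^sub>R (p - (A / D) *\<^sub>R q) \<bullet> (z - a) - \<epsilon>' * norm (z - a)) \<le> \<psi> z"
  proof eventually_elim
    case (elim z)
    define t where "t = norm (z - a)"
    have t: "0 \<le> t" "t < \<rho>"
      using elim(2) by (auto simp: t_def dist_norm)
    define D' where "D' = D + q \<bullet> (z - a) + e * t"
    have qt: "\<bar>q \<bullet> (z - a)\<bar> \<le> norm q * t" and wt: "\<bar>w \<bullet> (z - a)\<bar> \<le> norm w * t"
      unfolding t_def by (rule Cauchy_Schwarz_ineq2)+
    have e_t: "0 \<le> e * t"
      using e t by simp
    have dD: "\<bar>D' - D\<bar> \<le> R * t"
      using qt e_t unfolding D'_def R_def ring_distribs by linarith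
    also have "\<dots> \<le> R * (D / (2 * R))"
      using t R by (intro mult_left_mono) (auto simp: \<rho>_def)
    also have "\<dots> = D / 2"
      using R by simp
    finally have D': "D / 2 \<le> D'" "0 < D'"
      using D by linarith+
    show ?case
    proof (cases "\<psi> z = \<infinity>")
      case False
      then obtain n d where nd: "\<psi> z = ereal (n / d)" "0 \<le> n" "0 < d"
        "A + p \<bullet> (z - a) - e * t \<le> n" "d \<le> D'"
        using elim(1) by (auto simp: t_def D'_def)
      have "w \<bullet> (z - a) / D - w \<bullet> (z - a) / D' = w \<bullet> (z - a) * (D' - D) / (D * D')"
        using D D' by (simp add: field_simps)
      also have "\<dots> \<le> norm w * t * (R * t) / (D * D')"
      proof (rule divide_right_mono)
        have "w \<bullet> (z - a) * (D' - D) \<le> \<bar>w \<bullet> (z - a)\<bar> * \<bar>D' - D\<bar>"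
          by (metis abs_ge_self abs_mult)
        also have "\<dots> \<le> norm w * t * (R * t)"
          using wt dD t by (intro mult_mono) auto
        finally show "w \<bullet> (z - a) * (D' - D) \<le> norm w * t * (R * t)" .
      qed (use D D' in auto)
      also have "\<dots> \<le> norm w * t * (R * t) / (D * (D / 2))"
        using D D' t R by (intro divide_left_mono mult_left_mono) auto
      also have "\<dots> = (norm w * R * t) * (2 * t / D\<^sup>2)"
        by (simp add: field_simps power2_eq_square)
      also have "\<dots> \<le> (\<epsilon>' * D\<^sup>2 / 4) * (2 * t / D\<^sup>2)"
      proof (rule mult_right_mono)
        have "norm w * R * t \<le> (W * R) * (\<epsilon>' * D\<^sup>2 / (4 * R * W))"
          using t R W by (intro mult_mono) (auto simp: \<rho>_def)
        also have "\<dots> = \<epsilon>' * D\<^sup>2 / 4"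
          using R W by (simp add: field_simps)
        finally show "norm w * R * t \<le> \<epsilon>' * D\<^sup>2 / 4" .
      qed (use t in auto)
      also have "\<dots> = \<epsilon>' * t / 2"
        using D by (simp add: field_simps)
      finally have 1: "w \<bullet> (z - a) / D - \<epsilon>' * t / 2 \<le> w \<bullet> (z - a) / D'"
        by linarith
      have "e * (1 + \<theta>) * t / D' \<le> e * (1 + \<theta>) * t / (D / 2)"
        using D D' e \<theta> t by (intro divide_left_mono) auto
      also have "\<dots> = (e * (1 + \<theta>) * 2 / D) * t"
        by simp
      finally have 2: "e * (1 + \<theta>) * t / D' \<le> \<epsilon>' * t / 2"
        unfolding e(2) by simp
      have "\<theta> + w \<bullet> (z - a) / D - \<epsilon>' * t \<le> \<theta> + (w \<bullet> (z - a) - e * (1 + \<theta>) * t) / D'"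
        using 1 2 by (simp add: diff_divide_distrib)
      also have "\<dots> = (A + p \<bullet> (z - a) - e * t) / D'"
        using D' unfolding w_def D'_def \<theta>(2) by (simp add: field_simps inner_diff_left)
      also have "\<dots> \<le> n / D'"
        using nd D' by (intro divide_right_mono) auto
      also have "\<dots> \<le> n / d"
        using nd D' by (intro divide_left_mono) auto
      finally show ?thesis
        using nd(1) unfolding t_def w_def \<theta>_def by simp
    qed simp
  qed
qed

section \<open>The subdifferential sum rule\<close>

text \<open>
The subdifferential sum rule, in the normalization in which \<open>F\<close> is the convex function minus its
affine minorant on \<open>S\<close>. The convex set \<open>Q\<close> consists of differences of points of \<open>D\<close> and \<open>S\<close>, paired
with upper bounds of \<open>F\<close>. The origin is on its relative boundary, so it has a nontrivial supporting
hyperplane there. The hyperplane is not vertical: a vertical one would weakly separate \<open>D\<close> from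
\<open>S\<close>, and at a common relative interior point this forces the functional to vanish on \<open>Q\<close>. Hence its
slope can be normalized, and it is the vector \<open>w\<close>.
\<close>

lemma normal_separation_rel_interior:
  fixes F :: "'a::euclidean_space \<Rightarrow> real"
  assumes F: "convex_on D F" and S: "convex S"
    and ri: "rel_interior S \<inter> rel_interior D \<noteq> {}"
    and nonneg: "\<And>z. z \<in> S \<inter> D \<Longrightarrow> 0 \<le> F z"
    and p: "p \<in> S \<inter> D" "F p = 0"
  obtains w where "\<And>z. z \<in> S \<Longrightarrow> w \<bullet> (z - p) \<le> 0" "\<And>z. z \<in> D \<Longrightarrow> 0 \<le> F z + w \<bullet> (z - p)"
proof -
  define Q where "Q = {(z1 - z2, r) | z1 z2 r. z1 \<in> D \<and> z2 \<in> S \<and> F z1 \<le> r}"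
  have QI: "(z1 - z2, r) \<in> Q" if "z1 \<in> D" "z2 \<in> S" "F z1 \<le> r" for z1 z2 r
    using that unfolding Q_def by blast
  have convD: "convex D"
    using F by (simp add: convex_on_def)
  have "convex Q"
    unfolding convex_alt
  proof (intro ballI allI impI)
    fix a b and t :: real
    assume a: "a \<in> Q" and b: "b \<in> Q" and t: "0 \<le> t \<and> t \<le> 1"
    obtain a1 a2 r where a: "a = (a1 - a2, r)" "a1 \<in> D" "a2 \<in> S" "F a1 \<le> r"
      using a unfolding Q_def by blast
    obtain b1 b2 s where b: "b = (b1 - b2, s)" "b1 \<in> D" "b2 \<in> S" "F b1 \<le> s"
      using b unfolding Q_def by blast
    have "F ((1 - t) *\<^sub>R a1 + t *\<^sub>R b1) \<le> (1 - t) * F a1 + t * F b1"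
      using convex_onD[OF F] a b t by auto
    also have "\<dots> \<le> (1 - t) * r + t * s"
      using a b t by (intro add_mono mult_left_mono) auto
    finally have "(((1 - t) *\<^sub>R a1 + t *\<^sub>R b1) - ((1 - t) *\<^sub>R a2 + t *\<^sub>R b2), (1 - t) * r + t * s) \<in> Q"
      using a b t S convD by (intro QI convexD_alt) auto
    then show "(1 - t) *\<^sub>R a + t *\<^sub>R b \<in> Q"
      unfolding a(1) b(1) by (simp add: algebra_simps)
  qed
  moreover have zero: "(0, 0) \<in> Q" "(0, 1) \<in> Q"
    using QI[of p p 0] QI[of p p 1] p by auto
  \<comment> \<open>Since \<open>(0, 1)\<close> is in \<open>Q\<close>, a relative interior origin would give a point of \<open>S \<inter> D\<close> with \<open>F < 0\<close>.\<close>
  moreover have "(0, 0) \<notin> rel_interior Q"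
  proof
    assume "(0, 0) \<in> rel_interior Q"
    then have "\<exists>e>1. (1 - e) *\<^sub>R (0, 1) + e *\<^sub>R (0, 0) \<in> Q"
      using convex_rel_interior_iff[of Q "(0, 0)"] \<open>convex Q\<close> zero by blast
    then obtain e where e: "e > 1" "(0, 1 - e) \<in> Q"
      by auto
    then obtain z where "z \<in> D" "z \<in> S" "F z \<le> 1 - e"
      unfolding Q_def by auto
    with nonneg[of z] e show False
      by simp
  qed
  ultimately obtain aa :: "'a \<times> real" where aa: "aa \<noteq> 0" "\<And>q. q \<in> Q \<Longrightarrow> aa \<bullet> (0, 0) \<le> aa \<bullet> q"
    "\<And>q. q \<in> rel_interior Q \<Longrightarrow> aa \<bullet> (0, 0) < aa \<bullet> q"
    using supporting_hyperplane_rel_boundary[of Q "(0, 0)"] by metis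
  obtain a \<beta> where a: "aa = (a, \<beta>)"
    by (cases aa)
  have sup: "0 \<le> a \<bullet> (z1 - z2) + \<beta> * r" if "z1 \<in> D" "z2 \<in> S" "F z1 \<le> r" for z1 z2 r
    using aa(2)[OF QI[OF that]] by (simp add: a)
  have "0 \<le> \<beta>"
    using sup[of p p 1] p by simp
  moreover have "\<beta> \<noteq> 0"
  proof
    assume "\<beta> = 0"
    then have sup0: "0 \<le> a \<bullet> (z1 - z2)" if "z1 \<in> D" "z2 \<in> S" for z1 z2
      using sup[OF that order_refl] by simp
    obtain z0 where z0: "z0 \<in> rel_interior S" "z0 \<in> rel_interior D"
      using ri by blast
    have "rel_interior Q \<noteq> {}"
      using \<open>convex Q\<close> zero by (auto simp: rel_interior_eq_empty)
    then obtain q where q: "q \<in> rel_interior Q"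
      by blast
    then have "q \<in> Q"
      using rel_interior_subset by blast
    then obtain z1 z2 r where q': "q = (z1 - z2, r)" "z1 \<in> D" "z2 \<in> S"
      unfolding Q_def by blast
    have pos: "0 < a \<bullet> (z1 - z2)"
      using aa(3)[OF q] q' \<open>\<beta> = 0\<close> by (simp add: a)
    obtain e1 where e1: "e1 > 1" "(1 - e1) *\<^sub>R z1 + e1 *\<^sub>R z0 \<in> D"
      using convex_rel_interior_iff[of D z0] convD z0 q' by blast
    obtain e2 where e2: "e2 > 1" "(1 - e2) *\<^sub>R z2 + e2 *\<^sub>R z0 \<in> S"
      using convex_rel_interior_iff[of S z0] S z0 q' by blast
    have z0': "z0 \<in> S" "z0 \<in> D"
      using z0 rel_interior_subset by blast+
    \<comment> \<open>Prolonging the segments from \<open>z1\<close> and \<open>z2\<close> slightly beyond \<open>z0\<close> reverses the inequalities.\<close>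
    have "0 \<le> a \<bullet> (((1 - e1) *\<^sub>R z1 + e1 *\<^sub>R z0) - z0)"
      by (rule sup0[OF e1(2) z0'(1)])
    also have "\<dots> = (e1 - 1) * (a \<bullet> (z0 - z1))"
      by (simp add: algebra_simps inner_simps)
    finally have 1: "0 \<le> a \<bullet> (z0 - z1)"
      using e1(1) by (simp add: zero_le_mult_iff)
    have "0 \<le> a \<bullet> (z0 - ((1 - e2) *\<^sub>R z2 + e2 *\<^sub>R z0))"
      by (rule sup0[OF z0'(2) e2(2)])
    also have "\<dots> = (e2 - 1) * (a \<bullet> (z2 - z0))"
      by (simp add: algebra_simps inner_simps)
    finally have 2: "0 \<le> a \<bullet> (z2 - z0)"
      using e2(1) by (simp add: zero_le_mult_iff)
    from 1 2 pos show False
      by (simp add: inner_diff_right)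
  qed
  ultimately have \<beta>: "0 < \<beta>"
    by simp
  show thesis
  proof (rule that)
    fix z
    assume "z \<in> S"
    with sup[of p z 0] p have "a \<bullet> (z - p) \<le> 0"
      by (simp add: inner_diff_right)
    then show "((1 / \<beta>) *\<^sub>R a) \<bullet> (z - p) \<le> 0"
      using \<beta> by (simp add: divide_le_0_iff)
  next
    fix z
    assume "z \<in> D"
    with sup[of z p "F z"] p have "0 \<le> a \<bullet> (z - p) + \<beta> * F z"
      by simp
    then have "0 \<le> (a \<bullet> (z - p) + \<beta> * F z) / \<beta>"
      using \<beta> by simp
    then show "0 \<le> F z + ((1 / \<beta>) *\<^sub>R a) \<bullet> (z - p)"
      using \<beta> by (simp add: add_divide_distrib)
  qed
qed

text \<open>
The orthogonal projection onto the complement of \<open>W\<close>, built from an orthonormal basis.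
\<close>

lemma projection_along_subspace:
  fixes W :: "'a::euclidean_space set"
  assumes "subspace W"
  obtains \<pi> :: "'a \<Rightarrow> 'a" where "linear \<pi>" "\<And>z. \<pi> z = 0 \<longleftrightarrow> z \<in> W"
proof -
  obtain B where B: "B \<subseteq> W" "pairwise orthogonal B" "\<And>x. x \<in> B \<Longrightarrow> norm x = 1"
    "independent B" "card B = dim W" "span B = W"
    using orthonormal_basis_subspace[OF assms] by blast
  have fin: "finite B"
    using B(4) by (rule independent_imp_finite)
  define \<pi> where "\<pi> z = z - (\<Sum>b\<in>B. (b \<bullet> z) *\<^sub>R b)" for z
  have lin: "linear \<pi>"
    by (rule linearI) (simp_all add: \<pi>_def inner_simps algebra_simps sum.distrib scaleR_sum_right)
  have zeroB: "\<pi> b = 0" if "b \<in> B" for b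
  proof -
    have "(\<Sum>c\<in>B. (c \<bullet> b) *\<^sub>R c) = (\<Sum>c\<in>B. if c = b then b else 0)"
    proof (rule sum.cong[OF refl])
      fix c assume "c \<in> B"
      show "(c \<bullet> b) *\<^sub>R c = (if c = b then b else 0)"
        using B(3)[OF that] B(2) \<open>c \<in> B\<close> that
        by (auto simp: pairwise_def orthogonal_def dot_square_norm)
    qed
    then show ?thesis
      using fin that by (simp add: \<pi>_def)
  qed
  show thesis
  proof (rule that[OF lin])
    fix z
    show "\<pi> z = 0 \<longleftrightarrow> z \<in> W"
    proof
      assume "\<pi> z = 0"
      then have "z = (\<Sum>b\<in>B. (b \<bullet> z) *\<^sub>R b)"
        by (simp add: \<pi>_def)
      also have "\<dots> \<in> span B"
        by (intro span_sum span_scale span_base)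
      finally show "z \<in> W"
        using B by simp
    next
      assume "z \<in> W"
      then have "z \<in> span B"
        using B by simp
      then show "\<pi> z = 0"
        using linear_eq_0_on_span[OF lin zeroB] by blast
    qed
  qed
qed

text \<open>
The normal cone of the intersection of a polytope with an affine subspace through \<open>p\<close> is the sum of the two
normal cones. To extend the functional \<open>w1\<close> from \<open>V\<close>, project along the part of \<open>V\<close> on
which \<open>w1\<close> vanishes. The projected polytope is again a polyhedron, and it contains no positive
multiple of the image of a direction \<open>v1\<close> with \<open>w1 \<bullet> v1 = 1\<close>. So one of its finitely many defining
inequalities is active at the origin and cuts off \<open>v1\<close>. That inequality, rescaled, is the extension.
\<close>

lemma polytope_normal_extend:
  fixes S :: "'a::euclidean_space set"
  assumes S: "polytope S" and p: "p \<in> S" and V: "subspace V"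
    and w1: "\<And>z. z \<in> S \<Longrightarrow> z - p \<in> V \<Longrightarrow> w1 \<bullet> (z - p) \<le> 0"
  obtains w where "\<And>z. z \<in> S \<Longrightarrow> w \<bullet> (z - p) \<le> 0" "\<And>v. v \<in> V \<Longrightarrow> w \<bullet> v = w1 \<bullet> v"
proof (cases "\<forall>v\<in>V. w1 \<bullet> v = 0")
  case True
  then show ?thesis
    by (intro that[of 0]) auto
next
  case False
  then obtain v0 where v0: "v0 \<in> V" "w1 \<bullet> v0 \<noteq> 0"
    by blast
  define v1 where "v1 = (1 / (w1 \<bullet> v0)) *\<^sub>R v0"
  have v1: "v1 \<in> V" "w1 \<bullet> v1 = 1"
    using v0 V by (auto simp: v1_def subspace_scale)
  define W where "W = V \<inter> {v. w1 \<bullet> v = 0}"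
  have "subspace W"
    unfolding W_def by (intro subspace_inter V subspace_hyperplane)
  then obtain \<pi> :: "'a \<Rightarrow> 'a" where \<pi>: "linear \<pi>" "\<And>z. \<pi> z = 0 \<longleftrightarrow> z \<in> W"
    by (rule projection_along_subspace) blast
  interpret \<pi>: linear \<pi> by (rule \<pi>(1))
  define P where "P = \<pi> ` ((\<lambda>z. z - p) ` S)"
  have "polytope ((\<lambda>z. z - p) ` S)"
    using polytope_translation_eq[of "- p" S] S by (simp add: image_def)
  then have "polyhedron P"
    unfolding P_def using polytope_linear_image[OF \<pi>(1)] polytope_imp_polyhedron by blast
  then obtain \<F> where \<F>: "finite \<F>" "P = \<Inter> \<F>" "\<forall>h\<in>\<F>. \<exists>a b. a \<noteq> 0 \<and> h = {x. a \<bullet> x \<le> b}"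
    unfolding polyhedron_def by blast
  obtain \<alpha> \<beta> where h: "\<And>h. h \<in> \<F> \<Longrightarrow> h = {x. \<alpha> h \<bullet> x \<le> \<beta> h}"
    using \<F>(3) by metis
  have P: "q \<in> P \<longleftrightarrow> (\<forall>h\<in>\<F>. \<alpha> h \<bullet> q \<le> \<beta> h)" for q
    using \<F>(2) h by blast
  have "0 \<in> P"
    using p by (force simp: P_def \<pi>.zero)
  then have \<beta>: "0 \<le> \<beta> h" if "h \<in> \<F>" for h
    using P that by auto
  have notP: "t *\<^sub>R \<pi> v1 \<notin> P" if "0 < t" for t
  proof
    assume "t *\<^sub>R \<pi> v1 \<in> P"
    then obtain z where z: "z \<in> S" "t *\<^sub>R \<pi> v1 = \<pi> (z - p)"
      unfolding P_def by auto
    then have "\<pi> ((z - p) - t *\<^sub>R v1) = 0"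
      by (simp add: \<pi>.diff \<pi>.scale)
    then have "(z - p) - t *\<^sub>R v1 \<in> W"
      using \<pi>(2) by blast
    then have "(z - p) - t *\<^sub>R v1 \<in> V" and eq: "w1 \<bullet> ((z - p) - t *\<^sub>R v1) = 0"
      by (auto simp: W_def)
    then have "z - p \<in> V"
      using subspace_add[OF V, of "(z - p) - t *\<^sub>R v1" "t *\<^sub>R v1"] subspace_scale[OF V v1(1)] by simp
    with w1[OF z(1)] have "w1 \<bullet> (z - p) \<le> 0"
      by simp
    moreover have "w1 \<bullet> (z - p) = t"
      using eq v1(2) by (simp add: inner_diff_right)
    ultimately show False
      using that by simp
  qed
  have "\<exists>h\<in>\<F>. \<beta> h = 0 \<and> 0 < \<alpha> h \<bullet> \<pi> v1"
  proof (rule ccontr)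
    assume neg: "\<not> (\<exists>h\<in>\<F>. \<beta> h = 0 \<and> 0 < \<alpha> h \<bullet> \<pi> v1)"
    have "\<forall>\<^sub>F t in at_right (0::real). \<alpha> h \<bullet> (t *\<^sub>R \<pi> v1) \<le> \<beta> h" if hF: "h \<in> \<F>" for h
    proof (cases "\<beta> h = 0")
      case True
      then have "\<alpha> h \<bullet> \<pi> v1 \<le> 0"
        using neg hF by force
      moreover have "\<forall>\<^sub>F t in at_right (0::real). 0 < t"
        by (simp add: eventually_at_right_less)
      ultimately show ?thesis
        using True by (auto elim!: eventually_mono simp: mult_le_0_iff)
    next
      case False
      then have "0 < \<beta> h"
        using \<beta>[OF hF] by simp
      moreover have "((\<lambda>t. \<alpha> h \<bullet> (t *\<^sub>R \<pi> v1)) \<longlongrightarrow> \<alpha> h \<bullet> (0 *\<^sub>R \<pi> v1)) (at_right 0)"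
        by (intro tendsto_intros)
      ultimately have "\<forall>\<^sub>F t in at_right 0. \<alpha> h \<bullet> (t *\<^sub>R \<pi> v1) < \<beta> h"
        by (intro order_tendstoD(2)) auto
      then show ?thesis
        by (rule eventually_mono) simp
    qed
    then have "\<forall>\<^sub>F t in at_right (0::real). \<forall>h\<in>\<F>. \<alpha> h \<bullet> (t *\<^sub>R \<pi> v1) \<le> \<beta> h"
      using \<F>(1) by (simp add: eventually_ball_finite)
    moreover have "\<forall>\<^sub>F t in at_right (0::real). 0 < t"
      by (simp add: eventually_at_right_less)
    ultimately have "\<forall>\<^sub>F t in at_right (0::real). False"
      by eventually_elim (use P notP in blast)
    then show False
      by simp
  qed
  then obtain h0 where h0: "h0 \<in> \<F>" "\<beta> h0 = 0" "0 < \<alpha> h0 \<bullet> \<pi> v1"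
    by blast
  define c where "c = \<alpha> h0 \<bullet> \<pi> v1"
  have c: "0 < c"
    using h0 by (simp add: c_def)
  define w where "w = (1 / c) *\<^sub>R adjoint \<pi> (\<alpha> h0)"
  have w: "w \<bullet> z = \<alpha> h0 \<bullet> \<pi> z / c" for z
    using adjoint_works[OF \<pi>(1), of z "\<alpha> h0"] by (simp add: w_def inner_commute)
  show ?thesis
  proof (rule that)
    fix z assume "z \<in> S"
    then have "\<pi> (z - p) \<in> P"
      by (auto simp: P_def)
    then have "\<alpha> h0 \<bullet> \<pi> (z - p) \<le> 0"
      using P h0 by force
    then show "w \<bullet> (z - p) \<le> 0"
      using c by (simp add: w divide_le_0_iff)
  next
    fix v assume v: "v \<in> V"
    have "v - (w1 \<bullet> v) *\<^sub>R v1 \<in> W"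
      using v v1 V by (simp add: W_def subspace_diff subspace_scale inner_diff_right)
    then have "\<pi> (v - (w1 \<bullet> v) *\<^sub>R v1) = 0"
      using \<pi>(2) by blast
    then have "\<pi> v = (w1 \<bullet> v) *\<^sub>R \<pi> v1"
      by (simp add: \<pi>.diff \<pi>.scale)
    then show "w \<bullet> v = w1 \<bullet> v"
      using c by (simp add: w c_def)
  qed
qed

text \<open>
The sum rule when the polytope \<open>S\<close> merely meets the relative interior of \<open>D\<close>. Inside the affine hull
\<open>A\<close> of \<open>D\<close> the relative interior of \<open>D\<close> is open, so it also meets the relative interior of \<open>S \<inter> A\<close>, and
the lemma \<open>normal_separation_rel_interior\<close> yields a normal vector of \<open>S \<inter> A\<close>. It is then replaced by a normal vector of \<open>S\<close>
that agrees with it on the directions of \<open>A\<close>, the only ones seen by \<open>F\<close>.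
\<close>

lemma normal_separation_polytope:
  fixes F :: "'a::euclidean_space \<Rightarrow> real"
  assumes F: "convex_on D F" and S: "polytope S"
    and ri: "S \<inter> rel_interior D \<noteq> {}"
    and nonneg: "\<And>z. z \<in> S \<inter> D \<Longrightarrow> 0 \<le> F z"
    and p: "p \<in> S \<inter> D" "F p = 0"
  obtains w where "\<And>z. z \<in> S \<Longrightarrow> w \<bullet> (z - p) \<le> 0" "\<And>z. z \<in> D \<Longrightarrow> 0 \<le> F z + w \<bullet> (z - p)"
proof -
  have convD: "convex D" and convS: "convex S"
    using F S by (auto simp: convex_on_def polytope_imp_convex)
  define A where "A = affine hull D"
  have A: "affine A" "D \<subseteq> A"
    by (auto simp: A_def hull_subset)
  define V where "V = (\<lambda>z. z - p) ` A"
  have V: "subspace V"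
  proof -
    have "V = (+) (- p) ` A"
      by (auto simp: V_def)
    then show ?thesis
      using affine_diffs_subspace[OF A(1), of p] A p by auto
  qed
  have VA: "z - p \<in> V \<longleftrightarrow> z \<in> A" for z
    by (auto simp: V_def)
  obtain z0 where z0: "z0 \<in> S" "z0 \<in> rel_interior D"
    using ri by blast
  have convSA: "convex (S \<inter> A)"
    using convS affine_imp_convex[OF A(1)] by (rule convex_Int)
  have z0A: "z0 \<in> S \<inter> A"
    using z0 rel_interior_subset A(2) by blast
  then have "rel_interior (S \<inter> A) \<noteq> {}"
    using convSA by (auto simp: rel_interior_eq_empty)
  then obtain s where s: "s \<in> rel_interior (S \<inter> A)"
    by blast
  then have sA: "s \<in> A"
    using rel_interior_subset by blast
  obtain e where e: "e > 0" "ball z0 e \<inter> A \<subseteq> D" and z0D: "z0 \<in> D"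
    using z0(2) unfolding mem_rel_interior_ball A_def by blast
  define t where "t = min 1 (e / 2 / (norm (z0 - s) + 1))"
  \<comment> \<open>A point of the segment from \<open>z0\<close> to \<open>s\<close> that is still within distance \<open>e\<close> of \<open>z0\<close>.\<close>
  define z1 where "z1 = z0 - t *\<^sub>R (z0 - s)"
  have t: "0 < t" "t \<le> 1"
    using e by (auto simp: t_def add_nonneg_pos)
  have "norm (t *\<^sub>R (z0 - s)) \<le> e / 2 / (norm (z0 - s) + 1) * (norm (z0 - s) + 1)"
    using t unfolding norm_scaleR by (intro mult_mono) (auto simp: t_def)
  also have "\<dots> = e / 2"
    by (rule nonzero_eq_divide_eq[THEN iffD1, OF _ refl]) (use norm_ge_zero[of "z0 - s"] in linarith)
  finally have d: "dist z0 z1 < e"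
    using e by (simp add: z1_def dist_norm)
  have z1A: "z1 \<in> A"
  proof -
    have "z1 = (1 - t) *\<^sub>R z0 + t *\<^sub>R s"
      by (simp add: z1_def algebra_simps)
    then show ?thesis
      using A(1) z0A sA by (simp add: affine_alt)
  qed
  have "z1 \<in> rel_interior (S \<inter> A)"
    unfolding z1_def by (rule rel_interior_convex_shrink[OF convSA s z0A t])
  moreover have "z1 \<in> rel_interior D"
    unfolding mem_rel_interior_ball A_def[symmetric]
  proof (intro conjI exI)
    show "z1 \<in> D"
      using d e z1A by auto
    show "0 < e - dist z0 z1"
      using d by simp
    have "ball z1 (e - dist z0 z1) \<subseteq> ball z0 e"
    proof
      fix q assume "q \<in> ball z1 (e - dist z0 z1)"
      then show "q \<in> ball z0 e"
        using dist_triangle[of z0 q z1] by simp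
    qed
    then show "ball z1 (e - dist z0 z1) \<inter> A \<subseteq> D"
      using e(2) by blast
  qed
  ultimately have "rel_interior (S \<inter> A) \<inter> rel_interior D \<noteq> {}"
    by blast
  moreover have "0 \<le> F z" if "z \<in> (S \<inter> A) \<inter> D" for z
    using nonneg that by blast
  moreover have "p \<in> (S \<inter> A) \<inter> D"
    using p A by blast
  ultimately obtain w1 where w1: "\<And>z. z \<in> S \<inter> A \<Longrightarrow> w1 \<bullet> (z - p) \<le> 0"
    "\<And>z. z \<in> D \<Longrightarrow> 0 \<le> F z + w1 \<bullet> (z - p)"
    using normal_separation_rel_interior[OF F convSA, of p] p(2) by blast
  have "w1 \<bullet> (z - p) \<le> 0" if "z \<in> S" "z - p \<in> V" for z
    using w1(1) that VA by blast
  then obtain w where w: "\<And>z. z \<in> S \<Longrightarrow> w \<bullet> (z - p) \<le> 0" "\<And>v. v \<in> V \<Longrightarrow> w \<bullet> v = w1 \<bullet> v"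
    using polytope_normal_extend[OF S _ V, of p w1] p by blast
  show thesis
  proof (rule that[OF w(1)])
    fix z assume "z \<in> D"
    then show "0 \<le> F z + w \<bullet> (z - p)"
      using w1(2)[of z] w(2)[of "z - p"] VA A(2) by auto
  qed
qed

section \<open>Finite length from the Kurdyka-Lojasiewicz property\<close>

lemma summable_of_telescoping_bound:
  fixes a V :: "nat \<Rightarrow> real"
  assumes a: "\<And>k. k \<ge> N \<Longrightarrow> 0 \<le> a k" "\<And>k. k \<ge> N \<Longrightarrow> a k \<le> V k - V (Suc k)"
    and V: "\<And>k. k \<ge> N \<Longrightarrow> B \<le> V k"
  shows "summable a"
proof -
  have "summable (\<lambda>k. a (k + N))"
  proof (rule summableI_nonneg_bounded)
    show "0 \<le> a (k + N)" for k
      using a by simp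
    show "(\<Sum>k<n. a (k + N)) \<le> V N - B" for n
    proof -
      have "(\<Sum>k<n. a (k + N)) \<le> (\<Sum>k<n. V (k + N) - V (Suc k + N))"
        by (intro sum_mono) (simp add: a)
      also have "\<dots> = V N - V (n + N)"
        using sum_lessThan_telescope'[of "\<lambda>k. V (k + N)" n] by simp
      also have "\<dots> \<le> V N - B"
        using V by simp
      finally show ?thesis .
    qed
  qed
  then show ?thesis
    using summable_iff_shift by blast
qed

lemma desingularizing_tangent:
  assumes \<phi>: "desingularizing \<eta> \<phi>" and t: "0 < t" "ereal t < \<eta>" and s: "0 \<le> s" "s \<le> t"
  shows "deriv \<phi> t * (t - s) \<le> \<phi> t - \<phi> s"
proof -
  let ?A = "{t. 0 \<le> t \<and> ereal t < \<eta>}"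
  have conv: "convex_on ?A (\<lambda>x. - \<phi> x)"
    using \<phi> by (simp add: desingularizing_def concave_on_def)
  then have "connected ?A"
    by (intro convex_connected) (simp add: convex_on_def)
  obtain b where b: "t < b" "ereal b < \<eta>"
    using t by (metis ereal_dense2 less_ereal.simps(1))
  have "t \<in> interior ?A"
  proof (rule interiorI)
    show "{0<..<b} \<subseteq> ?A"
    proof
      fix x assume "x \<in> {0<..<b}"
      then have "0 \<le> x" "ereal x < ereal b"
        by auto
      with b(2) show "x \<in> ?A"
        using less_trans by blast
    qed
  qed (use t b in auto)
  moreover have "ereal s < \<eta>"
    using s(2) t(2) by (metis ereal_less_eq(3) le_less_trans)
  then have "s \<in> ?A"
    using s(1) by blast
  moreover have "(\<phi> has_real_derivative deriv \<phi> t) (at t)"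
    using \<phi> t by (simp add: desingularizing_def DERIV_deriv_iff_real_differentiable)
  then have "((\<lambda>x. - \<phi> x) has_real_derivative - deriv \<phi> t) (at t within ?A)"
    by (blast intro: DERIV_minus DERIV_subset)
  ultimately have "- \<phi> s - - \<phi> t \<ge> - deriv \<phi> t * (s - t)"
    using convex_on_imp_above_tangent[OF conv \<open>connected ?A\<close>] by blast
  then show ?thesis
    by (simp add: algebra_simps)
qed

lemma convergent_subsequence_of_recurrence:
  fixes z :: "nat \<Rightarrow> 'a::metric_space"
  assumes "\<And>U. open U \<Longrightarrow> p \<in> U \<Longrightarrow> \<exists>\<^sub>F k in sequentially. z k \<in> U"
  obtains s where "strict_mono s" "(z \<circ> s) \<longlonglongrightarrow> p"
proof -
  have freq: "\<exists>m>n. dist (z m) p < e" if "0 < e" for e and n :: nat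
  proof -
    have "\<exists>\<^sub>F k in sequentially. z k \<in> ball p e"
      using that by (intro assms) auto
    then obtain m where "m \<ge> Suc n" "z m \<in> ball p e"
      unfolding frequently_sequentially by blast
    then show ?thesis
      by (auto simp: dist_commute intro!: exI[of _ m])
  qed
  have "\<exists>s. \<forall>n. dist (z (s n)) p < 1 / Suc n \<and> s n < s (Suc n)"
  proof (rule dependent_nat_choice)
    show "\<exists>m. dist (z m) p < 1 / Suc 0"
      using freq[of 1 0] by auto
    show "\<exists>m'. dist (z m') p < 1 / Suc (Suc n) \<and> m < m'" for m n
      using freq[of "1 / Suc (Suc n)" m] by (auto simp: conj_commute)
  qed
  then obtain s where s: "\<And>n. dist (z (s n)) p < 1 / Suc n" "\<And>n. s n < s (Suc n)"
    by blast
  have "(\<lambda>n. dist (z (s n)) p) \<longlonglongrightarrow> 0"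
  proof (rule tendsto_sandwich[OF _ _ tendsto_const])
    show "(\<lambda>n. 1 / Suc n) \<longlonglongrightarrow> (0::real)"
      using LIMSEQ_inverse_real_of_nat by (simp add: inverse_eq_divide)
  qed (use s(1) in \<open>auto intro!: always_eventually less_imp_le\<close>)
  then have "(z \<circ> s) \<longlonglongrightarrow> p"
    by (subst tendsto_dist_iff) (simp add: o_def)
  moreover have "strict_mono s"
    using s(2) by (simp add: strict_mono_Suc_iff)
  ultimately show ?thesis
    using that by blast
qed

lemma dist_zero_le_norm: "v \<in> A \<Longrightarrow> dist_zero A \<le> ereal (norm v)"
  unfolding dist_zero_def by (intro INF_lower2[of v]) auto

text \<open>
The closure of the iterates is compact. Each of its points has either a neighbourhood that the
iterates eventually leave or, if it is a cluster point, a neighbourhood with a desingularizing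
function. Finitely many of them suffice, and the sum \<open>\<Phi> k\<close> of the finitely many desingularizing functions,
evaluated at \<open>r k - l\<close>, serves for all late iterates at once. The tangent inequality for concave
functions then bounds the decrease of \<open>r\<close> by \<open>norm (w k)\<close> times the decrease of \<open>\<Phi>\<close>. Inserting the
bounds for \<open>r\<close> and \<open>w\<close> and using the arithmetic-geometric mean inequality bounds \<open>\<Delta> (Suc k)\<close> by the
decrease of \<open>V k = \<Delta> k + r k + const * \<Phi> (Suc k)\<close>, which telescopes.
\<close>

theorem KL_finite_length:
  fixes \<psi> :: "'a::euclidean_space \<Rightarrow> ereal" and z w :: "nat \<Rightarrow> 'a" and r \<Delta> :: "nat \<Rightarrow> real"
  assumes bounded: "bounded (range z)"
    and val: "\<And>k. k \<ge> N \<Longrightarrow> \<psi> (z k) = ereal (r k)"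
    and subgrad: "\<And>k. k \<ge> N \<Longrightarrow> w (Suc k) \<in> limiting_subdifferential \<psi> (z (Suc k))"
    and subgrad_bound: "\<And>k. k \<ge> N \<Longrightarrow> norm (w (Suc k)) \<le> C * (\<Delta> k + (r k - r (Suc k)))"
    and descent: "\<And>k. k \<ge> N \<Longrightarrow> c * (\<Delta> k)\<^sup>2 \<le> r k - r (Suc k)" and c: "0 < c"
    and \<Delta>: "\<And>k. 0 \<le> \<Delta> k"
    and lim: "r \<longlonglongrightarrow> l"
    and cluster: "\<And>s p. strict_mono s \<Longrightarrow> (z \<circ> s) \<longlonglongrightarrow> p \<Longrightarrow> \<psi> p = ereal l \<and> KL_property_at \<psi> p"
  shows "summable \<Delta>"
proof -
  have dec: "r (Suc k) \<le> r k" if "k \<ge> N" for k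
    using descent[OF that] c by (smt (verit) zero_le_power2 mult_nonneg_nonneg)
  have dec': "r k \<le> r j" if "N \<le> j" "j \<le> k" for j k
    using that(2)
  proof (induction rule: dec_induct)
    case (step i)
    then show ?case
      using dec[of i] that(1) by linarith
  qed simp
  have ge: "l \<le> r k" if "k \<ge> N" for k
    using lim by (rule LIMSEQ_le_const2) (use dec' that in auto)
  show ?thesis
  proof (cases "\<exists>j\<ge>N. r j = l")
    \<comment> \<open>The KL inequality says nothing at the limit value, but once it is attained all steps vanish.\<close>
    case True
    then obtain j where j: "j \<ge> N" "r j = l"
      by blast
    have "\<Delta> k = 0" if "k \<ge> j" for k
    proof -
      have "r k = l" "r (Suc k) = l"
        using j that dec'[of j k] dec'[of j "Suc k"] ge[of k] ge[of "Suc k"] by auto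
      then have "c * (\<Delta> k)\<^sup>2 \<le> 0"
        using descent[of k] j that by simp
      then show ?thesis
        using c by (simp add: mult_le_0_iff)
    qed
    then show ?thesis
      by (intro summable_finite[of "{..<j}"]) (auto simp: not_less)
  next
    case False
    then have gt: "l < r k" if "k \<ge> N" for k
      using ge[OF that] that by force
    let ?KL = "\<lambda>U \<eta> \<phi>. (0::ereal) < \<eta> \<and> desingularizing \<eta> \<phi> \<and> (\<forall>q\<in>U. ereal l < \<psi> q \<and> \<psi> q < ereal l + \<eta> \<longrightarrow>
           1 \<le> ereal (deriv \<phi> (real_of_ereal (\<psi> q - ereal l))) * dist_zero (limiting_subdifferential \<psi> q))"
    let ?good = "\<lambda>U. (\<forall>\<^sub>F k in sequentially. z k \<notin> U) \<or> (\<exists>\<eta> \<phi>. ?KL U \<eta> \<phi>)"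
    define \<C> where "\<C> = {U. open U \<and> ?good U}"
    \<comment> \<open>The cover is taken over the closure of the iterates because that set is compact; the members
      around points that are not cluster points are discarded once \<open>k\<close> is large.\<close>
    have "closure (range z) \<subseteq> \<Union>\<C>"
    proof
      fix p
      show "p \<in> \<Union>\<C>"
      proof (cases "\<exists>U. open U \<and> p \<in> U \<and> (\<forall>\<^sub>F k in sequentially. z k \<notin> U)")
        case True
        then show ?thesis
          by (auto simp: \<C>_def)
      next
        case no: False
        obtain s where s: "strict_mono s" "(z \<circ> s) \<longlonglongrightarrow> p"
        proof (rule convergent_subsequence_of_recurrence)
          fix U assume "open U" "p \<in> U"
          with no show "\<exists>\<^sub>F k in sequentially. z k \<in> U"
            by (auto simp: frequently_def)
        qed
        have "\<psi> p = ereal l" "KL_property_at \<psi> p"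
          using cluster[OF s] by auto
        then obtain \<eta> U \<phi> where "open U" "p \<in> U" "?KL U \<eta> \<phi>"
          unfolding KL_property_at_def by auto
        then show ?thesis
          unfolding \<C>_def by blast
      qed
    qed
    moreover have "compact (closure (range z))"
      using bounded by (simp add: compact_closure)
    moreover have "\<And>U. U \<in> \<C> \<Longrightarrow> open U"
      by (simp add: \<C>_def)
    ultimately obtain \<D> where \<D>: "\<D> \<subseteq> \<C>" "finite \<D>" "closure (range z) \<subseteq> \<Union>\<D>"
      by (metis compactE)
    define \<D>' where "\<D>' = {U \<in> \<D>. \<exists>\<eta> \<phi>. ?KL U \<eta> \<phi>}"
    have "\<forall>U\<in>\<D>'. \<exists>\<eta> \<phi>. ?KL U \<eta> \<phi>"
      by (simp add: \<D>'_def)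
    then obtain \<eta> where "\<forall>U\<in>\<D>'. \<exists>\<phi>. ?KL U (\<eta> U) \<phi>"
      by (rule bchoice[THEN exE])
    then obtain \<phi> where KL: "\<forall>U\<in>\<D>'. ?KL U (\<eta> U) (\<phi> U)"
      by (rule bchoice[THEN exE])
    have \<eta>: "0 < \<eta> U" and desing: "desingularizing (\<eta> U) (\<phi> U)" if "U \<in> \<D>'" for U
      using KL that by blast+
    have KL_ineq: "1 \<le> ereal (deriv (\<phi> U) (real_of_ereal (\<psi> q - ereal l))) *
        dist_zero (limiting_subdifferential \<psi> q)"
      if "U \<in> \<D>'" "q \<in> U" "ereal l < \<psi> q" "\<psi> q < ereal l + \<eta> U" for U q
      using KL that by blast
    have fin: "finite \<D>'"
      using \<D> by (simp add: \<D>'_def)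
    have "\<forall>U\<in>\<D> - \<D>'. \<forall>\<^sub>F k in sequentially. z k \<notin> U"
      using \<D> by (auto simp: \<D>'_def \<C>_def)
    then have ev1: "\<forall>\<^sub>F k in sequentially. \<forall>U\<in>\<D> - \<D>'. z k \<notin> U"
      using \<D> by (simp add: eventually_ball_finite)
    have "\<forall>\<^sub>F k in sequentially. ereal (r k - l) < \<eta> U" if "U \<in> \<D>'" for U
    proof -
      have "(\<lambda>k. ereal (r k - l)) \<longlonglongrightarrow> ereal (l - l)"
        by (intro tendsto_intros lim tendsto_ereal)
      then show ?thesis
        using \<eta>[OF that] by (intro order_tendstoD(2)) (auto simp: zero_ereal_def)
    qed
    then have "\<forall>\<^sub>F k in sequentially. \<forall>U\<in>\<D>'. ereal (r k - l) < \<eta> U"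
      using fin by (simp add: eventually_ball_finite)
    with ev1 have "\<forall>\<^sub>F k in sequentially. k \<ge> N \<and> (\<forall>U\<in>\<D> - \<D>'. z k \<notin> U) \<and> (\<forall>U\<in>\<D>'. ereal (r k - l) < \<eta> U)"
      by (intro eventually_conj eventually_ge_at_top)
    then obtain N' where "\<And>k. k \<ge> N' \<Longrightarrow> k \<ge> N \<and> (\<forall>U\<in>\<D> - \<D>'. z k \<notin> U) \<and> (\<forall>U\<in>\<D>'. ereal (r k - l) < \<eta> U)"
      unfolding eventually_sequentially by blast
    then have N': "\<And>k. k \<ge> N' \<Longrightarrow> k \<ge> N" "\<And>k U. k \<ge> N' \<Longrightarrow> U \<in> \<D> - \<D>' \<Longrightarrow> z k \<notin> U"
      "\<And>k U. k \<ge> N' \<Longrightarrow> U \<in> \<D>' \<Longrightarrow> ereal (r k - l) < \<eta> U"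
      by blast+
    define \<Phi> where "\<Phi> k = (\<Sum>U\<in>\<D>'. \<phi> U (r k - l))" for k
    have \<Phi>_nonneg: "0 \<le> \<Phi> k" if "k \<ge> N'" for k
      unfolding \<Phi>_def using desing N'(1,3)[OF that] ge[of k]
      by (intro sum_nonneg) (simp add: desingularizing_def)
    have tangent: "0 < deriv (\<phi> U) (r k - l)"
      "deriv (\<phi> U) (r k - l) * (r k - r (Suc k)) \<le> \<phi> U (r k - l) - \<phi> U (r (Suc k) - l)"
      if "k \<ge> N'" "U \<in> \<D>'" for k U
    proof -
      show "0 < deriv (\<phi> U) (r k - l)"
        using desing[OF that(2)] N'(1,3)[OF that(1)] gt[of k] that(2) by (simp add: desingularizing_def)
      from desingularizing_tangent[OF desing[OF that(2)], of "r k - l" "r (Suc k) - l"]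
      show "deriv (\<phi> U) (r k - l) * (r k - r (Suc k)) \<le> \<phi> U (r k - l) - \<phi> U (r (Suc k) - l)"
        using N'(1,3)[OF that(1)] gt[of k] that gt[of "Suc k"] dec[of k] by simp
    qed
    have desc: "r k - r (Suc k) \<le> norm (w k) * (\<Phi> k - \<Phi> (Suc k))"
      if k: "k \<ge> N'" "k \<ge> Suc N" for k
    proof -
      have "z k \<in> \<Union>\<D>"
        using \<D>(3) closure_subset[of "range z"] by (meson rangeI subsetD)
      then obtain U where "U \<in> \<D>" and zU: "z k \<in> U"
        by (rule UnionE)
      then have U: "U \<in> \<D>'" "z k \<in> U"
        using N'(2)[OF k(1), of U] by blast+
      have wk: "w k \<in> limiting_subdifferential \<psi> (z k)"
        using subgrad[of "k - 1"] k by simp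
      have "\<psi> (z k) < ereal l + \<eta> U"
        using val[of k] N'(1)[OF k(1)] N'(3)[OF k(1) U(1)] by (cases "\<eta> U") auto
      then have "1 \<le> ereal (deriv (\<phi> U) (r k - l)) * dist_zero (limiting_subdifferential \<psi> (z k))"
        using KL_ineq[OF U] val[of k] gt[of k] N'(1)[OF k(1)] by simp
      also have "\<dots> \<le> ereal (deriv (\<phi> U) (r k - l)) * ereal (norm (w k))"
        using tangent(1)[OF k(1) U(1)] by (intro ereal_mult_left_mono dist_zero_le_norm wk) auto
      finally have 1: "1 \<le> norm (w k) * deriv (\<phi> U) (r k - l)"
        by (simp add: one_ereal_def mult.commute)
      have "r k - r (Suc k) \<le> (norm (w k) * deriv (\<phi> U) (r k - l)) * (r k - r (Suc k))"
        using 1 dec[of k] k mult_right_mono[OF 1, of "r k - r (Suc k)"] by simp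
      also have "\<dots> = norm (w k) * (deriv (\<phi> U) (r k - l) * (r k - r (Suc k)))"
        by simp
      also have "deriv (\<phi> U) (r k - l) * (r k - r (Suc k)) \<le> \<Phi> k - \<Phi> (Suc k)"
      proof -
        have "deriv (\<phi> U) (r k - l) * (r k - r (Suc k)) \<le> (\<Sum>U\<in>\<D>'. deriv (\<phi> U) (r k - l) * (r k - r (Suc k)))"
        proof (rule member_le_sum[OF U(1) _ fin])
          fix U' assume "U' \<in> \<D>' - {U}"
          then have "0 < deriv (\<phi> U') (r k - l)"
            using tangent(1)[OF k(1)] by blast
          then show "0 \<le> deriv (\<phi> U') (r k - l) * (r k - r (Suc k))"
            using dec[of k] k by simp
        qed
        also have "\<dots> \<le> \<Phi> k - \<Phi> (Suc k)"
          unfolding \<Phi>_def sum_subtractf[symmetric] by (intro sum_mono tangent(2) k)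
        finally show ?thesis .
      qed
      finally show ?thesis
        by (simp add: mult_left_mono)
    qed
    define C' where "C' = \<bar>C\<bar> / c"
    define V where "V k = \<Delta> k + r k + 2 * (C' * \<Phi> (Suc k))" for k
    have C': "0 \<le> C'"
      using c by (simp add: C'_def)
    have "summable (\<lambda>k. \<Delta> (Suc k))"
    proof (rule summable_of_telescoping_bound[where V = V and B = l and N = "N' + N"])
      fix k assume k: "k \<ge> N' + N"
      show "0 \<le> \<Delta> (Suc k)"
        by (rule \<Delta>)
      show "l \<le> V k"
        using \<Delta>[of k] ge[of k] \<Phi>_nonneg[of "Suc k"] C' k unfolding V_def
        by (smt (verit) le_add2 le_SucI mult_nonneg_nonneg order_trans le_add1)
      let ?B = "\<Delta> k + (r k - r (Suc k))" and ?E = "\<Phi> (Suc k) - \<Phi> (Suc (Suc k))"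
      have B: "0 \<le> ?B"
        using \<Delta>[of k] dec[of k] k by simp
      have kk: "k \<ge> N" "Suc k \<ge> N'" "Suc k \<ge> Suc N" "Suc k \<ge> N"
        using k by auto
      have wB: "norm (w (Suc k)) \<le> \<bar>C\<bar> * ?B"
        using subgrad_bound[OF kk(1)] B by (meson abs_ge_self mult_right_mono order_trans)
      have cD: "c * (\<Delta> (Suc k))\<^sup>2 \<le> norm (w (Suc k)) * ?E"
        using descent[OF kk(4)] desc[OF kk(2,3)] by linarith
      \<comment> \<open>The arithmetic-geometric mean bound gives half of \<open>\<Delta> k\<close> on the right; absorbing it into the
        telescoping sum explains the factor \<open>2\<close> in \<open>V\<close>.\<close>
      show "\<Delta> (Suc k) \<le> V k - V (Suc k)"
      proof (cases "0 \<le> ?E")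
        case True
        have "c * (\<Delta> (Suc k))\<^sup>2 \<le> \<bar>C\<bar> * ?B * ?E"
          using cD mult_right_mono[OF wB True] by linarith
        then have "(\<Delta> (Suc k))\<^sup>2 \<le> ?B * (C' * ?E)"
          using c by (simp add: C'_def field_simps)
        also have "\<dots> \<le> ((?B + C' * ?E) / 2)\<^sup>2"
          using zero_le_power2[of "?B - C' * ?E"] by (simp add: power2_eq_square field_simps)
        finally have "\<Delta> (Suc k) \<le> (?B + C' * ?E) / 2"
          by (rule power2_le_imp_le) (use B True C' in auto)
        then show ?thesis
          using True C' mult_nonneg_nonneg[OF C' True] unfolding V_def by (simp add: algebra_simps)
      next
        case False
        have "norm (w (Suc k)) * ?E \<le> 0"
          using False by (intro mult_nonneg_nonpos) auto
        then have le: "r (Suc k) - r (Suc (Suc k)) \<le> 0"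
          using desc[OF kk(2,3)] by linarith
        then have "r (Suc k) = r (Suc (Suc k))"
          using dec[OF kk(4)] by linarith
        then have "\<Phi> (Suc k) = \<Phi> (Suc (Suc k))"
          by (simp add: \<Phi>_def)
        with False show ?thesis
          by simp
      qed
    qed
    then show ?thesis
      by (simp add: summable_Suc_iff)
  qed
qed

text \<open>
At a cluster point the subdifferential is nonempty, since the regular subgradients \<open>w k\<close> tend to
\<open>0\<close> while the values converge. So the KL property holds there for every KL function.
\<close>

corollary KL_function_finite_length:
  fixes \<psi> :: "'a::euclidean_space \<Rightarrow> ereal" and z w :: "nat \<Rightarrow> 'a" and r \<Delta> :: "nat \<Rightarrow> real"
  assumes KL: "KL_function \<psi>" and bounded: "bounded (range z)"
    and val: "\<And>k. k \<ge> N \<Longrightarrow> \<psi> (z k) = ereal (r k)"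
    and subgrad: "\<And>k. k \<ge> N \<Longrightarrow> w (Suc k) \<in> frechet_subdifferential \<psi> (z (Suc k))"
    and subgrad_bound: "\<And>k. k \<ge> N \<Longrightarrow> norm (w (Suc k)) \<le> C * (\<Delta> k + (r k - r (Suc k)))"
    and descent: "\<And>k. k \<ge> N \<Longrightarrow> c * (\<Delta> k)\<^sup>2 \<le> r k - r (Suc k)" and c: "0 < c"
    and \<Delta>: "\<And>k. 0 \<le> \<Delta> k"
    and lim: "r \<longlonglongrightarrow> l"
    and cluster: "\<And>s p. strict_mono s \<Longrightarrow> (z \<circ> s) \<longlonglongrightarrow> p \<Longrightarrow> \<psi> p = ereal l"
  shows "summable \<Delta>"
proof (rule KL_finite_length[OF bounded val _ subgrad_bound descent c \<Delta> lim])
  show "w (Suc k) \<in> limiting_subdifferential \<psi> (z (Suc k))" if "k \<ge> N" for k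
    using subgrad[OF that] frechet_subset_limiting by blast
  have r0: "(\<lambda>k. r k - r (Suc k)) \<longlonglongrightarrow> l - l"
    by (intro tendsto_diff lim LIMSEQ_Suc)
  have "(\<lambda>k. (\<Delta> k)\<^sup>2) \<longlonglongrightarrow> 0"
  proof (rule tendsto_sandwich[OF _ _ tendsto_const])
    show "\<forall>\<^sub>F k in sequentially. (\<Delta> k)\<^sup>2 \<le> (r k - r (Suc k)) / c"
      using descent c by (auto simp: eventually_sequentially field_simps intro!: exI[of _ N])
    show "(\<lambda>k. (r k - r (Suc k)) / c) \<longlonglongrightarrow> 0"
      using tendsto_divide[OF r0 tendsto_const, of c] c by simp
  qed simp
  then have \<Delta>0: "\<Delta> \<longlonglongrightarrow> 0"
    using tendsto_real_sqrt[of "\<lambda>k. (\<Delta> k)\<^sup>2" 0] \<Delta> by simp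
  have "(\<lambda>k. norm (w (Suc k))) \<longlonglongrightarrow> 0"
  proof (rule tendsto_sandwich[OF _ _ tendsto_const])
    show "\<forall>\<^sub>F k in sequentially. norm (w (Suc k)) \<le> C * (\<Delta> k + (r k - r (Suc k)))"
      using subgrad_bound by (auto simp: eventually_sequentially intro!: exI[of _ N])
    show "(\<lambda>k. C * (\<Delta> k + (r k - r (Suc k)))) \<longlonglongrightarrow> 0"
      using tendsto_mult[OF tendsto_const tendsto_add[OF \<Delta>0 r0], of C] by simp
  qed simp
  then have w0: "w \<longlonglongrightarrow> 0"
    using LIMSEQ_imp_Suc tendsto_norm_zero_iff by blast
  fix s :: "nat \<Rightarrow> nat" and p
  assume s: "strict_mono s" "(z \<circ> s) \<longlonglongrightarrow> p"
  have p: "\<psi> p = ereal l"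
    using cluster[OF s] .
  define t where "t j = s (j + Suc N)" for j
  have t: "strict_mono t"
    using s(1) by (simp add: t_def strict_mono_def)
  have tN: "t j \<ge> Suc N" for j
    using strict_mono_imp_increasing[OF s(1), of "j + Suc N"] by (simp add: t_def)
  have lim_t: "(\<lambda>j. a (t j)) \<longlonglongrightarrow> b" if "a \<longlonglongrightarrow> b" for a :: "nat \<Rightarrow> 'x::topological_space" and b
    using LIMSEQ_subseq_LIMSEQ[OF that t] by (simp add: o_def)
  have "0 \<in> limiting_subdifferential \<psi> p"
    unfolding limiting_subdifferential_def mem_Collect_eq
  proof (intro conjI exI allI)
    show "(\<lambda>j. z (t j)) \<longlonglongrightarrow> p"
      using LIMSEQ_ignore_initial_segment[OF s(2), of "Suc N"] by (simp add: t_def o_def)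
    have "(\<lambda>j. ereal (r (t j))) \<longlonglongrightarrow> ereal l"
      by (intro tendsto_ereal lim_t lim)
    then show "(\<lambda>j. \<psi> (z (t j))) \<longlonglongrightarrow> \<psi> p"
      using val tN p by (simp add: Suc_leD)
    show "w (t j) \<in> frechet_subdifferential \<psi> (z (t j))" for j
      using subgrad[of "t j - 1"] tN[of j] by simp
    show "(\<lambda>j. w (t j)) \<longlonglongrightarrow> 0"
      by (intro lim_t w0)
  qed (simp add: p)
  with KL p show "\<psi> p = ereal l \<and> KL_property_at \<psi> p"
    by (auto simp: KL_function_def)
qed

section \<open>Descent and cluster points of the iteration\<close>

text \<open>
The setting common to both conditions of the theorem, over arbitrary Euclidean spaces.
\<close>

locale fractional_splitting =
  fixes S :: "'a::euclidean_space set" and g :: "'a \<Rightarrow> ereal" and h :: "'a \<Rightarrow> real"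
    and f :: "'b::euclidean_space \<Rightarrow> ereal" and K :: "'a \<Rightarrow> 'b"
    and L \<delta> \<sigma> m M :: real
    and x u :: "nat \<Rightarrow> 'a" and y :: "nat \<Rightarrow> 'b" and \<theta> :: "nat \<Rightarrow> real"
  assumes linear_K: "linear K"
    and S: "convex S" "compact S"
    and g: "proper_fun g" "convex_fun g" "lsc_fun g"
    and h: "\<exists>U. open U \<and> S \<subseteq> U \<and> lipschitz_gradient_on L U h"
    and f: "proper_fun f" "convex_fun f"
    and K_S: "K ` S \<subseteq> interior (effective_domain f)"
    and f_pos: "\<forall>z\<in>S. 0 < f (K z)"
    and numerator_nonneg: "0 \<le> (INF z\<in>S. g z + ereal (h z))"
    and sigma: "0 < \<sigma>" "\<sigma> < 2"
    and delta: "0 < \<delta>" "L = 0 \<or> \<delta> < 1 / L"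
    and algorithm: "FPSA S g h f K \<delta> \<sigma> x y u \<theta>"
    and merit_bounds: "0 < m" "0 < M"
      "ereal m < (INF k. f (K (x k)))" "(SUP k. f (K (x k))) \<le> ereal M"
begin

abbreviation "T \<equiv> S \<inter> effective_domain g"
abbreviation "gr z \<equiv> real_of_ereal (g z)"
abbreviation "fr z \<equiv> real_of_ereal (f z)"
abbreviation "H \<equiv> gradient h"
abbreviation "Kt \<equiv> adjoint K"

text \<open>
The real value of \<open>\<phi>\<close> at points of \<open>T\<close>.
\<close>

definition num :: "'a \<Rightarrow> 'a \<Rightarrow> real" where
  "num z v = gr z + h z + 1 / (2 * \<delta>) * (norm (z - v))\<^sup>2"

lemma g_eq: "z \<in> T \<Longrightarrow> g z = ereal (gr z)"
  using proper_real[OF g(1)] by blast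

lemma fK_eq: "z \<in> S \<Longrightarrow> f (K z) = ereal (fr (K z))"
  using proper_real[OF f(1)] K_S interior_subset by blast

lemma fK_pos: "z \<in> S \<Longrightarrow> 0 < fr (K z)"
  using f_pos fK_eq by (metis ereal_less(2))

lemma inner_K: "K v \<bullet> w = Kt w \<bullet> v"
  using adjoint_works[OF linear_K, of v w] by (simp add: inner_commute)

sublocale K: linear K
  by (rule linear_K)

sublocale Kt: linear Kt
  by (rule adjoint_linear[OF linear_K])

lemma convex_T: "convex_on T gr"
proof -
  have conv: "convex_on (effective_domain g) gr"
    by (rule convex_on_real_of_convex_fun[OF g(2,1)])
  then show ?thesis
    by (rule convex_on_subset) (auto intro: convex_Int S(1) convex_on_imp_convex[OF conv])
qed

lemma L_nonneg: "0 \<le> L"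
  using h lipschitz_on_nonneg unfolding lipschitz_gradient_on_def by blast

lemma h_GDERIV: "z \<in> S \<Longrightarrow> GDERIV h z :> H z"
  using h differentiable_imp_GDERIV unfolding lipschitz_gradient_on_def by blast

lemma H_lipschitz: "norm (H a - H b) \<le> L * norm (a - b)" if "a \<in> S" "b \<in> S"
proof -
  obtain U where "S \<subseteq> U" "L-lipschitz_on U H"
    using h unfolding lipschitz_gradient_on_def by blast
  then show ?thesis
    using that lipschitz_on_normD by blast
qed

lemma H_cont: "continuous_on S H"
proof (rule lipschitz_on_continuous_on)
  show "L-lipschitz_on S H"
    using H_lipschitz L_nonneg by (intro lipschitz_onI) (auto simp: dist_norm)
qed

lemma h_cont: "continuous_on S h"
proof (rule continuous_at_imp_continuous_on, rule ballI)
  fix z assume "z \<in> S"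
  then have "(h has_derivative (\<lambda>v. v \<bullet> H z)) (at z)"
    using h_GDERIV by (simp add: gderiv_def)
  then show "isCont h z"
    by (rule has_derivative_continuous)
qed

lemma h_descent: "h b \<le> h a + H a \<bullet> (b - a) + L / 2 * (norm (b - a))\<^sup>2" if "a \<in> S" "b \<in> S"
proof -
  obtain U where "S \<subseteq> U" "lipschitz_gradient_on L U h"
    using h by blast
  moreover have "closed_segment a b \<subseteq> S"
    using S(1) that by (rule closed_segment_subset[rotated 2])
  ultimately show ?thesis
    using lipschitz_gradient_descent by blast
qed

lemma f_cont: "continuous_on (interior (effective_domain f)) fr"
proof (rule convex_on_continuous[OF open_interior])
  have "convex_on (effective_domain f) fr"
    by (rule convex_on_real_of_convex_fun[OF f(2,1)])
  then show "convex_on (interior (effective_domain f)) fr"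
    by (meson convex_interior convex_on_imp_convex convex_on_subset interior_subset)
qed

text \<open>
Continuity of \<open>f \<circ> K\<close> on \<open>S\<close>: \<open>K\<close> maps \<open>S\<close> into the interior of the domain, where the convex function \<open>f\<close>
is continuous.
\<close>

lemma fK_lim: "(\<lambda>j. fr (K (a j))) \<longlonglongrightarrow> fr (K p)" if "a \<longlonglongrightarrow> p" "\<And>j. a j \<in> S" "p \<in> S"
proof -
  have "continuous_on S (\<lambda>z. fr (K z))"
    by (rule continuous_on_compose2[OF f_cont linear_continuous_on K_S])
      (simp add: linear_K linear_conv_bounded_linear[symmetric])
  then show ?thesis
    using that by (intro continuous_on_tendsto_compose[OF _ that(1,3)]) simp_all
qed

lemma g_plus_h_nonneg: "z \<in> T \<Longrightarrow> 0 \<le> gr z + h z"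
proof -
  assume z: "z \<in> T"
  have "0 \<le> g z + ereal (h z)"
    using numerator_nonneg z by (auto intro: order_trans INF_lower)
  then show ?thesis
    using g_eq[OF z] by (metis ereal_less_eq(5) plus_ereal.simps(1))
qed

lemma num_ge_0: "z \<in> T \<Longrightarrow> 0 \<le> num z v"
  using g_plus_h_nonneg[of z] delta(1) by (simp add: num_def)

lemma phi_eq: "z \<in> T \<Longrightarrow> phi_fun S g h \<delta> z v = ereal (num z v)"
  using g_eq[of z] by (cases "g z") (simp_all add: phi_fun_def num_def indicator_fun_def)

lemma phi_infinity: "z \<notin> T \<Longrightarrow> phi_fun S g h \<delta> z v = \<infinity>"
  using g(1) by (cases "g z") (auto simp: phi_fun_def indicator_fun_def effective_domain_def proper_fun_def)

lemma vartheta_eq: "z \<in> T \<Longrightarrow> vartheta_fun S g h f K \<delta> z v = ereal (num z v / fr (K z))"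
  using phi_eq[of z v] fK_eq[of z] fK_pos[of z] by (cases "f (K z)") (simp_all add: vartheta_fun_def)

lemma \<theta>_vartheta: "ereal (\<theta> k) = vartheta_fun S g h f K \<delta> (x k) (u k)"
  using algorithm by (simp add: FPSA_def)

lemma x_in_T: "x k \<in> T"
  using \<theta>_vartheta[of k] by (auto simp: vartheta_fun_def split: if_splits)

lemma x_in_S: "x k \<in> S"
  using x_in_T by blast

lemma \<theta>_eq: "\<theta> k = num (x k) (u k) / fr (K (x k))"
  using \<theta>_vartheta[of k] vartheta_eq[OF x_in_T] by simp

lemma \<theta>_mult: "\<theta> k * fr (K (x k)) = num (x k) (u k)"
  using fK_pos[OF x_in_S[of k]] by (simp add: \<theta>_eq)

lemma \<theta>_nonneg: "0 \<le> \<theta> k"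
  using num_ge_0[OF x_in_T] fK_pos[OF x_in_S] by (simp add: \<theta>_eq less_imp_le)

lemma fx_bounds: "m < fr (K (x k))" "fr (K (x k)) \<le> M"
proof -
  have "ereal m < f (K (x k))"
    using merit_bounds(3) by (rule less_le_trans) (auto intro: INF_lower)
  then show "m < fr (K (x k))"
    using fK_eq[OF x_in_S[of k]] by (metis less_ereal.simps(1))
  have "f (K (x k)) \<le> ereal M"
    using merit_bounds(4) by (rule order_trans[rotated]) (auto intro: SUP_upper)
  then show "fr (K (x k)) \<le> M"
    using fK_eq[OF x_in_S[of k]] by (metis ereal_less_eq(3))
qed

lemma y_subgradient: "is_subgradient f (K (x k)) (y (Suc k))"
  using algorithm by (intro limiting_imp_is_subgradient f) (simp add: FPSA_def)

lemma y_ineq: "w \<in> effective_domain f \<Longrightarrow> fr (K (x k)) + y (Suc k) \<bullet> (w - K (x k)) \<le> fr w"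
proof -
  assume w: "w \<in> effective_domain f"
  have "f (K (x k)) + ereal (y (Suc k) \<bullet> (w - K (x k))) \<le> f w"
    using y_subgradient by (simp add: is_subgradient_def)
  then show ?thesis
    using proper_real[OF f(1) w] fK_eq[OF x_in_S[of k]] by (metis ereal_less_eq(3) plus_ereal.simps(1))
qed

lemma u_Suc: "u (Suc k) = (1 - \<sigma>) *\<^sub>R u k + \<sigma> *\<^sub>R x (Suc k)"
  using algorithm by (simp add: FPSA_def)

lemma u_diff: "u (Suc k) - u k = \<sigma> *\<^sub>R (x (Suc k) - u k)" "x (Suc k) - u (Suc k) = (1 - \<sigma>) *\<^sub>R (x (Suc k) - u k)"
  by (simp_all add: u_Suc algebra_simps)

text \<open>
The negative gradient, at \<open>x (Suc k)\<close>, of the quadratic in the subproblem for \<open>x (Suc k)\<close>.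
\<close>

definition \<xi> :: "nat \<Rightarrow> 'a" where
  "\<xi> k = \<theta> k *\<^sub>R Kt (y (Suc k)) - H (x k) - (1 / \<delta>) *\<^sub>R (x (Suc k) - u k)"

lemma \<xi>_subgradient:
  assumes z: "z \<in> T"
  shows "gr (x (Suc k)) + \<xi> k \<bullet> (z - x (Suc k)) \<le> gr z"
proof -
  let ?c = "u k - \<delta> *\<^sub>R H (x k) + (\<theta> k * \<delta>) *\<^sub>R Kt (y (Suc k))"
  let ?P = "\<lambda>z. g z + ereal (1 / (2 * \<delta>) *
      (norm (z - u k + \<delta> *\<^sub>R H (x k) - (\<theta> k * \<delta>) *\<^sub>R Kt (y (Suc k))))\<^sup>2)"
  have "is_arg_min ?P (\<lambda>z. z \<in> S) (x (Suc k))"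
    using algorithm unfolding FPSA_def by blast
  then have min: "?P (x (Suc k)) \<le> ?P q" if "q \<in> S" for q
    using that by (auto simp: is_arg_min_def not_less)
  have "gr (x (Suc k)) + 1 / (2 * \<delta>) * (norm (x (Suc k) - ?c))\<^sup>2 \<le> gr q + 1 / (2 * \<delta>) * (norm (q - ?c))\<^sup>2"
    if q: "q \<in> T" for q
    using min[of q] q g_eq[OF x_in_T[of "Suc k"]] g_eq[OF q]
    by (cases "g q"; cases "g (x (Suc k))") (simp_all add: algebra_simps)
  then have "gr (x (Suc k)) - (1 / \<delta>) * ((x (Suc k) - ?c) \<bullet> (z - x (Suc k))) \<le> gr z"
    by (intro prox_optimality[OF convex_T x_in_T delta(1) _ z])
  moreover have "\<xi> k = - ((1 / \<delta>) *\<^sub>R (x (Suc k) - ?c))"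
    using delta(1) by (simp add: \<xi>_def algebra_simps)
  ultimately show ?thesis
    by simp
qed

text \<open>
The linearization of \<open>f \<circ> K\<close> at \<open>x k\<close>, evaluated at \<open>x (Suc k)\<close>. By Fenchel-Young equality it is also the
denominator of \<open>\<varpi>\<close> at \<open>(x (Suc k), y (Suc k))\<close>, see \<open>den_conjugate\<close>.
\<close>

definition den :: "nat \<Rightarrow> real" where
  "den k = fr (K (x k)) + y (Suc k) \<bullet> (K (x (Suc k)) - K (x k))"

lemma den_le: "den k \<le> fr (K (x (Suc k)))"
  unfolding den_def by (rule y_ineq) (use K_S x_in_S interior_subset in blast)

text \<open>
The smaller of the gains per squared step of \<open>x\<close> and of \<open>u\<close>.
\<close>

definition numerator_decrease :: real where
  "numerator_decrease = min ((1 / \<delta> - L) / 2) ((2 - \<sigma>) / (2 * \<delta> * \<sigma>))"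

lemma numerator_decrease_pos: "0 < numerator_decrease"
proof -
  have "L < 1 / \<delta>"
  proof (cases "L = 0")
    case False
    then have "\<delta> < 1 / L" "0 < L"
      using delta L_nonneg by auto
    then show ?thesis
      using delta(1) by (simp add: field_simps)
  qed (use delta in simp)
  then show ?thesis
    using sigma delta(1) by (simp add: numerator_decrease_def)
qed

definition \<Delta> :: "nat \<Rightarrow> real" where
  "\<Delta> k = norm (x k - x (Suc k)) + norm (u k - u (Suc k))"

lemma \<Delta>_nonneg: "0 \<le> \<Delta> k"
  by (simp add: \<Delta>_def)

text \<open>
Test the subgradient \<open>\<xi> k\<close> at \<open>x k\<close>, expand the inner product with \<open>x (Suc k) - u k\<close> into squares, and
add the descent lemma for \<open>h\<close>. The gain in \<open>x\<close> is positive because \<open>\<delta> < 1 / L\<close>. Moving from \<open>u k\<close> to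
\<open>u (Suc k)\<close> shrinks the proximal term by the factor \<open>(1 - \<sigma>)\<^sup>2\<close>, which is below \<open>1\<close> because \<open>0 < \<sigma> < 2\<close>, and
this is the gain in \<open>u\<close>.
\<close>

lemma numerator_descent:
  "num (x (Suc k)) (u (Suc k)) \<le> \<theta> k * den k - numerator_decrease / 2 * (\<Delta> k)\<^sup>2"
proof -
  let ?x = "x k" and ?x' = "x (Suc k)" and ?u = "u k" and ?u' = "u (Suc k)" and ?y = "y (Suc k)"
  have 1: "gr ?x' + \<xi> k \<bullet> (?x - ?x') \<le> gr ?x"
    by (rule \<xi>_subgradient[OF x_in_T])
  have 2: "h ?x' \<le> h ?x + H ?x \<bullet> (?x' - ?x) + L / 2 * (norm (?x' - ?x))\<^sup>2"
    by (rule h_descent[OF x_in_S x_in_S])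
  have inner: "(1 / \<delta>) * ((?x' - ?u) \<bullet> (?x' - ?x)) =
      1 / (2 * \<delta>) * ((norm (?x' - ?u))\<^sup>2 + (norm (?x' - ?x))\<^sup>2 - (norm (?x - ?u))\<^sup>2)"
  proof -
    have "(norm (?x - ?u))\<^sup>2 = (norm (?x' - ?u))\<^sup>2 + (norm (?x' - ?x))\<^sup>2 - 2 * ((?x' - ?u) \<bullet> (?x' - ?x))"
      by (simp only: power2_norm_eq_inner) (simp add: inner_simps inner_commute)
    then show ?thesis
      using delta(1) by (simp add: field_simps)
  qed
  have 3: "\<xi> k \<bullet> (?x - ?x') = 1 / (2 * \<delta>) * ((norm (?x' - ?u))\<^sup>2 + (norm (?x' - ?x))\<^sup>2 - (norm (?x - ?u))\<^sup>2)
      + H ?x \<bullet> (?x' - ?x) - \<theta> k * (?y \<bullet> (K ?x' - K ?x))"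
  proof -
    have "\<xi> k \<bullet> (?x - ?x') = (1 / \<delta>) * ((?x' - ?u) \<bullet> (?x' - ?x)) + H ?x \<bullet> (?x' - ?x)
        - \<theta> k * (Kt ?y \<bullet> (?x' - ?x))"
      by (simp add: \<xi>_def inner_simps algebra_simps)
    moreover have "Kt ?y \<bullet> (?x' - ?x) = ?y \<bullet> (K ?x' - K ?x)"
      using inner_K[of "?x' - ?x" ?y] by (simp add: K.diff inner_commute)
    ultimately show ?thesis
      using inner by simp
  qed
  have 4: "1 / (2 * \<delta>) * (norm (?x' - ?u'))\<^sup>2
      = 1 / (2 * \<delta>) * (norm (?x' - ?u))\<^sup>2 - (2 - \<sigma>) / (2 * \<delta> * \<sigma>) * (norm (?u' - ?u))\<^sup>2"
    unfolding u_diff(1,2) norm_scaleR power_mult_distrib power2_abs using sigma delta(1)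
    by (simp add: field_simps power2_eq_square)
  have 5: "\<theta> k * den k = num ?x ?u + \<theta> k * (?y \<bullet> (K ?x' - K ?x))"
    using \<theta>_mult[of k] by (simp add: den_def distrib_left)
  have "num ?x' ?u' \<le> \<theta> k * den k - ((1 / \<delta> - L) / 2 * (norm (?x' - ?x))\<^sup>2
      + (2 - \<sigma>) / (2 * \<delta> * \<sigma>) * (norm (?u' - ?u))\<^sup>2)"
    using 1 2 unfolding 3 5 num_def 4 by (simp add: algebra_simps diff_divide_distrib add_divide_distrib)
  moreover have "numerator_decrease / 2 * (\<Delta> k)\<^sup>2 \<le> numerator_decrease * ((norm (?x' - ?x))\<^sup>2 + (norm (?u' - ?u))\<^sup>2)"
  proof -
    have "(a + b)\<^sup>2 \<le> 2 * (a\<^sup>2 + b\<^sup>2)" for a b :: real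
      using zero_le_power2[of "a - b"] by (simp add: power2_eq_square algebra_simps)
    then have "(\<Delta> k)\<^sup>2 \<le> 2 * ((norm (?x' - ?x))\<^sup>2 + (norm (?u' - ?u))\<^sup>2)"
      by (simp add: \<Delta>_def norm_minus_commute)
    then show ?thesis
      using numerator_decrease_pos by simp
  qed
  moreover have "numerator_decrease * ((norm (?x' - ?x))\<^sup>2 + (norm (?u' - ?u))\<^sup>2) \<le> (1 / \<delta> - L) / 2 * (norm (?x' - ?x))\<^sup>2
      + (2 - \<sigma>) / (2 * \<delta> * \<sigma>) * (norm (?u' - ?u))\<^sup>2"
    unfolding distrib_left numerator_decrease_def
    by (intro add_mono mult_right_mono min.cobounded1 min.cobounded2) simp_all
  ultimately show ?thesis
    by linarith
qed

text \<open>
The factor \<open>2\<close> comes from bounding the square of a sum of two norms, the factor \<open>M\<close> from the denominators.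
\<close>

definition decrease_rate :: real where "decrease_rate = numerator_decrease / (2 * M)"

lemma decrease_rate_pos: "0 < decrease_rate"
  using numerator_decrease_pos merit_bounds(2) by (simp add: decrease_rate_def)

text \<open>
The common source of the two descent inequalities: \<open>D\<close> is \<open>f (K (x (Suc k)))\<close> for \<open>\<vartheta>\<close> and \<open>den k\<close> for \<open>\<varpi>\<close>.
\<close>

lemma quotient_descent:
  assumes "den k \<le> D" "0 < D" "D \<le> M"
  shows "num (x (Suc k)) (u (Suc k)) / D \<le> \<theta> k - decrease_rate * (\<Delta> k)\<^sup>2"
proof -
  have "num (x (Suc k)) (u (Suc k)) \<le> \<theta> k * D - numerator_decrease / 2 * (\<Delta> k)\<^sup>2"
    using numerator_descent[of k] mult_left_mono[OF assms(1) \<theta>_nonneg[of k]] by linarith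
  then have "num (x (Suc k)) (u (Suc k)) / D \<le> (\<theta> k * D - numerator_decrease / 2 * (\<Delta> k)\<^sup>2) / D"
    using assms(2) by (simp add: divide_right_mono)
  also have "\<dots> = \<theta> k - numerator_decrease / 2 * (\<Delta> k)\<^sup>2 / D"
    using assms(2) by (simp add: diff_divide_distrib)
  also have "\<dots> \<le> \<theta> k - numerator_decrease / 2 * (\<Delta> k)\<^sup>2 / M"
    using assms numerator_decrease_pos by (intro diff_left_mono divide_left_mono) auto
  finally show ?thesis
    by (simp add: decrease_rate_def)
qed

lemma \<theta>_descent: "\<theta> (Suc k) \<le> \<theta> k - decrease_rate * (\<Delta> k)\<^sup>2"
  using quotient_descent[OF den_le fK_pos[OF x_in_S] fx_bounds(2)] by (simp add: \<theta>_eq[of "Suc k"])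

lemma \<theta>_dec: "\<theta> (Suc k) \<le> \<theta> k"
  using \<theta>_descent[of k] decrease_rate_pos by (smt (verit) mult_nonneg_nonneg zero_le_power2)

definition \<theta>_star :: real where "\<theta>_star = lim \<theta>"

lemma \<theta>_lim: "\<theta> \<longlonglongrightarrow> \<theta>_star"
proof -
  have "decseq \<theta>"
    using \<theta>_dec by (simp add: decseq_Suc_iff)
  then obtain l where "\<theta> \<longlonglongrightarrow> l"
    using decseq_convergent[of \<theta> 0] \<theta>_nonneg by blast
  then show ?thesis
    by (simp add: \<theta>_star_def limI)
qed

lemma \<theta>_le: "\<theta> k \<le> \<theta> 0"
  using \<theta>_dec by (induction k) (auto intro: order_trans)

lemma \<Delta>_lim: "\<Delta> \<longlonglongrightarrow> 0"
proof -
  have "(\<lambda>k. (\<Delta> k)\<^sup>2) \<longlonglongrightarrow> 0"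
  proof (rule tendsto_sandwich[OF _ _ tendsto_const])
    show "\<forall>\<^sub>F k in sequentially. (\<Delta> k)\<^sup>2 \<le> (\<theta> k - \<theta> (Suc k)) / decrease_rate"
      using \<theta>_descent decrease_rate_pos by (auto simp: field_simps)
    have "(\<lambda>k. (\<theta> k - \<theta> (Suc k)) / decrease_rate) \<longlonglongrightarrow> (\<theta>_star - \<theta>_star) / decrease_rate"
      by (intro tendsto_intros \<theta>_lim LIMSEQ_Suc) (use decrease_rate_pos in auto)
    then show "(\<lambda>k. (\<theta> k - \<theta> (Suc k)) / decrease_rate) \<longlonglongrightarrow> 0"
      by simp
  qed simp
  then show ?thesis
    using tendsto_real_sqrt[of "\<lambda>k. (\<Delta> k)\<^sup>2" 0] \<Delta>_nonneg by simp
qed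

lemma x_step_le: "norm (x (Suc k) - x k) \<le> \<Delta> k" and u_step_le: "norm (u (Suc k) - u k) \<le> \<Delta> k"
  by (simp_all add: \<Delta>_def norm_minus_commute)

lemma prox_step_le: "norm (x (Suc k) - u k) \<le> \<Delta> k / \<sigma>"
proof -
  have "norm (u (Suc k) - u k) = \<sigma> * norm (x (Suc k) - u k)"
    using u_diff(1)[of k] sigma by simp
  then show ?thesis
    using u_step_le[of k] sigma by (simp add: field_simps)
qed

lemma relaxed_prox_step_le: "norm (x (Suc k) - u (Suc k)) \<le> \<Delta> k / \<sigma>"
proof -
  have "norm (x (Suc k) - u (Suc k)) = \<bar>1 - \<sigma>\<bar> * norm (x (Suc k) - u k)"
    using u_diff(2)[of k] by simp
  also have "\<dots> \<le> 1 * norm (x (Suc k) - u k)"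
    using sigma by (intro mult_right_mono) auto
  finally show ?thesis
    using prox_step_le[of k] by simp
qed

lemma tendsto_0_of_le_\<Delta>: "a \<longlonglongrightarrow> (0::'c::real_normed_vector)" if "\<And>k. norm (a k) \<le> C * \<Delta> k"
  by (rule Lim_null_comparison[of _ "\<lambda>k. C * \<Delta> k"])
    (use that tendsto_mult_right_zero[OF \<Delta>_lim] in auto)

lemma y_bounded: obtains B where "0 < B" "\<And>k. norm (y (Suc k)) \<le> B"
proof -
  have "compact (K ` S)"
    by (intro compact_continuous_image linear_continuous_on S(2))
      (simp add: linear_K linear_conv_bounded_linear[symmetric])
  then obtain B where "\<And>a v. a \<in> K ` S \<Longrightarrow> is_subgradient f a v \<Longrightarrow> norm v \<le> B"
    using subgradients_bounded[OF f(2,1) _ K_S] by blast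
  then have "norm (y (Suc k)) \<le> B" for k
    using y_subgradient x_in_S by blast
  then show thesis
    using that[of "max B 1"] by (simp add: le_max_iff_disj)
qed

text \<open>
The identity for \<open>\<theta>\<close> shows that \<open>g (x (Suc k))\<close> converges along the subsequence to some \<open>\<gamma>\<close>. Lower
semicontinuity gives \<open>g p \<le> \<gamma>\<close>, so \<open>p\<close> is in the domain of \<open>g\<close>. The subgradient inequality for the
convergent sequence \<open>\<xi>\<close>, tested at \<open>p\<close>, gives the converse inequality. Thus values and subgradients
converge together.
\<close>

lemma cluster_point_properties:
  assumes s: "strict_mono s" and p: "(\<lambda>j. x (Suc (s j))) \<longlonglongrightarrow> p" and q: "(\<lambda>j. y (Suc (s j))) \<longlonglongrightarrow> q"
  shows "(\<lambda>j. u (Suc (s j))) \<longlonglongrightarrow> p" "p \<in> T" "is_subgradient f (K p) q"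
    "\<theta>_star = (gr p + h p) / fr (K p)" "m \<le> fr (K p)"
    "\<And>z. z \<in> T \<Longrightarrow> gr p + (\<theta>_star *\<^sub>R Kt q - H p) \<bullet> (z - p) \<le> gr z"
proof -
  have sub: "(\<lambda>j. a (s j)) \<longlonglongrightarrow> l" if "a \<longlonglongrightarrow> l" for a :: "nat \<Rightarrow> 'c::topological_space" and l
    using LIMSEQ_subseq_LIMSEQ[OF that s] by (simp add: o_def)
  have "(\<lambda>k. x (Suc k) - x k) \<longlonglongrightarrow> 0"
    using x_step_le by (intro tendsto_0_of_le_\<Delta>[of _ 1]) simp
  from tendsto_diff[OF p sub[OF this]] have x_lim: "(\<lambda>j. x (s j)) \<longlonglongrightarrow> p"
    by simp
  have xu0: "(\<lambda>k. x (Suc k) - u (Suc k)) \<longlonglongrightarrow> 0"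
    using relaxed_prox_step_le by (intro tendsto_0_of_le_\<Delta>[of _ "1 / \<sigma>"]) simp
  from tendsto_diff[OF p sub[OF this]] show u_lim: "(\<lambda>j. u (Suc (s j))) \<longlonglongrightarrow> p"
    by simp
  have xu: "(\<lambda>k. x (Suc k) - u k) \<longlonglongrightarrow> 0"
    using prox_step_le by (intro tendsto_0_of_le_\<Delta>[of _ "1 / \<sigma>"]) simp
  have pS: "p \<in> S"
    using S(2) x_lim x_in_S by (metis closed_sequentially compact_imp_closed)
  have f_lim: "(\<lambda>j. fr (K (x (Suc (s j))))) \<longlonglongrightarrow> fr (K p)" "(\<lambda>j. fr (K (x (s j)))) \<longlonglongrightarrow> fr (K p)"
    using fK_lim[OF p x_in_S pS] fK_lim[OF x_lim x_in_S pS] by auto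
  show "m \<le> fr (K p)"
    by (rule LIMSEQ_le_const[OF f_lim(2)]) (use fx_bounds(1) less_imp_le in blast)
  have fp: "0 < fr (K p)"
    by (rule fK_pos[OF pS])
  have h_lim: "(\<lambda>j. h (x (Suc (s j)))) \<longlonglongrightarrow> h p"
    using h_cont p x_in_S pS by (intro continuous_on_tendsto_compose[OF h_cont]) auto
  have H_lim: "(\<lambda>j. H (x (s j))) \<longlonglongrightarrow> H p"
    using x_lim x_in_S pS by (intro continuous_on_tendsto_compose[OF H_cont]) auto
  define \<gamma> where "\<gamma> = \<theta>_star * fr (K p) - h p"
  have "gr (x (Suc k)) = \<theta> (Suc k) * fr (K (x (Suc k))) - h (x (Suc k))
      - 1 / (2 * \<delta>) * (norm (x (Suc k) - u (Suc k)))\<^sup>2" for k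
    using \<theta>_mult[of "Suc k"] by (simp add: num_def)
  moreover have "(\<lambda>j. \<theta> (Suc (s j)) * fr (K (x (Suc (s j)))) - h (x (Suc (s j)))
      - 1 / (2 * \<delta>) * (norm (x (Suc (s j)) - u (Suc (s j))))\<^sup>2) \<longlonglongrightarrow>
      \<theta>_star * fr (K p) - h p - 1 / (2 * \<delta>) * (norm (0::'a))\<^sup>2"
    by (intro tendsto_intros sub[OF LIMSEQ_Suc[OF \<theta>_lim]] f_lim h_lim sub[OF xu0])
  ultimately have g_lim: "(\<lambda>j. gr (x (Suc (s j)))) \<longlonglongrightarrow> \<gamma>"
    by (simp add: \<gamma>_def)
  have "(\<lambda>j. g (x (Suc (s j)))) = (\<lambda>j. ereal (gr (x (Suc (s j)))))"
    using g_eq[OF x_in_T] by (intro ext)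
  with tendsto_ereal[OF g_lim] have "(\<lambda>j. g (x (Suc (s j)))) \<longlonglongrightarrow> ereal \<gamma>"
    by presburger
  then have "g p \<le> ereal \<gamma>"
    by (rule lsc_fun_sequentially[OF g(3) p])
  then have "p \<in> effective_domain g"
    by (auto simp: effective_domain_def)
  with pS show pT: "p \<in> T"
    by blast
  have "gr p \<le> \<gamma>"
    using \<open>g p \<le> ereal \<gamma>\<close> g_eq[OF pT] by (metis ereal_less_eq(3))
  have "(\<lambda>j. \<xi> (s j)) \<longlonglongrightarrow> \<theta>_star *\<^sub>R Kt q - H p - (1 / \<delta>) *\<^sub>R 0"
    unfolding \<xi>_def
    by (intro tendsto_intros sub[OF \<theta>_lim] H_lim sub[OF xu] bounded_linear.tendsto[OF _ q] linear_conv_bounded_linear[THEN iffD1])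
      (rule Kt.linear_axioms)
  then have \<xi>_lim: "(\<lambda>j. \<xi> (s j)) \<longlonglongrightarrow> \<theta>_star *\<^sub>R Kt q - H p"
    by simp
  have sub_\<gamma>: "\<gamma> + (\<theta>_star *\<^sub>R Kt q - H p) \<bullet> (z - p) \<le> gr z" if "z \<in> T" for z
  proof (rule LIMSEQ_le_const2)
    show "(\<lambda>j. gr (x (Suc (s j))) + \<xi> (s j) \<bullet> (z - x (Suc (s j)))) \<longlonglongrightarrow> \<gamma> + (\<theta>_star *\<^sub>R Kt q - H p) \<bullet> (z - p)"
      by (intro tendsto_intros g_lim \<xi>_lim p)
  qed (use \<xi>_subgradient[OF that] in blast)
  have "\<gamma> \<le> gr p"
    using sub_\<gamma>[OF pT] by simp
  with \<open>gr p \<le> \<gamma>\<close> have \<gamma>: "\<gamma> = gr p"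
    by simp
  then show "\<theta>_star = (gr p + h p) / fr (K p)"
    using fp by (simp add: \<gamma>_def field_simps)
  show "gr p + (\<theta>_star *\<^sub>R Kt q - H p) \<bullet> (z - p) \<le> gr z" if "z \<in> T" for z
    using sub_\<gamma>[OF that] \<gamma> by simp
  have K_lim: "(\<lambda>j. K (x (s j))) \<longlonglongrightarrow> K p"
    using linear_K by (intro bounded_linear.tendsto[OF _ x_lim]) (simp add: linear_conv_bounded_linear)
  show "is_subgradient f (K p) q"
    unfolding is_subgradient_def
  proof (intro conjI allI)
    show "\<bar>f (K p)\<bar> \<noteq> \<infinity>"
      using fK_eq[OF pS] by (cases "f (K p)") auto
    fix w
    show "f (K p) + ereal (q \<bullet> (w - K p)) \<le> f w"
    proof (cases "w \<in> effective_domain f")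
      case True
      have "fr (K p) + q \<bullet> (w - K p) \<le> fr w"
      proof (rule LIMSEQ_le_const2)
        show "(\<lambda>j. fr (K (x (s j))) + y (Suc (s j)) \<bullet> (w - K (x (s j)))) \<longlonglongrightarrow> fr (K p) + q \<bullet> (w - K p)"
          by (intro tendsto_intros f_lim q K_lim)
      qed (use y_ineq[OF True] in blast)
      then show ?thesis
        using fK_eq[OF pS] proper_real[OF f(1) True] by (metis ereal_less_eq(3) plus_ereal.simps(1))
    qed (simp add: effective_domain_def)
  qed
qed

section \<open>First-order data of the merit functions\<close>

text \<open>
Only \<open>h\<close> contributes an error term: \<open>g\<close> has a subgradient, and the convex proximal term lies above
its linearization.
\<close>

lemma numerator_first_order:
  assumes a: "a \<in> T" and sub: "\<And>z. z \<in> T \<Longrightarrow> gr a + e \<bullet> (z - a) \<le> gr z" and \<epsilon>: "0 < \<epsilon>"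
  shows "\<forall>\<^sub>F z in nhds a. \<forall>v'. z \<in> T \<longrightarrow> num a v + (e + H a + (1 / \<delta>) *\<^sub>R (a - v)) \<bullet> (z - a)
      + ((1 / \<delta>) *\<^sub>R (v - a)) \<bullet> (v' - v) - \<epsilon> * norm (z - a) \<le> num z v'"
proof -
  have "GDERIV h a :> H a"
    using a by (intro h_GDERIV) simp
  from GDERIV_first_order[OF this \<epsilon>] show ?thesis
  proof eventually_elim
    case (elim z)
    show ?case
    proof (intro allI impI)
      fix v' assume z: "z \<in> T"
      have "(norm (z - v'))\<^sup>2 - ((norm (a - v))\<^sup>2 + 2 * ((a - v) \<bullet> ((z - a) - (v' - v)))) = (norm ((z - v') - (a - v)))\<^sup>2"
        by (simp only: power2_norm_eq_inner) (simp add: inner_simps inner_commute)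
      then have "(norm (a - v))\<^sup>2 + 2 * ((a - v) \<bullet> ((z - a) - (v' - v))) \<le> (norm (z - v'))\<^sup>2"
        by (smt (verit) zero_le_power2)
      then have "1 / (2 * \<delta>) * ((norm (a - v))\<^sup>2 + 2 * ((a - v) \<bullet> ((z - a) - (v' - v)))) \<le> 1 / (2 * \<delta>) * (norm (z - v'))\<^sup>2"
        using delta(1) by (intro mult_left_mono) auto
      moreover have "1 / (2 * \<delta>) * ((norm (a - v))\<^sup>2 + 2 * ((a - v) \<bullet> ((z - a) - (v' - v)))) =
          1 / (2 * \<delta>) * (norm (a - v))\<^sup>2 + ((1 / \<delta>) *\<^sub>R (a - v)) \<bullet> (z - a) + ((1 / \<delta>) *\<^sub>R (v - a)) \<bullet> (v' - v)"
        using delta(1) by (simp add: field_simps inner_simps)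
      moreover have "gr a + e \<bullet> (z - a) \<le> gr z"
        by (rule sub[OF z])
      ultimately show "num a v + (e + H a + (1 / \<delta>) *\<^sub>R (a - v)) \<bullet> (z - a)
          + ((1 / \<delta>) *\<^sub>R (v - a)) \<bullet> (v' - v) - \<epsilon> * norm (z - a) \<le> num z v'"
        using elim unfolding num_def inner_add_left by linarith
    qed
  qed
qed

definition K_bound :: real where "K_bound = onorm K + 1"

lemma K_bound: "0 < K_bound" "norm (K v) \<le> K_bound * norm v"
proof -
  have K: "bounded_linear K"
    by (simp add: linear_conv_bounded_linear[symmetric] linear_K)
  show "0 < K_bound"
    using onorm_pos_le[OF K] by (simp add: K_bound_def)
  show "norm (K v) \<le> K_bound * norm v"
    using onorm[OF K, of v] by (simp add: K_bound_def distrib_right add_increasing2)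
qed

lemma K_step_le: "norm (K (x (Suc k)) - K (x k)) \<le> K_bound * \<Delta> k"
proof -
  have "norm (K (x (Suc k)) - K (x k)) \<le> K_bound * norm (x (Suc k) - x k)"
    using K_bound(2)[of "x (Suc k) - x k"] by (simp add: K.diff)
  also have "\<dots> \<le> K_bound * \<Delta> k"
    using K_bound(1) x_step_le by (intro mult_left_mono) auto
  finally show ?thesis .
qed

text \<open>
The two components of the first-order minorant of \<open>num\<close> at \<open>(x (Suc k), u (Suc k))\<close>.
\<close>

abbreviation "x_part k \<equiv> \<xi> k + H (x (Suc k)) + (1 / \<delta>) *\<^sub>R (x (Suc k) - u (Suc k))"
abbreviation "u_part k \<equiv> (1 / \<delta>) *\<^sub>R (u (Suc k) - x (Suc k))"

text \<open>
In the \<open>x\<close> component of a subgradient of either merit function, the definition of \<open>\<xi>\<close> cancels all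
terms except differences of consecutive iterates and a multiple of \<open>\<theta> k - \<eta>\<close>, where \<open>\<eta>\<close> is the new
merit value.
\<close>

lemma x_part_residual:
  obtains C where "0 < C" "\<And>k \<eta>. \<eta> \<le> \<theta> k \<Longrightarrow> norm (x_part k - \<eta> *\<^sub>R Kt (y (Suc k))) \<le> C * (\<Delta> k + (\<theta> k - \<eta>))"
proof -
  obtain B where B: "0 < B" "\<And>k. norm (y (Suc k)) \<le> B"
    by (rule y_bounded) blast
  obtain kt where kt: "0 < kt" "\<And>w. norm (Kt w) \<le> norm w * kt"
    using linear_bounded_pos[OF Kt.linear_axioms] by (auto simp: mult.commute)
  \<comment> \<open>The three constants belong to the step of \<open>\<nabla>h\<close>, the step of \<open>u\<close>, and the bound on the adjoint image of \<open>y\<close>.\<close>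
  show thesis
  proof (rule that)
    show "0 < L + 1 / \<delta> + B * kt"
      using L_nonneg delta(1) B kt by (intro add_nonneg_pos add_nonneg_nonneg) auto
    fix k \<eta> assume \<eta>: "\<eta> \<le> \<theta> k"
    have "x_part k - \<eta> *\<^sub>R Kt (y (Suc k)) = (H (x (Suc k)) - H (x k)) - (1 / \<delta>) *\<^sub>R (u (Suc k) - u k)
        + (\<theta> k - \<eta>) *\<^sub>R Kt (y (Suc k))"
      by (simp add: \<xi>_def algebra_simps)
    also have "norm \<dots> \<le> norm (H (x (Suc k)) - H (x k)) + norm ((1 / \<delta>) *\<^sub>R (u (Suc k) - u k))
        + norm ((\<theta> k - \<eta>) *\<^sub>R Kt (y (Suc k)))"
      by (rule norm_triangle_le[OF add_right_mono[OF norm_triangle_ineq4]])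
    also have "\<dots> \<le> L * \<Delta> k + 1 / \<delta> * \<Delta> k + (\<theta> k - \<eta>) * (B * kt)"
    proof (intro add_mono)
      show "norm (H (x (Suc k)) - H (x k)) \<le> L * \<Delta> k"
        using H_lipschitz[OF x_in_S x_in_S, of "Suc k" k] mult_left_mono[OF x_step_le[of k] L_nonneg] by linarith
      show "norm ((1 / \<delta>) *\<^sub>R (u (Suc k) - u k)) \<le> 1 / \<delta> * \<Delta> k"
        unfolding norm_scaleR using delta(1) u_step_le[of k] by (intro mult_mono) auto
      have "norm (Kt (y (Suc k))) \<le> B * kt"
        using kt(2)[of "y (Suc k)"] mult_right_mono[OF B(2)[of k], of kt] kt(1) by linarith
      then show "norm ((\<theta> k - \<eta>) *\<^sub>R Kt (y (Suc k))) \<le> (\<theta> k - \<eta>) * (B * kt)"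
        unfolding norm_scaleR using \<eta> by (intro mult_mono) auto
    qed
    also have "\<dots> \<le> (L + 1 / \<delta> + B * kt) * (\<Delta> k + (\<theta> k - \<eta>))"
    proof -
      have "0 \<le> (L + 1 / \<delta>) * (\<theta> k - \<eta>)" "0 \<le> B * kt * \<Delta> k"
        using \<eta> L_nonneg delta(1) B kt \<Delta>_nonneg[of k] by auto
      then show ?thesis
        by (simp add: algebra_simps)
    qed
    finally show "norm (x_part k - \<eta> *\<^sub>R Kt (y (Suc k))) \<le> (L + 1 / \<delta> + B * kt) * (\<Delta> k + (\<theta> k - \<eta>))" .
  qed
qed

lemma u_part_le: "norm (u_part k) \<le> 1 / (\<delta> * \<sigma>) * \<Delta> k"
proof -
  have "norm (u_part k) = 1 / \<delta> * norm (x (Suc k) - u (Suc k))"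
    using delta(1) by (simp add: norm_minus_commute)
  also have "\<dots> \<le> 1 / \<delta> * (\<Delta> k / \<sigma>)"
    using delta(1) relaxed_prox_step_le by (intro mult_left_mono) auto
  finally show ?thesis
    by simp
qed

lemma bounded_x: "bounded (range (\<lambda>k. x (Suc k)))"
  by (rule bounded_subset[OF compact_imp_bounded[OF S(2)]]) (use x_in_S in auto)

lemma bounded_u: "bounded (range (\<lambda>k. u (Suc k)))"
proof -
  have "(\<lambda>k. x (Suc k) - u (Suc k)) \<longlonglongrightarrow> 0"
    using relaxed_prox_step_le by (intro tendsto_0_of_le_\<Delta>[of _ "1 / \<sigma>"]) simp
  then have "bounded (range (\<lambda>k. x (Suc k) - u (Suc k)))"
    by (intro convergent_imp_bounded)
  from bounded_minus_comp[OF bounded_x this] show ?thesis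
    by simp
qed

lemma y_convergent_subsequence:
  fixes s :: "nat \<Rightarrow> nat"
  obtains r q where "strict_mono r" "(\<lambda>j. y (Suc (s (r j)))) \<longlonglongrightarrow> q"
proof -
  obtain B where B: "0 < B" "\<And>k. norm (y (Suc k)) \<le> B"
    by (rule y_bounded) blast
  then have "bounded (range (\<lambda>j. y (Suc (s j))))"
    by (auto simp: bounded_iff)
  then obtain q r where "strict_mono r" "((\<lambda>j. y (Suc (s j))) \<circ> r) \<longlonglongrightarrow> q"
    using bounded_imp_convergent_subsequence by blast
  then show thesis
    using that by (simp add: o_def)
qed

lemma numerator_first_order_at:
  assumes \<epsilon>: "0 < \<epsilon>" and \<pi>: "filterlim \<pi> (nhds (x (Suc k))) F"
  shows "\<forall>\<^sub>F z in F. \<forall>v'. \<pi> z \<in> T \<longrightarrow> num (x (Suc k)) (u (Suc k)) + x_part k \<bullet> (\<pi> z - x (Suc k))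
      + u_part k \<bullet> (v' - u (Suc k)) - \<epsilon> * norm (\<pi> z - x (Suc k)) \<le> num (\<pi> z) v'"
  by (rule eventually_compose_filterlim[OF numerator_first_order[OF x_in_T \<xi>_subgradient \<epsilon>] \<pi>])

section \<open>Finite length for a smooth denominator\<close>

lemma vartheta_subgradient:
  assumes fd: "GDERIV (\<lambda>z. fr z) (K (x (Suc k))) :> q"
  shows "(1 / fr (K (x (Suc k)))) *\<^sub>R ((x_part k, u_part k) - \<theta> (Suc k) *\<^sub>R (Kt q, 0))
    \<in> frechet_subdifferential (\<lambda>(x, u). vartheta_fun S g h f K \<delta> x u) (x (Suc k), u (Suc k))"
  unfolding \<theta>_eq[of "Suc k"]
proof (rule quotient_frechet_subgradient)
  let ?a = "(x (Suc k), u (Suc k))"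
  show "(case ?a of (x, u) \<Rightarrow> vartheta_fun S g h f K \<delta> x u) = ereal (num (x (Suc k)) (u (Suc k)) / fr (K (x (Suc k))))"
    using vartheta_eq[OF x_in_T] by simp
  show "0 \<le> num (x (Suc k)) (u (Suc k))"
    by (rule num_ge_0[OF x_in_T])
  show "0 < fr (K (x (Suc k)))"
    by (rule fK_pos[OF x_in_S])
  fix \<epsilon> :: real assume \<epsilon>: "0 < \<epsilon>"
  have fst: "(fst \<longlongrightarrow> x (Suc k)) (at ?a)"
    using tendsto_fst[OF tendsto_ident_at, of ?a UNIV] by simp
  have "((\<lambda>z. K (fst z)) \<longlongrightarrow> K (x (Suc k))) (at ?a)"
    using linear_K by (intro bounded_linear.tendsto[OF _ fst]) (simp add: linear_conv_bounded_linear)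
  moreover have "0 < \<epsilon> / K_bound"
    using \<epsilon> K_bound by simp
  ultimately have "\<forall>\<^sub>F z in at ?a. \<bar>fr (K (fst z)) - fr (K (x (Suc k))) - q \<bullet> (K (fst z) - K (x (Suc k)))\<bar>
      \<le> \<epsilon> / K_bound * norm (K (fst z) - K (x (Suc k)))"
    using GDERIV_first_order[OF fd] eventually_compose_filterlim by blast
  with numerator_first_order_at[where k = k, OF \<epsilon> fst]
  show "\<forall>\<^sub>F z in at ?a. (case z of (x, u) \<Rightarrow> vartheta_fun S g h f K \<delta> x u) = \<infinity> \<or>
      (\<exists>n D. (case z of (x, u) \<Rightarrow> vartheta_fun S g h f K \<delta> x u) = ereal (n / D) \<and> 0 \<le> n \<and> 0 < D \<and>
        num (x (Suc k)) (u (Suc k)) + (x_part k, u_part k) \<bullet> (z - ?a) - \<epsilon> * norm (z - ?a) \<le> n \<and>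
        D \<le> fr (K (x (Suc k))) + (Kt q, 0) \<bullet> (z - ?a) + \<epsilon> * norm (z - ?a))"
  proof eventually_elim
    case (elim z)
    obtain z1 z2 where z: "z = (z1, z2)"
      by (cases z)
    show ?case
    proof (cases "z1 \<in> T")
      case True
      have le: "\<epsilon> * norm (z1 - x (Suc k)) \<le> \<epsilon> * norm (z - ?a)"
        using \<epsilon> norm_fst_le[of "z1 - x (Suc k)" "z2 - u (Suc k)"] by (simp add: z)
      have "num (x (Suc k)) (u (Suc k)) + (x_part k, u_part k) \<bullet> (z - ?a) - \<epsilon> * norm (z - ?a) \<le> num z1 z2"
        using elim(1)[rule_format, of z2] True le by (simp add: z)
      moreover have "fr (K z1) \<le> fr (K (x (Suc k))) + (Kt q, 0) \<bullet> (z - ?a) + \<epsilon> * norm (z - ?a)"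
      proof -
        have "\<epsilon> / K_bound * norm (K z1 - K (x (Suc k))) \<le> \<epsilon> / K_bound * (K_bound * norm (z1 - x (Suc k)))"
          using K_bound(2)[of "z1 - x (Suc k)"] \<epsilon> K_bound(1) by (intro mult_left_mono) (auto simp: K.diff)
        also have "\<dots> \<le> \<epsilon> * norm (z - ?a)"
          using K_bound(1) le by simp
        finally have "fr (K z1) \<le> fr (K (x (Suc k))) + q \<bullet> (K z1 - K (x (Suc k))) + \<epsilon> * norm (z - ?a)"
          using elim(2) by (simp add: z abs_le_iff)
        moreover have "q \<bullet> (K z1 - K (x (Suc k))) = Kt q \<bullet> (z1 - x (Suc k))"
          using inner_K[of "z1 - x (Suc k)" q] by (simp add: K.diff inner_commute)
        ultimately show ?thesis
          by (simp add: z)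
      qed
      moreover have "vartheta_fun S g h f K \<delta> z1 z2 = ereal (num z1 z2 / fr (K z1))" "0 \<le> num z1 z2" "0 < fr (K z1)"
        using vartheta_eq[OF True] num_ge_0[OF True] fK_pos[of z1] True by auto
      ultimately show ?thesis
        unfolding z prod.case by blast
    next
      case False
      then have "vartheta_fun S g h f K \<delta> z1 z2 = \<infinity>"
        unfolding vartheta_fun_def by (rule if_not_P)
      then show ?thesis
        by (simp add: z)
    qed
  qed
qed

text \<open>
Smoothness makes \<open>y\<close> the gradient of \<open>f\<close> along the iterates. Hence \<open>y (Suc (Suc k))\<close>, which enters the
subgradient of \<open>\<vartheta>\<close> at \<open>x (Suc k)\<close>, differs from \<open>y (Suc k)\<close>, which enters \<open>\<xi> k\<close>, by at most a
multiple of \<open>\<Delta> k\<close>.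
\<close>

lemma summable_of_KL_vartheta:
  assumes U: "open U" "K ` S \<subseteq> U" "U \<subseteq> effective_domain f"
    and lip: "lipschitz_gradient_on L' U (\<lambda>z. fr z)"
    and KL: "KL_function (\<lambda>(x, u). vartheta_fun S g h f K \<delta> x u)"
  shows "summable \<Delta>"
proof -
  have y_grad: "GDERIV (\<lambda>z. fr z) (K (x k)) :> y (Suc k)" for k
  proof -
    have KU: "K (x k) \<in> U"
      using U(2) x_in_S by blast
    have D: "GDERIV (\<lambda>z. fr z) (K (x k)) :> gradient (\<lambda>z. fr z) (K (x k))"
      using lip KU by (intro differentiable_imp_GDERIV) (simp add: lipschitz_gradient_on_def)
    have "\<forall>\<^sub>F z in nhds (K (x k)). z \<in> U"
      using U(1) KU by (rule eventually_nhds_in_open)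
    then have "\<forall>\<^sub>F z in nhds (K (x k)). fr (K (x k)) + y (Suc k) \<bullet> (z - K (x k)) \<le> fr z"
      by (rule eventually_mono) (use U(3) y_ineq in blast)
    from gradient_eq_subgradient[OF D this] D show ?thesis
      by simp
  qed
  obtain C where C: "0 < C" "\<And>k \<eta>. \<eta> \<le> \<theta> k \<Longrightarrow> norm (x_part k - \<eta> *\<^sub>R Kt (y (Suc k))) \<le> C * (\<Delta> k + (\<theta> k - \<eta>))"
    by (rule x_part_residual) blast
  obtain kt where kt: "0 < kt" "\<And>w. norm (Kt w) \<le> norm w * kt"
    using linear_bounded_pos[OF Kt.linear_axioms] by (auto simp: mult.commute)
  define w where "w k = (1 / fr (K (x (Suc k)))) *\<^sub>R ((x_part k, u_part k) - \<theta> (Suc k) *\<^sub>R (Kt (y (Suc (Suc k))), 0))" for k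
  have L': "0 \<le> L'"
    using lip lipschitz_on_nonneg unfolding lipschitz_gradient_on_def by blast
  define C2 where "C2 = C + \<theta> 0 * (L' * K_bound * kt) + 1 / (\<delta> * \<sigma>)"
  have w_bound: "norm (w k) \<le> C2 / m * (\<Delta> k + (\<theta> k - \<theta> (Suc k)))" for k
  proof -
    let ?y = "y (Suc k)" and ?y' = "y (Suc (Suc k))"
    have y_lip: "norm (?y - ?y') \<le> L' * (K_bound * \<Delta> k)"
    proof -
      have "?y = gradient (\<lambda>z. fr z) (K (x k))" "?y' = gradient (\<lambda>z. fr z) (K (x (Suc k)))"
        using gradient_eq[OF y_grad[of k]] gradient_eq[OF y_grad[of "Suc k"]] by simp_all
      moreover have "norm (gradient (\<lambda>z. fr z) (K (x k)) - gradient (\<lambda>z. fr z) (K (x (Suc k))))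
          \<le> L' * norm (K (x k) - K (x (Suc k)))"
      proof (rule lipschitz_on_normD)
        show "L'-lipschitz_on U (gradient (\<lambda>z. fr z))"
          using lip by (simp add: lipschitz_gradient_on_def)
      qed (use U(2) x_in_S in blast)+
      ultimately have "norm (?y - ?y') \<le> L' * norm (K (x k) - K (x (Suc k)))"
        by simp
      also have "\<dots> \<le> L' * (K_bound * \<Delta> k)"
        using K_step_le[of k] L' by (intro mult_left_mono) (auto simp: norm_minus_commute)
      finally show ?thesis .
    qed
    have split: "x_part k - \<theta> (Suc k) *\<^sub>R Kt ?y' = (x_part k - \<theta> (Suc k) *\<^sub>R Kt ?y) + \<theta> (Suc k) *\<^sub>R Kt (?y - ?y')"
      by (simp add: Kt.diff algebra_simps)
    have "norm (\<theta> (Suc k) *\<^sub>R Kt (?y - ?y')) \<le> \<theta> 0 * (L' * K_bound * kt * \<Delta> k)"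
    proof -
      have "norm (Kt (?y - ?y')) \<le> L' * (K_bound * \<Delta> k) * kt"
        using kt(2)[of "?y - ?y'"] mult_right_mono[OF y_lip, of kt] kt(1) by linarith
      then show ?thesis
        unfolding norm_scaleR using \<theta>_nonneg[of "Suc k"] \<theta>_le[of "Suc k"] \<theta>_nonneg[of 0]
        by (intro mult_mono) (auto simp: mult_ac)
    qed
    then have 1: "norm (x_part k - \<theta> (Suc k) *\<^sub>R Kt ?y') \<le> C * (\<Delta> k + (\<theta> k - \<theta> (Suc k))) + \<theta> 0 * (L' * K_bound * kt) * \<Delta> k"
      unfolding split using C(2)[OF \<theta>_dec[of k]]
      by (intro norm_triangle_le add_mono) (auto simp: mult_ac)
    have "w k = (1 / fr (K (x (Suc k)))) *\<^sub>R (x_part k - \<theta> (Suc k) *\<^sub>R Kt ?y', u_part k)"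
      by (simp add: w_def)
    then have "norm (w k) = 1 / fr (K (x (Suc k))) * norm (x_part k - \<theta> (Suc k) *\<^sub>R Kt ?y', u_part k)"
      using fK_pos[OF x_in_S[of "Suc k"]] by (simp only: norm_scaleR real_norm_def abs_divide abs_one abs_of_pos)
    also have "\<dots> \<le> 1 / m * norm (x_part k - \<theta> (Suc k) *\<^sub>R Kt ?y', u_part k)"
      using fx_bounds(1)[of "Suc k"] merit_bounds(1) by (intro mult_right_mono divide_left_mono) auto
    also have "\<dots> \<le> 1 / m * (C2 * (\<Delta> k + (\<theta> k - \<theta> (Suc k))))"
    proof (rule mult_left_mono)
      have "norm (x_part k - \<theta> (Suc k) *\<^sub>R Kt ?y', u_part k) \<le> C * (\<Delta> k + (\<theta> k - \<theta> (Suc k)))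
          + \<theta> 0 * (L' * K_bound * kt) * \<Delta> k + 1 / (\<delta> * \<sigma>) * \<Delta> k"
        using norm_Pair_le[of "x_part k - \<theta> (Suc k) *\<^sub>R Kt ?y'" "u_part k"] 1 u_part_le[of k] by linarith
      also have "\<dots> \<le> C2 * (\<Delta> k + (\<theta> k - \<theta> (Suc k)))"
      proof -
        have "0 \<le> (\<theta> 0 * (L' * K_bound * kt) + 1 / (\<delta> * \<sigma>)) * (\<theta> k - \<theta> (Suc k))"
          using \<theta>_nonneg[of 0] L' K_bound(1) kt(1) delta(1) sigma(1) \<theta>_dec[of k]
          by (intro mult_nonneg_nonneg add_nonneg_nonneg) auto
        then show ?thesis
          by (simp add: C2_def algebra_simps)
      qed
      finally show "norm (x_part k - \<theta> (Suc k) *\<^sub>R Kt ?y', u_part k) \<le> C2 * (\<Delta> k + (\<theta> k - \<theta> (Suc k)))" .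
    qed (use merit_bounds in auto)
    finally show ?thesis
      by simp
  qed
  define z where "z k = (x (Suc k), u (Suc k))" for k
  have "summable (\<lambda>k. \<Delta> (Suc k))"
  proof (rule KL_function_finite_length[OF KL, where z = z and w = w and r = "\<lambda>k. \<theta> (Suc k)"
        and N = 0 and C = "C2 / m" and c = decrease_rate and l = \<theta>_star])
    have "range z \<subseteq> range (\<lambda>k. x (Suc k)) \<times> range (\<lambda>k. u (Suc k))"
      by (auto simp: z_def)
    then show "bounded (range z)"
      using bounded_Times[OF bounded_x bounded_u] bounded_subset by blast
    show "(case z k of (x, u) \<Rightarrow> vartheta_fun S g h f K \<delta> x u) = ereal (\<theta> (Suc k))" for k
      by (simp add: z_def \<theta>_vartheta)
    show "w (Suc k) \<in> frechet_subdifferential (\<lambda>(x, u). vartheta_fun S g h f K \<delta> x u) (z (Suc k))" for k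
      unfolding w_def z_def by (rule vartheta_subgradient[OF y_grad])
    show "norm (w (Suc k)) \<le> C2 / m * (\<Delta> (Suc k) + (\<theta> (Suc k) - \<theta> (Suc (Suc k))))" for k
      by (rule w_bound)
    show "decrease_rate * (\<Delta> (Suc k))\<^sup>2 \<le> \<theta> (Suc k) - \<theta> (Suc (Suc k))" for k
      using \<theta>_descent[of "Suc k"] by simp
    show "(\<lambda>k. \<theta> (Suc k)) \<longlonglongrightarrow> \<theta>_star"
      by (rule LIMSEQ_Suc[OF \<theta>_lim])
    fix s :: "nat \<Rightarrow> nat" and p
    assume s: "strict_mono s" "(z \<circ> s) \<longlonglongrightarrow> p"
    obtain r q where r: "strict_mono r" "(\<lambda>j. y (Suc (s (r j)))) \<longlonglongrightarrow> q"
      by (rule y_convergent_subsequence)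
    have zs: "(\<lambda>j. z (s (r j))) \<longlonglongrightarrow> p"
      using LIMSEQ_subseq_LIMSEQ[OF s(2) r(1)] by (simp add: o_def)
    have x_lim: "(\<lambda>j. x (Suc (s (r j)))) \<longlonglongrightarrow> fst p"
      using tendsto_fst[OF zs] by (simp add: z_def)
    have u_lim: "(\<lambda>j. u (Suc (s (r j)))) \<longlonglongrightarrow> snd p"
      using tendsto_snd[OF zs] by (simp add: z_def)
    have sr: "strict_mono (\<lambda>j. s (r j))"
      using s(1) r(1) by (simp add: strict_mono_def)
    note cl = cluster_point_properties[OF sr x_lim r(2)]
    have "snd p = fst p"
      using LIMSEQ_unique[OF u_lim cl(1)] .
    then have "p = (fst p, fst p)"
      by (simp add: prod_eq_iff)
    then obtain p0 where p0: "p = (p0, p0)" "fst p = p0"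
      by blast
    show "(case p of (x, u) \<Rightarrow> vartheta_fun S g h f K \<delta> x u) = ereal \<theta>_star"
      using vartheta_eq[of p0 p0] cl(2,4) by (simp add: p0 num_def)
  qed (use decrease_rate_pos \<Delta>_nonneg in auto)
  then show ?thesis
    by (simp add: summable_Suc_iff)
qed

section \<open>Finite length through the conjugate of the denominator\<close>

text \<open>
The value of \<open>\<varpi>\<close> at \<open>(x (Suc k), y (Suc k), u (Suc k))\<close>, see \<open>varpi_iterate\<close>.
\<close>

definition \<omega> :: "nat \<Rightarrow> real" where
  "\<omega> k = num (x (Suc k)) (u (Suc k)) / den k"

lemma conjugate_y: "convex_conjugate f (y (Suc k)) = ereal (K (x k) \<bullet> y (Suc k) - fr (K (x k)))"
  by (rule convex_conjugate_at_subgradient[OF y_subgradient fK_eq[OF x_in_S]])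

lemma varpi_eq:
  assumes "a \<in> T" "convex_conjugate f b = ereal c" "m / 2 < K a \<bullet> b - c"
  shows "varpi_fun S g h f K \<delta> m a b v = ereal (num a v / (K a \<bullet> b - c))"
  using assms phi_eq[of a v] merit_bounds(1) by (simp add: varpi_fun_def effective_domain_def)

text \<open>
On the region where \<open>\<varpi>\<close> is a quotient, the conjugate is finite: it is below infinity by the guard
and above minus infinity by Fenchel-Young.
\<close>

lemma varpi_cases:
  obtains "varpi_fun S g h f K \<delta> m a b v = \<infinity>"
  | c where "a \<in> T" "convex_conjugate f b = ereal c" "m / 2 < K a \<bullet> b - c"
proof (cases "b \<in> effective_domain (convex_conjugate f) \<and> ereal (m / 2) < ereal (K a \<bullet> b) - convex_conjugate f b")
  case True
  have "ereal (K (x 0) \<bullet> b - fr (K (x 0))) \<le> convex_conjugate f b"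
    by (rule convex_conjugate_ge) (rule fK_eq[OF x_in_S])
  then obtain c where c: "convex_conjugate f b = ereal c"
    using True by (cases "convex_conjugate f b") (auto simp: effective_domain_def)
  then have m: "m / 2 < K a \<bullet> b - c"
    using True by simp
  show thesis
  proof (cases "a \<in> T")
    case True
    then show thesis
      using that(2) c m by blast
  next
    case False
    then have "varpi_fun S g h f K \<delta> m a b v = \<infinity>"
      using phi_infinity[OF False] c m merit_bounds(1) by (simp add: varpi_fun_def)
    then show thesis
      by (rule that(1))
  qed
next
  case False
  then have "varpi_fun S g h f K \<delta> m a b v = \<infinity>"
    unfolding varpi_fun_def by (rule if_not_P)
  then show thesis
    by (rule that(1))
qed

lemma den_conjugate: "K (x (Suc k)) \<bullet> y (Suc k) - (K (x k) \<bullet> y (Suc k) - fr (K (x k))) = den k"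
  by (simp add: den_def inner_diff_right inner_commute)

lemma varpi_iterate:
  assumes "m / 2 < den k"
  shows "varpi_fun S g h f K \<delta> m (x (Suc k)) (y (Suc k)) (u (Suc k)) = ereal (\<omega> k)"
  using varpi_eq[OF x_in_T conjugate_y, of "Suc k" k] assms unfolding den_conjugate by (simp add: \<omega>_def)

text \<open>
Fenchel-Young at \<open>K (x k)\<close> bounds the denominator of \<open>\<varpi>\<close> by a bilinear function of the first two
variables, with equality at the iterate. The increment of that function is linear up to a
product of two increments.
\<close>

lemma varpi_subgradient:
  assumes dk: "m / 2 < den k"
  shows "(1 / den k) *\<^sub>R ((x_part k, 0, u_part k) - \<omega> k *\<^sub>R (Kt (y (Suc k)), K (x (Suc k)) - K (x k), 0))
    \<in> frechet_subdifferential (\<lambda>(x, y, u). varpi_fun S g h f K \<delta> m x y u) (x (Suc k), y (Suc k), u (Suc k))"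
  unfolding \<omega>_def
proof (rule quotient_frechet_subgradient)
  let ?a = "(x (Suc k), y (Suc k), u (Suc k))"
  let ?Q = "(Kt (y (Suc k)), K (x (Suc k)) - K (x k), 0::'a)"
  show "(case ?a of (x, y, u) \<Rightarrow> varpi_fun S g h f K \<delta> m x y u) = ereal (num (x (Suc k)) (u (Suc k)) / den k)"
    using varpi_iterate[OF dk] by (simp add: \<omega>_def)
  show "0 \<le> num (x (Suc k)) (u (Suc k))"
    by (rule num_ge_0[OF x_in_T])
  show "0 < den k"
    using dk merit_bounds(1) by simp
  fix \<epsilon> :: real assume \<epsilon>: "0 < \<epsilon>"
  have fst: "(fst \<longlongrightarrow> x (Suc k)) (at ?a)"
    using tendsto_fst[OF tendsto_ident_at, of ?a UNIV] by simp
  have snd: "((\<lambda>z. fst (snd z)) \<longlongrightarrow> y (Suc k)) (at ?a)"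
    using tendsto_fst[OF tendsto_snd[OF tendsto_ident_at], of ?a UNIV] by simp
  have "\<forall>\<^sub>F z in at ?a. dist (fst (snd z)) (y (Suc k)) < \<epsilon> / K_bound"
    using snd by (rule tendstoD) (use \<epsilon> K_bound in simp)
  with numerator_first_order_at[where k = k, OF \<epsilon> fst]
  show "\<forall>\<^sub>F z in at ?a. (case z of (x, y, u) \<Rightarrow> varpi_fun S g h f K \<delta> m x y u) = \<infinity> \<or>
      (\<exists>n D. (case z of (x, y, u) \<Rightarrow> varpi_fun S g h f K \<delta> m x y u) = ereal (n / D) \<and> 0 \<le> n \<and> 0 < D \<and>
        num (x (Suc k)) (u (Suc k)) + (x_part k, 0, u_part k) \<bullet> (z - ?a) - \<epsilon> * norm (z - ?a) \<le> n \<and>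
        D \<le> den k + ?Q \<bullet> (z - ?a) + \<epsilon> * norm (z - ?a))"
  proof eventually_elim
    case (elim z)
    obtain z1 z2 z3 where z: "z = (z1, z2, z3)"
      by (cases z)
    show ?case
    proof (cases rule: varpi_cases[of z1 z2 z3])
      case 1
      then show ?thesis
        by (simp add: z)
    next
      case (2 c)
      define e1 where "e1 = z1 - x (Suc k)"
      define e2 where "e2 = z2 - y (Suc k)"
      have e1_le: "norm e1 \<le> norm (z - ?a)"
        using norm_fst_le[of "z1 - x (Suc k)" "(z2 - y (Suc k), z3 - u (Suc k))"] by (simp add: z e1_def)
      have le: "\<epsilon> * norm (z1 - x (Suc k)) \<le> \<epsilon> * norm (z - ?a)"
        using e1_le \<epsilon> by (simp add: e1_def)
      have "num (x (Suc k)) (u (Suc k)) + (x_part k, 0, u_part k) \<bullet> (z - ?a) - \<epsilon> * norm (z - ?a) \<le> num z1 z3"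
        using elim(1)[rule_format, of z3] 2(1) le by (simp add: z)
      moreover have "K z1 \<bullet> z2 - c \<le> den k + ?Q \<bullet> (z - ?a) + \<epsilon> * norm (z - ?a)"
      proof -
        have "K (x k) \<bullet> z2 - fr (K (x k)) \<le> c"
          using convex_conjugate_ge[where \<psi> = f and v = z2, OF fK_eq[OF x_in_S[of k]]] 2(2) by simp
        then have "K z1 \<bullet> z2 - c \<le> K z1 \<bullet> z2 - K (x k) \<bullet> z2 + fr (K (x k))"
          by simp
        also have "\<dots> = den k + (K e1 \<bullet> y (Suc k) + (K (x (Suc k)) - K (x k)) \<bullet> e2) + K e1 \<bullet> e2"
          by (simp add: den_def e1_def e2_def K.diff inner_simps inner_commute)
        also have "K e1 \<bullet> y (Suc k) + (K (x (Suc k)) - K (x k)) \<bullet> e2 = ?Q \<bullet> (z - ?a)"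
          by (simp add: z e1_def e2_def inner_K)
        also have "K e1 \<bullet> e2 \<le> norm (K e1) * norm e2"
          by (rule norm_cauchy_schwarz)
        also have "\<dots> \<le> (K_bound * norm (z - ?a)) * (\<epsilon> / K_bound)"
        proof (rule mult_mono)
          show "norm (K e1) \<le> K_bound * norm (z - ?a)"
            using K_bound(2)[of e1] mult_left_mono[OF e1_le, of K_bound] K_bound(1) by linarith
          show "norm e2 \<le> \<epsilon> / K_bound"
            using elim(2) by (simp add: z e2_def dist_norm)
        qed (use K_bound(1) in auto)
        also have "\<dots> = \<epsilon> * norm (z - ?a)"
          using K_bound(1) by simp
        finally show ?thesis
          by simp
      qed
      moreover have "varpi_fun S g h f K \<delta> m z1 z2 z3 = ereal (num z1 z3 / (K z1 \<bullet> z2 - c))"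
        by (rule varpi_eq[OF 2])
      moreover have "0 \<le> num z1 z3" "0 < K z1 \<bullet> z2 - c"
        using num_ge_0[OF 2(1)] 2(3) merit_bounds(1) by auto
      ultimately show ?thesis
        unfolding z prod.case by blast
    qed
  qed
qed

text \<open>
The linearization differs from \<open>f (K (x k))\<close>, which exceeds \<open>m\<close>, by a bounded multiple of a
vanishing step. Hence the iterates eventually lie where \<open>\<varpi>\<close> is a quotient.
\<close>

lemma den_eventually: "\<forall>\<^sub>F k in sequentially. m / 2 < den k"
proof -
  obtain B where B: "0 < B" "\<And>k. norm (y (Suc k)) \<le> B"
    by (rule y_bounded) blast
  have "(\<lambda>k. B * (K_bound * \<Delta> k)) \<longlonglongrightarrow> B * (K_bound * 0)"
    by (intro tendsto_intros \<Delta>_lim)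
  then have "\<forall>\<^sub>F k in sequentially. B * (K_bound * \<Delta> k) < m / 2"
    by (rule order_tendstoD(2)) (use merit_bounds(1) in simp)
  then show ?thesis
  proof (rule eventually_mono)
    fix k assume k: "B * (K_bound * \<Delta> k) < m / 2"
    have "\<bar>y (Suc k) \<bullet> (K (x (Suc k)) - K (x k))\<bar> \<le> norm (y (Suc k)) * norm (K (x (Suc k)) - K (x k))"
      by (rule Cauchy_Schwarz_ineq2)
    also have "\<dots> \<le> B * (K_bound * \<Delta> k)"
      using B K_step_le[of k] by (intro mult_mono) auto
    finally show "m / 2 < den k"
      using k fx_bounds(1)[of k] unfolding den_def by linarith
  qed
qed

text \<open>
The lower bound holds because the linearization of a convex function lies below it; the upper
bounds are the descent inequality with divisor \<open>den k\<close>.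
\<close>

lemma \<omega>_bounds:
  assumes "m / 2 < den k"
  shows "\<theta> (Suc k) \<le> \<omega> k" "\<omega> k \<le> \<theta> k - decrease_rate * (\<Delta> k)\<^sup>2" "\<omega> k \<le> \<theta> k" "0 \<le> \<omega> k"
proof -
  have den: "0 < den k"
    using assms merit_bounds(1) by simp
  show le: "\<theta> (Suc k) \<le> \<omega> k"
    unfolding \<theta>_eq[of "Suc k"] \<omega>_def using den den_le[of k] num_ge_0[OF x_in_T] fK_pos[OF x_in_S]
    by (intro divide_left_mono) auto
  show "\<omega> k \<le> \<theta> k - decrease_rate * (\<Delta> k)\<^sup>2"
    unfolding \<omega>_def using den den_le[of k] fx_bounds(2)[of "Suc k"] by (intro quotient_descent) auto
  then show "\<omega> k \<le> \<theta> k"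
    using decrease_rate_pos by (smt (verit) mult_nonneg_nonneg zero_le_power2)
  show "0 \<le> \<omega> k"
    using le \<theta>_nonneg[of "Suc k"] by linarith
qed

text \<open>
The subgradient of \<open>\<varpi>\<close> has no term in a difference of \<open>y\<close> iterates, so the steps of \<open>y\<close> do not
enter the bound. Its residual \<open>\<theta> k - \<omega> k\<close> is at most \<open>\<omega> (k - 1) - \<omega> k\<close> by interlacing.
\<close>

lemma summable_of_KL_varpi:
  assumes KL: "KL_function (\<lambda>(x, y, u). varpi_fun S g h f K \<delta> m x y u)"
  shows "summable \<Delta>"
proof -
  obtain n where n: "\<And>k. k \<ge> n \<Longrightarrow> m / 2 < den k"
    using den_eventually unfolding eventually_sequentially by blast
  obtain C where C: "0 < C" "\<And>k \<eta>. \<eta> \<le> \<theta> k \<Longrightarrow> norm (x_part k - \<eta> *\<^sub>R Kt (y (Suc k))) \<le> C * (\<Delta> k + (\<theta> k - \<eta>))"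
    by (rule x_part_residual) blast
  obtain B where B: "0 < B" "\<And>k. norm (y (Suc k)) \<le> B"
    by (rule y_bounded) blast
  define w where "w k = (1 / den k) *\<^sub>R ((x_part k, 0, u_part k) - \<omega> k *\<^sub>R (Kt (y (Suc k)), K (x (Suc k)) - K (x k), 0))" for k
  define C2 where "C2 = C + \<theta> 0 * K_bound + 1 / (\<delta> * \<sigma>)"
  have C2: "0 \<le> C2"
    using C(1) \<theta>_nonneg[of 0] K_bound(1) delta(1) sigma(1) by (auto simp: C2_def intro!: add_nonneg_nonneg)
  have w_bound: "norm (w k) \<le> C2 * 2 / m * (\<Delta> k + (\<theta> k - \<omega> k))" if k: "k \<ge> n" for k
  proof -
    note \<omega> = \<omega>_bounds[OF n[OF k]]
    let ?v = "(x_part k - \<omega> k *\<^sub>R Kt (y (Suc k)), - \<omega> k *\<^sub>R (K (x (Suc k)) - K (x k)), u_part k)"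
    have "w k = (1 / den k) *\<^sub>R ?v"
      by (simp add: w_def)
    then have "norm (w k) = 1 / den k * norm ?v"
      using n[OF k] merit_bounds(1) by (simp only: norm_scaleR) simp
    also have "\<dots> \<le> 1 / (m / 2) * norm ?v"
      using n[OF k] merit_bounds(1) by (intro mult_right_mono divide_left_mono) auto
    also have "\<dots> \<le> 1 / (m / 2) * (C2 * (\<Delta> k + (\<theta> k - \<omega> k)))"
    proof (rule mult_left_mono)
      have "norm (- \<omega> k *\<^sub>R (K (x (Suc k)) - K (x k))) = \<omega> k * norm (K (x (Suc k)) - K (x k))"
        using \<omega>(4) by simp
      also have "\<dots> \<le> \<theta> 0 * (K_bound * \<Delta> k)"
        using \<omega>(3,4) \<theta>_le[of k] K_step_le[of k] by (intro mult_mono) auto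
      finally have 2: "norm (- \<omega> k *\<^sub>R (K (x (Suc k)) - K (x k))) \<le> \<theta> 0 * K_bound * \<Delta> k"
        by simp
      have "norm ?v \<le> norm (x_part k - \<omega> k *\<^sub>R Kt (y (Suc k))) + (norm (- \<omega> k *\<^sub>R (K (x (Suc k)) - K (x k))) + norm (u_part k))"
        using norm_Pair_le[of "x_part k - \<omega> k *\<^sub>R Kt (y (Suc k))" "(- \<omega> k *\<^sub>R (K (x (Suc k)) - K (x k)), u_part k)"]
          norm_Pair_le[of "- \<omega> k *\<^sub>R (K (x (Suc k)) - K (x k))" "u_part k"] by linarith
      also have "\<dots> \<le> C * (\<Delta> k + (\<theta> k - \<omega> k)) + (\<theta> 0 * K_bound * \<Delta> k + 1 / (\<delta> * \<sigma>) * \<Delta> k)"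
        by (intro add_mono C(2) \<omega>(3) 2 u_part_le)
      also have "\<dots> \<le> C2 * (\<Delta> k + (\<theta> k - \<omega> k))"
      proof -
        have "0 \<le> (\<theta> 0 * K_bound + 1 / (\<delta> * \<sigma>)) * (\<theta> k - \<omega> k)"
          using \<theta>_nonneg[of 0] K_bound(1) delta(1) sigma(1) \<omega>(3)
          by (intro mult_nonneg_nonneg add_nonneg_nonneg) auto
        then show ?thesis
          by (simp add: C2_def algebra_simps)
      qed
      finally show "norm ?v \<le> C2 * (\<Delta> k + (\<theta> k - \<omega> k))" .
    qed (use merit_bounds in auto)
    finally show ?thesis
      by (simp add: mult_ac)
  qed
  define z where "z k = (x (Suc k), y (Suc k), u (Suc k))" for k
  have "summable (\<lambda>k. \<Delta> (Suc k))"
  proof (rule KL_function_finite_length[OF KL, where z = z and w = w and r = \<omega>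
        and N = n and C = "C2 * 2 / m" and c = decrease_rate and l = \<theta>_star])
    have "bounded (range (\<lambda>k. y (Suc k)))"
      using B by (auto simp: bounded_iff)
    then have "bounded (range (\<lambda>k. x (Suc k)) \<times> range (\<lambda>k. y (Suc k)) \<times> range (\<lambda>k. u (Suc k)))"
      by (intro bounded_Times bounded_x bounded_u)
    then show "bounded (range z)"
      by (rule bounded_subset) (auto simp: z_def)
    show "(case z k of (x, y, u) \<Rightarrow> varpi_fun S g h f K \<delta> m x y u) = ereal (\<omega> k)" if "k \<ge> n" for k
      using varpi_iterate[OF n[OF that]] by (simp add: z_def)
    show "w (Suc k) \<in> frechet_subdifferential (\<lambda>(x, y, u). varpi_fun S g h f K \<delta> m x y u) (z (Suc k))"
      if "k \<ge> n" for k
      unfolding w_def z_def using that by (intro varpi_subgradient n) simp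
    show "norm (w (Suc k)) \<le> C2 * 2 / m * (\<Delta> (Suc k) + (\<omega> k - \<omega> (Suc k)))" if "k \<ge> n" for k
    proof -
      have "norm (w (Suc k)) \<le> C2 * 2 / m * (\<Delta> (Suc k) + (\<theta> (Suc k) - \<omega> (Suc k)))"
        using that by (intro w_bound) simp
      also have "\<dots> \<le> C2 * 2 / m * (\<Delta> (Suc k) + (\<omega> k - \<omega> (Suc k)))"
        using \<omega>_bounds(1)[OF n[OF that]] C2 merit_bounds(1) by (intro mult_left_mono) auto
      finally show ?thesis .
    qed
    show "decrease_rate * (\<Delta> (Suc k))\<^sup>2 \<le> \<omega> k - \<omega> (Suc k)" if "k \<ge> n" for k
      using \<omega>_bounds(1)[OF n[OF that]] \<omega>_bounds(2)[OF n[of "Suc k"]] that by simp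
    show "\<omega> \<longlonglongrightarrow> \<theta>_star"
    proof (rule tendsto_sandwich[OF _ _ LIMSEQ_Suc[OF \<theta>_lim] \<theta>_lim])
      show "\<forall>\<^sub>F k in sequentially. \<theta> (Suc k) \<le> \<omega> k" "\<forall>\<^sub>F k in sequentially. \<omega> k \<le> \<theta> k"
        using den_eventually by (auto elim!: eventually_mono intro: \<omega>_bounds)
    qed
    fix s :: "nat \<Rightarrow> nat" and p
    assume s: "strict_mono s" and zs: "(z \<circ> s) \<longlonglongrightarrow> p"
    have x_lim: "(\<lambda>j. x (Suc (s j))) \<longlonglongrightarrow> fst p"
      using tendsto_fst[OF zs] by (simp add: z_def)
    have y_lim: "(\<lambda>j. y (Suc (s j))) \<longlonglongrightarrow> fst (snd p)"
      using tendsto_fst[OF tendsto_snd[OF zs]] by (simp add: z_def)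
    have u_lim: "(\<lambda>j. u (Suc (s j))) \<longlonglongrightarrow> snd (snd p)"
      using tendsto_snd[OF tendsto_snd[OF zs]] by (simp add: z_def)
    note cl = cluster_point_properties[OF s x_lim y_lim]
    have "snd (snd p) = fst p"
      using LIMSEQ_unique[OF u_lim cl(1)] .
    then obtain p0 q where p: "p = (p0, q, p0)"
      by (metis prod.collapse)
    have p0: "p0 \<in> T" and conj: "convex_conjugate f q = ereal (K p0 \<bullet> q - fr (K p0))"
      using cl(2,3) by (auto simp: p intro!: convex_conjugate_at_subgradient fK_eq)
    have "varpi_fun S g h f K \<delta> m p0 q p0 = ereal (num p0 p0 / (K p0 \<bullet> q - (K p0 \<bullet> q - fr (K p0))))"
      using cl(5) merit_bounds(1) by (intro varpi_eq[OF p0 conj]) (simp add: p)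
    then show "(case p of (x, y, u) \<Rightarrow> varpi_fun S g h f K \<delta> m x y u) = ereal \<theta>_star"
      using cl(4) by (simp add: p num_def)
  qed (use decrease_rate_pos \<Delta>_nonneg in auto)
  then show ?thesis
    by (simp add: summable_Suc_iff)
qed

section \<open>Convergence to a stationary point\<close>

lemma x_convergent:
  assumes "summable \<Delta>"
  obtains p where "x \<longlonglongrightarrow> p"
proof -
  have "summable (\<lambda>k. x (Suc k) - x k)"
    by (rule summable_comparison_test'[OF assms]) (use x_step_le in auto)
  then have "(\<lambda>n. \<Sum>k<n. x (Suc k) - x k) \<longlonglongrightarrow> (\<Sum>k. x (Suc k) - x k)"
    by (rule summable_LIMSEQ)
  then have "(\<lambda>n. x n - x 0) \<longlonglongrightarrow> (\<Sum>k. x (Suc k) - x k)"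
    by (simp only: sum_lessThan_telescope)
  from tendsto_add[OF this tendsto_const[of "x 0"]] show thesis
    using that by simp
qed

text \<open>
The limit of \<open>\<xi>\<close> is a subgradient \<open>e\<close> at \<open>p\<close> of \<open>g\<close> restricted to \<open>S\<close>. Subtracting its affine minorant from \<open>g\<close>
gives a function \<open>F\<close> that is nonnegative on \<open>S\<close> and zero at \<open>p\<close>. The separation lemmas split
\<open>e\<close> into a subgradient of \<open>g\<close> and a normal vector of \<open>S\<close>. In the polyhedral case, the compact set \<open>S\<close> is
a polytope.
\<close>

lemma limit_stationary:
  assumes x: "x \<longlonglongrightarrow> p"
    and qualification:
      "rel_interior S \<inter> rel_interior (effective_domain g) \<noteq> {} \<or>
       (polyhedron S \<and> S \<inter> rel_interior (effective_domain g) \<noteq> {})"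
  shows "lifted_stationary S g h f K p"
proof -
  obtain s q where s: "strict_mono s" and q: "(\<lambda>j. y (Suc (s j))) \<longlonglongrightarrow> q"
    by (rule y_convergent_subsequence[of id]) auto
  have x_lim: "(\<lambda>j. x (Suc (s j))) \<longlonglongrightarrow> p"
    using LIMSEQ_subseq_LIMSEQ[OF LIMSEQ_Suc[OF x] s] by (simp add: o_def)
  note cl = cluster_point_properties[OF s x_lim q]
  define e where "e = \<theta>_star *\<^sub>R Kt q - H p"
  define F where "F z = gr z - gr p - e \<bullet> (z - p)" for z
  let ?D = "effective_domain g"
  have gconv: "convex_on ?D gr"
    by (rule convex_on_real_of_convex_fun[OF g(2,1)])
  have F: "convex_on ?D F"
  proof (rule convex_onI)
    fix t :: real and a b assume "0 < t" "t < 1" "a \<in> ?D" "b \<in> ?D"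
    then show "F ((1 - t) *\<^sub>R a + t *\<^sub>R b) \<le> (1 - t) * F a + t * F b"
      using convex_onD[OF gconv, of t a b] by (simp add: F_def inner_simps algebra_simps)
  qed (rule convex_on_imp_convex[OF gconv])
  have nonneg: "0 \<le> F z" if "z \<in> S \<inter> ?D" for z
    using cl(6)[OF that] by (simp add: F_def e_def)
  have Fp: "F p = 0"
    by (simp add: F_def)
  obtain w where w: "\<And>z. z \<in> S \<Longrightarrow> w \<bullet> (z - p) \<le> 0" "\<And>z. z \<in> ?D \<Longrightarrow> 0 \<le> F z + w \<bullet> (z - p)"
    using qualification
  proof
    assume "rel_interior S \<inter> rel_interior ?D \<noteq> {}"
    from normal_separation_rel_interior[OF F S(1) this nonneg cl(2) Fp] that show thesis
      by blast
  next
    assume *: "polyhedron S \<and> S \<inter> rel_interior ?D \<noteq> {}"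
    then have "polytope S"
      using S(2) by (simp add: polytope_eq_bounded_polyhedron compact_imp_bounded)
    from normal_separation_polytope[OF F this _ nonneg cl(2) Fp] * that show thesis
      by blast
  qed
  have gp: "g p = ereal (gr p)"
    by (rule g_eq[OF cl(2)])
  have "is_subgradient g p (e - w)"
    unfolding is_subgradient_def
  proof (intro conjI allI)
    show "\<bar>g p\<bar> \<noteq> \<infinity>"
      using gp by (cases "g p") auto
    fix z
    show "g p + ereal ((e - w) \<bullet> (z - p)) \<le> g z"
    proof (cases "z \<in> ?D")
      case True
      have "gr p + (e - w) \<bullet> (z - p) \<le> gr z"
        using w(2)[OF True] by (simp add: F_def inner_diff_left)
      then show ?thesis
        using gp proper_real[OF g(1) True] by (metis ereal_less_eq(3) plus_ereal.simps(1))
    qed (simp add: effective_domain_def)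
  qed
  then have v: "e - w \<in> limiting_subdifferential g p"
    by (rule is_subgradient_imp_limiting)
  have "is_subgradient (indicator_fun S) p w"
    using w(1) cl(2) by (auto simp: is_subgradient_def indicator_fun_def)
  then have w': "w \<in> limiting_subdifferential (indicator_fun S) p"
    by (rule is_subgradient_imp_limiting)
  have q': "q \<in> limiting_subdifferential f (K p)"
    by (rule is_subgradient_imp_limiting[OF cl(3)])
  have "fr (K p) * \<theta>_star = gr p + h p"
    using cl(4) fK_pos[of p] cl(2) by simp
  moreover have "real_of_ereal (g p + ereal (h p)) = gr p + h p"
    using gp by (cases "g p") auto
  ultimately have "0 = fr (K p) *\<^sub>R ((e - w) + H p + w) - real_of_ereal (g p + ereal (h p)) *\<^sub>R Kt q"
    by (simp add: e_def)
  then show ?thesis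
    unfolding lifted_stationary_def using v w' q' by blast
qed

end

theorem theorem9:
  fixes S :: "(real ^ 'n) set"
    and g :: "real ^ 'n \<Rightarrow> ereal"
    and h :: "real ^ 'n \<Rightarrow> real"
    and f :: "real ^ 'p \<Rightarrow> ereal"
    and K :: "real ^ 'n \<Rightarrow> real ^ 'p"
    and L \<delta> \<sigma> m M :: real
    and x u :: "nat \<Rightarrow> real ^ 'n"
    and y :: "nat \<Rightarrow> real ^ 'p"
    and \<theta> :: "nat \<Rightarrow> real"
  assumes linear_K: "linear K"
    and S: "S \<noteq> {}" "convex S" "compact S"
    and g: "proper_fun g" "convex_fun g" "lsc_fun g"
    and h: "\<exists>U. open U \<and> S \<subseteq> U \<and> lipschitz_gradient_on L U h"
    and f: "proper_fun f" "convex_fun f" "lsc_fun f"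
    and K_S: "K ` S \<subseteq> interior (effective_domain f)"
    and f_pos: "\<forall>z\<in>S. 0 < f (K z)"
    and S_dom_g: "S \<inter> effective_domain g \<noteq> {}"
    and numerator_nonneg: "0 \<le> (INF z\<in>S. g z + ereal (h z))"
    and qualification:
      "rel_interior S \<inter> rel_interior (effective_domain g) \<noteq> {} \<or>
       (polyhedron S \<and> S \<inter> rel_interior (effective_domain g) \<noteq> {})"
    and sigma: "0 < \<sigma>" "\<sigma> < 2"
    and delta: "0 < \<delta>" "L = 0 \<or> \<delta> < 1 / L"
    and algorithm: "FPSA S g h f K \<delta> \<sigma> x y u \<theta>"
    and merit_bounds: "0 < m" "0 < M"
      "ereal m < (INF k. f (K (x k)))" "(SUP k. f (K (x k))) \<le> ereal M"
    and conditions: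
      "((\<forall>\<^sub>F k in sequentially. calm_at (convex_conjugate f) (y k)) \<and>
        KL_function (\<lambda>(x, y, u). varpi_fun S g h f K \<delta> m x y u)) \<or>
       ((\<exists>U L'. open U \<and> K ` S \<subseteq> U \<and> U \<subseteq> effective_domain f \<and>
           lipschitz_gradient_on L' U (\<lambda>z. real_of_ereal (f z))) \<and>
        KL_function (\<lambda>(x, u). vartheta_fun S g h f K \<delta> x u))"
  shows "summable (\<lambda>k. norm (x k - x (Suc k)) + norm (u k - u (Suc k))) \<and>
         (\<exists>xbar. x \<longlonglongrightarrow> xbar \<and> lifted_stationary S g h f K xbar)"
proof -
  interpret fractional_splitting S g h f K L \<delta> \<sigma> m M x u y \<theta>
    by (rule fractional_splitting.intro) fact+
  have summable: "summable \<Delta>"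
    using conditions
  proof (elim disjE conjE exE)
    assume "KL_function (\<lambda>(x, y, u). varpi_fun S g h f K \<delta> m x y u)"
    then show ?thesis
      by (rule summable_of_KL_varpi)
  next
    fix U L'
    assume "open U" "K ` S \<subseteq> U" "U \<subseteq> effective_domain f"
      "lipschitz_gradient_on L' U (\<lambda>z. real_of_ereal (f z))"
      "KL_function (\<lambda>(x, u). vartheta_fun S g h f K \<delta> x u)"
    then show ?thesis
      by (rule summable_of_KL_vartheta)
  qed
  then obtain p where "x \<longlonglongrightarrow> p"
    by (rule x_convergent)
  with limit_stationary[OF this qualification] summable show ?thesis
    unfolding \<Delta>_def by blast
qed

end
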